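(* Let $p$ be a prime. Assume that every finite $M_p$-group of odd order is a super $M_p$-group. Then every normal subgroup of a finite $M_p$-group of odd order is also an $M_p$-group.
   Context: All groups are finite. For a prime $p$, $\mathrm{IBr}(G)$ denotes the set of irreducible $p$-Brauer characters of $G$. A Brauer character is linear if it has degree $1$. For $H\le G$ and a $p$-Brauer character $\lambda$ of $H$, $\lambda^G$ denotes the induced Brauer character; "$\lambda$ induces $\varphi$" means $\lambda^G=\varphi$. An irreducible $p$-Brauer character is primitive if it is not induced from a $p$-Brauer character of a proper subgroup. A $p$-Brauer character of $G$ is monomial if it is induced from a linear $p$-Brauer character of some (not necessarily proper) subgroup of $G$. $G$ is an $M_p$-group if every $\varphi\in\mathrm{IBr}(G)$ is monomial. A character $\varphi\in\mathrm{IBr}(G)$ is super-monomial if every primitive $p$-Brauer character (of some subgroup of $G$, possibly $G$ itself) inducing $\varphi$ is linear. $G$ is a super $M_p$-group if every $\varphi\in\mathrm{IBr}(G)$ is super-monomial. *)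

theory Defs
  imports
    "HOL-Algebra.Multiplicative_Group"
    "HOL-Computational_Algebra.Primes"
    "Jordan_Normal_Form.VS_Connect"
    "Jordan_Normal_Form.Char_Poly"
begin

section \<open>Reduction modulo a maximal ideal over p\<close>

text \<open>
  Brauer characters depend on the choice of a maximal ideal \<open>M\<close> containing \<open>p\<close> of the ring \<open>R\<close> of
  algebraic integers in the complex numbers.  The choice is encoded by the canonical surjection
  \<open>red\<close> from \<open>R\<close> to \<open>R/M\<close>: the field \<open>R/M\<close> is the type \<open>'k\<close> and \<open>M\<close> is the kernel of \<open>red\<close>.
  (Such a field is an algebraic closure of the prime field.)  Values of \<open>red\<close> outside \<open>R\<close> are
  irrelevant.
\<close>

definition brauer_reduction :: "nat \<Rightarrow> (complex \<Rightarrow> 'k::field) \<Rightarrow> bool" where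
  "brauer_reduction p red \<longleftrightarrow>
     CHAR('k) = p \<and>
     red 1 = 1 \<and>
     (\<forall>x y. algebraic_int x \<longrightarrow> algebraic_int y \<longrightarrow>
        red (x + y) = red x + red y \<and> red (x * y) = red x * red y) \<and>
     red ` {x. algebraic_int x} = UNIV"

text \<open>
  \<open>red\<close> restricts to an isomorphism from the complex roots of unity of order prime to \<open>p\<close> onto
  the multiplicative group of \<open>'k\<close>; the following is its inverse.
\<close>

definition brauer_lift :: "nat \<Rightarrow> (complex \<Rightarrow> 'k::field) \<Rightarrow> 'k \<Rightarrow> complex" where
  "brauer_lift p red a = (THE z. (\<exists>m>0. coprime m p \<and> z ^ m = 1) \<and> red z = a)"

section \<open>Matrix representations\<close>

definition representation ::
    "('a, 'b) monoid_scheme \<Rightarrow> nat \<Rightarrow> ('a \<Rightarrow> 'k::field mat) \<Rightarrow> bool" where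
  "representation G n X \<longleftrightarrow>
     n > 0 \<and>
     (\<forall>g\<in>carrier G. X g \<in> carrier_mat n n) \<and>
     X \<one>\<^bsub>G\<^esub> = 1\<^sub>m n \<and>
     (\<forall>g\<in>carrier G. \<forall>h\<in>carrier G. X (g \<otimes>\<^bsub>G\<^esub> h) = X g * X h)"

definition irreducible_representation ::
    "('a, 'b) monoid_scheme \<Rightarrow> nat \<Rightarrow> ('a \<Rightarrow> 'k::field mat) \<Rightarrow> bool" where
  "irreducible_representation G n X \<longleftrightarrow>
     representation G n X \<and>
     (\<forall>W. VectorSpace.subspace class_ring W (module_vec TYPE('k) n) \<and>
          (\<forall>g\<in>carrier G. \<forall>w\<in>W. X g *\<^sub>v w \<in> W) \<longrightarrow>
          W = {0\<^sub>v n} \<or> W = carrier_vec n)"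

section \<open>Brauer characters\<close>

text \<open>
  A subgroup \<open>H\<close> of \<open>G\<close> is treated as the group \<open>G\<lparr>carrier := H\<rparr>\<close>.  Brauer characters of \<open>G\<close> are
  functions on the \<open>p\<close>-regular elements of \<open>G\<close>; they are extended by \<open>0\<close>, so that equality of
  Brauer characters is equality of functions.
\<close>

definition p_regular :: "nat \<Rightarrow> ('a, 'b) monoid_scheme \<Rightarrow> 'a set" where
  "p_regular p G = {g \<in> carrier G. \<not> p dvd group.ord G g}"

text \<open>\<open>proots\<close> counts each eigenvalue with its algebraic multiplicity.\<close>

definition afforded_brauer ::
    "nat \<Rightarrow> (complex \<Rightarrow> 'k::field) \<Rightarrow> ('a, 'b) monoid_scheme \<Rightarrow> ('a \<Rightarrow> 'k mat) \<Rightarrow> 'a \<Rightarrow> complex" where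
  "afforded_brauer p red G X g =
     (if g \<in> p_regular p G
      then (\<Sum>a\<in>#proots (char_poly (X g)). brauer_lift p red a) else 0)"

definition Brauer_characters ::
    "nat \<Rightarrow> (complex \<Rightarrow> 'k::field) \<Rightarrow> ('a, 'b) monoid_scheme \<Rightarrow> ('a \<Rightarrow> complex) set" where
  "Brauer_characters p red G = {afforded_brauer p red G X | n X. representation G n X}"

definition IBr ::
    "nat \<Rightarrow> (complex \<Rightarrow> 'k::field) \<Rightarrow> ('a, 'b) monoid_scheme \<Rightarrow> ('a \<Rightarrow> complex) set" where
  "IBr p red G = {afforded_brauer p red G X | n X. irreducible_representation G n X}"

text \<open>The degree of a Brauer character is its value at the identity.\<close>

definition linear_Brauer ::
    "nat \<Rightarrow> (complex \<Rightarrow> 'k::field) \<Rightarrow> ('a, 'b) monoid_scheme \<Rightarrow> ('a \<Rightarrow> complex) \<Rightarrow> bool" where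
  "linear_Brauer p red G \<theta> \<longleftrightarrow> \<theta> \<in> Brauer_characters p red G \<and> \<theta> \<one>\<^bsub>G\<^esub> = 1"

text \<open>
  For \<open>x\<close> \<open>p\<close>-regular, all conjugates of \<open>x\<close> are \<open>p\<close>-regular, so those lying in \<open>H\<close> are in the
  domain of a Brauer character of \<open>H\<close>.
\<close>

definition induced_Brauer ::
    "nat \<Rightarrow> ('a, 'b) monoid_scheme \<Rightarrow> 'a set \<Rightarrow> ('a \<Rightarrow> complex) \<Rightarrow> 'a \<Rightarrow> complex" where
  "induced_Brauer p G H \<theta> x =
     (if x \<in> p_regular p G
      then (\<Sum>y\<in>{y \<in> carrier G. y \<otimes>\<^bsub>G\<^esub> x \<otimes>\<^bsub>G\<^esub> inv\<^bsub>G\<^esub> y \<in> H}.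
              \<theta> (y \<otimes>\<^bsub>G\<^esub> x \<otimes>\<^bsub>G\<^esub> inv\<^bsub>G\<^esub> y)) / of_nat (card H)
      else 0)"

definition primitive_Brauer ::
    "nat \<Rightarrow> (complex \<Rightarrow> 'k::field) \<Rightarrow> ('a, 'b) monoid_scheme \<Rightarrow> ('a \<Rightarrow> complex) \<Rightarrow> bool" where
  "primitive_Brauer p red G \<phi> \<longleftrightarrow>
     \<phi> \<in> IBr p red G \<and>
     \<not> (\<exists>H \<psi>. subgroup H G \<and> H \<noteq> carrier G \<and>
          \<psi> \<in> Brauer_characters p red (G\<lparr>carrier := H\<rparr>) \<and>
          induced_Brauer p G H \<psi> = \<phi>)"

definition monomial_Brauer ::
    "nat \<Rightarrow> (complex \<Rightarrow> 'k::field) \<Rightarrow> ('a, 'b) monoid_scheme \<Rightarrow> ('a \<Rightarrow> complex) \<Rightarrow> bool" where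
  "monomial_Brauer p red G \<phi> \<longleftrightarrow>
     \<phi> \<in> Brauer_characters p red G \<and>
     (\<exists>H \<theta>. subgroup H G \<and> linear_Brauer p red (G\<lparr>carrier := H\<rparr>) \<theta> \<and>
        induced_Brauer p G H \<theta> = \<phi>)"

definition super_monomial_Brauer ::
    "nat \<Rightarrow> (complex \<Rightarrow> 'k::field) \<Rightarrow> ('a, 'b) monoid_scheme \<Rightarrow> ('a \<Rightarrow> complex) \<Rightarrow> bool" where
  "super_monomial_Brauer p red G \<phi> \<longleftrightarrow>
     \<phi> \<in> IBr p red G \<and>
     (\<forall>H \<psi>. subgroup H G \<and> primitive_Brauer p red (G\<lparr>carrier := H\<rparr>) \<psi> \<and>
        induced_Brauer p G H \<psi> = \<phi> \<longrightarrow> linear_Brauer p red (G\<lparr>carrier := H\<rparr>) \<psi>)"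

section \<open>\<open>M\<^sub>p\<close>-groups\<close>

definition Mp_group ::
    "nat \<Rightarrow> (complex \<Rightarrow> 'k::field) \<Rightarrow> ('a, 'b) monoid_scheme \<Rightarrow> bool" where
  "Mp_group p red G \<longleftrightarrow>
     group G \<and> finite (carrier G) \<and> (\<forall>\<phi>\<in>IBr p red G. monomial_Brauer p red G \<phi>)"

definition super_Mp_group ::
    "nat \<Rightarrow> (complex \<Rightarrow> 'k::field) \<Rightarrow> ('a, 'b) monoid_scheme \<Rightarrow> bool" where
  "super_Mp_group p red G \<longleftrightarrow>
     group G \<and> finite (carrier G) \<and> (\<forall>\<phi>\<in>IBr p red G. super_monomial_Brauer p red G \<phi>)"

end

theory Submission
  imports Defs "HOL-Algebra.Generated_Groups" "HOL-Computational_Algebra.Fundamental_Theorem_Algebra"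
begin

text \<open>
  Taketa's argument shows that \<open>M\<^sub>p\<close>-groups are solvable, so a proper normal subgroup \<open>N\<close> of \<open>G\<close> lies
  in a normal subgroup \<open>M\<close> of prime index, and by induction it suffices to treat \<open>M\<close>. Let \<open>\<theta>\<close> be an
  irreducible Brauer character of \<open>M\<close>. If \<open>\<theta>\<close> induces an irreducible character of \<open>G\<close>, then a primitive
  character inducing \<open>\<theta>\<close> also induces that character of \<open>G\<close> and is linear by hypothesis. Otherwise \<open>\<theta>\<close>
  is \<open>G\<close>-invariant and extends to some \<open>\<phi>\<close>, which is induced from a linear \<open>\<lambda>\<close> of a subgroup \<open>H\<close>; as
  the restriction of \<open>\<phi>\<close> to \<open>M\<close> is irreducible, \<open>H M = G\<close>, and \<open>\<theta>\<close> is induced from the restriction of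
  \<open>\<lambda>\<close> to \<open>H \<inter> M\<close>.

  The only fact needed about the determination of representations by Brauer characters is that a
  representation with the Brauer character of an irreducible one is irreducible, with the same kernel; it
  follows from Burnside's theorem, because equal Brauer characters give equal traces on the whole group.
\<close>

section \<open>Algebraic integers\<close>

text \<open>Monomiality and super-monomiality are equations between class functions, while
  restricting, extending and inducing need representations. The bridge is \<open>Ind_brauer\<close>:
  an induced character is afforded by an explicit matrix representation, and irreducibility then
  passes to it from any representation with the same character. Equal Brauer characters give equal
  traces everywhere because the trace at \<open>g\<close> is determined by its
  \<open>p ^ a\<close>-th power, which is the trace at a p-regular power of \<open>g\<close>, and
  Frobenius is injective. Eigenvectors, Schur's lemma and the rescaling of an intertwiner require an
  algebraically closed residue field; this is the reason for proving that the algebraic integers are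
  integrally closed. In Taketa's argument a group acting trivially on all composition factors need
  not act trivially, since modular representations are not completely reducible; that the subgroup
  is perfect closes this gap. The assumption concerns groups on natural numbers, so \<open>G\<close>
  is replaced by an isomorphic copy whenever it is applied.\<close>

definition zspan :: "complex set \<Rightarrow> complex set" where
  "zspan B = {\<Sum>b\<in>B. of_int (c b) * b | c. True}"

lemma zspan_base: "finite B \<Longrightarrow> b \<in> B \<Longrightarrow> b \<in> zspan B"
  unfolding zspan_def
  by (rule CollectI, rule exI[of _ "\<lambda>x. if x = b then 1 else 0"]) (simp add: if_distrib[of of_int] if_distrib[of "\<lambda>x. x * _"] sum.delta cong: if_cong)

lemma zspan_0: "0 \<in> zspan B"
  unfolding zspan_def by (rule CollectI, rule exI[of _ "\<lambda>_. 0"]) simp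

lemma zspan_add: "x \<in> zspan B \<Longrightarrow> y \<in> zspan B \<Longrightarrow> x + y \<in> zspan B"
proof -
  assume "x \<in> zspan B" "y \<in> zspan B"
  then obtain c d where "x = (\<Sum>b\<in>B. of_int (c b) * b)" "y = (\<Sum>b\<in>B. of_int (d b) * b)"
    by (auto simp: zspan_def)
  then have "x + y = (\<Sum>b\<in>B. of_int ((\<lambda>b. c b + d b) b) * b)"
    by (simp add: sum.distrib distrib_right)
  then show "x + y \<in> zspan B" unfolding zspan_def by (intro CollectI exI conjI TrueI)
qed

lemma zspan_int:
  assumes "x \<in> zspan B" shows "of_int k * x \<in> zspan B"
proof -
  from assms obtain c where "x = (\<Sum>b\<in>B. of_int (c b) * b)" by (auto simp: zspan_def)
  then have "of_int k * x = (\<Sum>b\<in>B. of_int ((\<lambda>b. k * c b) b) * b)"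
    by (simp add: sum_distrib_left mult.assoc)
  then show ?thesis unfolding zspan_def by (intro CollectI exI conjI TrueI)
qed

lemma zspan_sum: "(\<And>i. i \<in> I \<Longrightarrow> f i \<in> zspan B) \<Longrightarrow> sum f I \<in> zspan B"
  by (induction I rule: infinite_finite_induct) (auto intro: zspan_0 zspan_add)

lemma zspan_minus: "x \<in> zspan B \<Longrightarrow> - x \<in> zspan B"
  using zspan_int[of x B "-1"] by simp

text \<open>Integrality by the determinant trick: a number that maps a nonzero finitely generated
  module into itself is integral. The stabilising numbers form a ring, so closure of the algebraic
  integers under sums and products becomes formal once a common module is found.\<close>

definition zstable :: "complex set \<Rightarrow> complex \<Rightarrow> bool" where
  "zstable B x \<longleftrightarrow> (\<forall>b\<in>B. x * b \<in> zspan B)"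

lemma zstable_zspan:
  assumes "zstable B x" "a \<in> zspan B" shows "x * a \<in> zspan B"
proof -
  from assms obtain c where "a = (\<Sum>b\<in>B. of_int (c b) * b)" by (auto simp: zspan_def)
  then have "x * a = (\<Sum>b\<in>B. of_int (c b) * (x * b))"
    by (simp add: sum_distrib_left algebra_simps)
  then show ?thesis using assms by (auto simp: zstable_def intro!: zspan_sum zspan_int)
qed

lemma zstable_add: "zstable B x \<Longrightarrow> zstable B y \<Longrightarrow> zstable B (x + y)"
  by (auto simp: zstable_def distrib_right intro: zspan_add)

lemma zstable_mult: "zstable B x \<Longrightarrow> zstable B y \<Longrightarrow> zstable B (x * y)"
  using zstable_zspan unfolding zstable_def mult.assoc by blast

lemma zstable_of_int: "finite B \<Longrightarrow> zstable B (of_int k)"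
  by (auto simp: zstable_def intro: zspan_int zspan_base)

text \<open>An element stabilising a finitely generated module is an eigenvalue of an integer matrix.\<close>

lemma zstable_algebraic_int:
  assumes fin: "finite B" and st: "zstable B x" and nz: "b0 \<in> B" "b0 \<noteq> 0"
  shows "algebraic_int x"
proof -
  define n where "n = card B"
  obtain e where e: "bij_betw e {0..<n} B"
    using ex_bij_betw_nat_finite[OF fin] n_def by blast
  have "\<exists>c. \<forall>b\<in>B. x * b = (\<Sum>b'\<in>B. of_int (c b b') * b')"
  proof -
    have "\<forall>b\<in>B. \<exists>c. x * b = (\<Sum>b'\<in>B. of_int (c b') * b')"
      using st by (auto simp: zstable_def zspan_def)
    then show ?thesis by (rule bchoice)
  qed
  then obtain c where c: "\<And>b. b \<in> B \<Longrightarrow> x * b = (\<Sum>b'\<in>B. of_int (c b b') * b')" by blast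
  define A where "A = mat n n (\<lambda>(i,j). c (e i) (e j))"
  have A: "A \<in> carrier_mat n n" by (simp add: A_def)
  interpret oi: comm_ring_hom "of_int :: int \<Rightarrow> complex" by unfold_locales auto
  define C where "C = map_mat (of_int :: int \<Rightarrow> complex) A"
  have oA: "C \<in> carrier_mat n n" using A by (simp add: C_def)
  define v where "v = vec n e"
  have "C *\<^sub>v v = x \<cdot>\<^sub>v v"
  proof (rule eq_vecI)
    fix i assume "i < dim_vec (x \<cdot>\<^sub>v v)"
    then have i: "i < n" by (simp add: v_def)
    then have "e i \<in> B" using e by (auto simp: bij_betw_def)
    have "(C *\<^sub>v v) $ i = (\<Sum>j\<in>{0..<n}. of_int (c (e i) (e j)) * e j)"
      using i A by (simp add: C_def v_def A_def scalar_prod_def)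
    also have "\<dots> = (\<Sum>b'\<in>B. of_int (c (e i) b') * b')"
      by (rule sum.reindex_bij_betw[OF e])
    also have "\<dots> = (x \<cdot>\<^sub>v v) $ i" using c[OF \<open>e i \<in> B\<close>] i by (simp add: v_def)
    finally show "(C *\<^sub>v v) $ i = (x \<cdot>\<^sub>v v) $ i" .
  qed (use A in \<open>auto simp: v_def C_def\<close>)
  moreover have "v \<noteq> 0\<^sub>v n"
  proof
    assume "v = 0\<^sub>v n"
    then have "\<forall>i<n. e i = 0" by (metis index_vec index_zero_vec(1) v_def)
    then show False using e nz by (auto simp: bij_betw_def)
  qed
  ultimately have "eigenvector (C) v x"
    using oA by (auto simp: eigenvector_def v_def)
  then have "eigenvalue (C) x" by (auto simp: eigenvalue_def)
  then have r: "poly (char_poly (C)) x = 0"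
    using eigenvalue_root_char_poly[OF oA] by simp
  have mon: "lead_coeff (char_poly (C)) = 1"
    using degree_monic_char_poly[OF oA] by simp
  have "char_poly (C) = map_poly of_int (char_poly A)"
    using of_int_hom.char_poly_hom[OF A] by (simp add: C_def)
  then have "\<forall>i. coeff (char_poly (C)) i \<in> \<int>" by simp
  then show ?thesis using r mon by (intro algebraic_int.intros) auto
qed

text \<open>With \<open>M\<close> the span of \<open>B\<close>, the new module is
  \<open>M + x M + ... + x^(n-1) M\<close>. The coefficients of \<open>P\<close> are asked to
  stabilise \<open>M\<close> rather than to be integers, so the lemma can be iterated and also
  covers monic equations with algebraic integer coefficients. Keeping 1 in the span guarantees a
  nonzero module.\<close>

lemma zstable_adjoin:
  assumes fin: "finite B" and one: "1 \<in> zspan B" and P: "lead_coeff P = 1" "poly P x = 0"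
    and co: "\<And>i. zstable B (coeff P i)"
  obtains B' where "finite B'" "1 \<in> zspan B'" "zstable B' x" "\<And>c. zstable B c \<Longrightarrow> zstable B' c"
proof -
  define n where "n = degree P"
  have n: "n > 0"
  proof (rule ccontr)
    assume "\<not> n > 0"
    then have "P = [:1:]" using P(1) by (metis degree_eq_zeroE gr0I lead_coeff_pCons(2) n_def)
    then show False using P(2) by simp
  qed
  define B' where "B' = (\<lambda>(b,j). b * x ^ j) ` (B \<times> {..<n})"
  have fB': "finite B'" using fin by (simp add: B'_def)
  have up: "a * x ^ j \<in> zspan B'" if "a \<in> zspan B" "j < n" for a j
  proof -
    from that obtain c where "a = (\<Sum>b\<in>B. of_int (c b) * b)" by (auto simp: zspan_def)
    then have "a * x ^ j = (\<Sum>b\<in>B. of_int (c b) * (b * x ^ j))"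
      by (simp add: sum_distrib_right mult.assoc)
    moreover have "b * x ^ j \<in> zspan B'" if "b \<in> B" for b
      using that \<open>j < n\<close> by (intro zspan_base[OF fB']) (auto simp: B'_def)
    ultimately show ?thesis by (auto intro!: zspan_sum zspan_int)
  qed
  have st: "zstable B' c" if "zstable B c" for c
  proof -
    have "c * (b * x ^ j) \<in> zspan B'" if "b \<in> B" "j < n" for b j
      using up[of "c * b" j] that \<open>zstable B c\<close> by (simp add: zstable_def mult.assoc)
    then show ?thesis by (auto simp: zstable_def B'_def)
  qed
  have "x * (b * x ^ j) \<in> zspan B'" if b: "b \<in> B" and j: "j < n" for b j
  proof (cases "Suc j < n")
    case True
    then have "b * x ^ Suc j \<in> B'" using b by (force simp: B'_def)
    then show ?thesis using zspan_base[OF fB'] by (simp add: algebra_simps)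
  next
    case False
    \<comment> \<open>At the top exponent the monic equation rewrites \<open>x ^ n\<close> by lower
      powers, and its coefficients are absorbed by the old module.\<close>
    then have jn: "Suc j = n" using j by simp
    have "0 = (\<Sum>i\<le>n. coeff P i * x ^ i)" using P(2) by (simp add: poly_altdef n_def)
    also have "\<dots> = (\<Sum>i<n. coeff P i * x ^ i) + x ^ n"
      using P(1) by (simp add: lessThan_Suc_atMost[symmetric] n_def)
    finally have "x ^ n = - (\<Sum>i<n. coeff P i * x ^ i)" by (simp add: eq_neg_iff_add_eq_0 add.commute)
    then have "x * (b * x ^ j) = - (\<Sum>i<n. (coeff P i * b) * x ^ i)"
      using jn by (metis (no_types, lifting) mult.assoc mult.commute mult_minus_right power_Suc sum.cong sum_distrib_left)
    then show ?thesis using co b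
      by (auto intro!: zspan_minus zspan_sum up simp: zstable_def)
  qed
  then have "zstable B' x" by (auto simp: zstable_def B'_def)
  moreover have "1 \<in> zspan B'" using up[OF one n] by simp
  ultimately show ?thesis using that[OF fB'] st by blast
qed

lemma zstable_algebraic_int':
  assumes "finite B" "1 \<in> zspan B" "zstable B x" shows "algebraic_int x"
proof -
  have "\<exists>b0\<in>B. b0 \<noteq> 0"
  proof (rule ccontr)
    assume "\<not> ?thesis"
    then show False using assms(2) by (auto simp: zspan_def)
  qed
  then show ?thesis using zstable_algebraic_int assms by blast
qed

lemma zstable_adjoin_finite:
  assumes "finite C" "\<And>c. c \<in> C \<Longrightarrow> algebraic_int c"
  obtains B where "finite B" "1 \<in> zspan B" "\<And>c. c \<in> C \<Longrightarrow> zstable B c"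
proof -
  have "\<exists>B. finite B \<and> 1 \<in> zspan B \<and> (\<forall>c\<in>C. zstable B c)"
    using assms
  proof (induction C rule: finite_induct)
    case empty
    show ?case using zspan_base[of "{1}" 1] by auto
  next
    case (insert c C)
    then obtain B where B: "finite B" "1 \<in> zspan B" "\<forall>c\<in>C. zstable B c" by auto
    from insert.prems[of c] obtain P where P: "lead_coeff P = 1" "\<forall>i. coeff P i \<in> \<int>" "poly P c = 0"
      by (auto elim: algebraic_int.cases)
    have "zstable B (coeff P i)" for i
      using P(2) zstable_of_int[OF B(1)] by (metis Ints_cases)
    from zstable_adjoin[OF B(1,2) P(1,3) this] B(3) show ?case by (metis insert_iff)
  qed
  then show ?thesis using that by blast
qed

section \<open>The ring of algebraic integers and its integral closedness\<close>

lemma algebraic_int_add: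
  fixes x y :: complex
  assumes "algebraic_int x" "algebraic_int y" shows "algebraic_int (x + y)"
proof -
  obtain B where "finite B" "1 \<in> zspan B" "\<And>c. c \<in> {x,y} \<Longrightarrow> zstable B c"
    using zstable_adjoin_finite[of "{x,y}"] assms by blast
  then show ?thesis by (intro zstable_algebraic_int'[of B] zstable_add) auto
qed

lemma algebraic_int_mult:
  fixes x y :: complex
  assumes "algebraic_int x" "algebraic_int y" shows "algebraic_int (x * y)"
proof -
  obtain B where "finite B" "1 \<in> zspan B" "\<And>c. c \<in> {x,y} \<Longrightarrow> zstable B c"
    using zstable_adjoin_finite[of "{x,y}"] assms by blast
  then show ?thesis by (intro zstable_algebraic_int'[of B] zstable_mult) auto
qed

text \<open>A polynomial has finitely many distinct coefficients, so one module is stable under all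
  of them and the root can be adjoined to it. This is what gives complex roots of lifted polynomials
  a reduction.\<close>

lemma algebraic_int_monic_root:
  fixes x :: complex
  assumes P: "lead_coeff P = 1" "poly P x = 0" and co: "\<And>i. algebraic_int (coeff P i)"
  shows "algebraic_int x"
proof -
  have fin: "finite (range (coeff P))"
  proof -
    have "range (coeff P) \<subseteq> insert 0 (coeff P ` {..degree P})"
      using le_degree by fastforce
    then show ?thesis by (rule finite_subset) auto
  qed
  obtain B where B: "finite B" "1 \<in> zspan B" "\<And>i. zstable B (coeff P i)"
    using zstable_adjoin_finite[OF fin] co by (metis (no_types, lifting) imageE rangeI)
  from zstable_adjoin[OF B(1,2) P B(3)] show ?thesis using zstable_algebraic_int' by metis
qed

lemma algebraic_int_sum:
  fixes f :: "'i \<Rightarrow> complex"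
  shows "(\<And>i. i \<in> I \<Longrightarrow> algebraic_int (f i)) \<Longrightarrow> algebraic_int (sum f I)"
  by (induction I rule: infinite_finite_induct) (auto simp: algebraic_int_add)

lemma algebraic_int_prod:
  fixes f :: "'i \<Rightarrow> complex"
  shows "(\<And>i. i \<in> I \<Longrightarrow> algebraic_int (f i)) \<Longrightarrow> algebraic_int (prod f I)"
  by (induction I rule: infinite_finite_induct) (auto simp: algebraic_int_mult int_imp_algebraic_int)

lemma algebraic_int_power:
  fixes x :: complex
  shows "algebraic_int x \<Longrightarrow> algebraic_int (x ^ n)"
  by (induction n) (auto simp: algebraic_int_mult int_imp_algebraic_int)

lemma algebraic_int_root_of_unity:
  fixes z :: complex
  assumes "z ^ m = 1" "m > 0" shows "algebraic_int z"
proof -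
  define P where "P = monom (1::complex) m + [:-1:]"
  have d: "degree P = m" "lead_coeff P = 1" using assms(2)
    by (auto simp: P_def degree_add_eq_left degree_monom_eq coeff_pCons split: nat.splits)
  have "poly P z = 0" using assms by (simp add: P_def poly_monom)
  moreover have "\<forall>i. coeff P i \<in> \<int>" by (auto simp: P_def coeff_pCons split: nat.splits)
  ultimately show ?thesis using d by (intro algebraic_int.intros) auto
qed

section \<open>Reduction and lifting\<close>

locale brauer =
  fixes p :: nat and red :: "complex \<Rightarrow> 'k::field"
  assumes prime_p: "prime p" and red: "brauer_reduction p red"
begin

lemma char_k: "CHAR('k) = p" using red by (simp add: brauer_reduction_def)

lemma red_1 [simp]: "red 1 = 1" using red by (simp add: brauer_reduction_def)

lemma red_add: "algebraic_int x \<Longrightarrow> algebraic_int y \<Longrightarrow> red (x + y) = red x + red y"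
  using red by (simp add: brauer_reduction_def)

lemma red_mult: "algebraic_int x \<Longrightarrow> algebraic_int y \<Longrightarrow> red (x * y) = red x * red y"
  using red by (simp add: brauer_reduction_def)

lemma red_0 [simp]: "red 0 = 0"
  using red_add[of 0 0] by (metis add_cancel_left_right algebraic_int_0 add_0)

lemma red_minus: "algebraic_int x \<Longrightarrow> red (- x) = - red x"
  using red_add[of x "-x"] by (simp add: algebraic_int_minus eq_neg_iff_add_eq_0 add.commute)

lemma red_sum:
  "(\<And>i. i \<in> I \<Longrightarrow> algebraic_int (f i)) \<Longrightarrow> red (sum f I) = (\<Sum>i\<in>I. red (f i))"
  by (induction I rule: infinite_finite_induct) (auto simp: red_add algebraic_int_sum)

lemma red_prod:
  "(\<And>i. i \<in> I \<Longrightarrow> algebraic_int (f i)) \<Longrightarrow> red (prod f I) = (\<Prod>i\<in>I. red (f i))"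
  by (induction I rule: infinite_finite_induct) (auto simp: red_mult algebraic_int_prod)

lemma red_power: "algebraic_int x \<Longrightarrow> red (x ^ n) = red x ^ n"
  by (induction n) (auto simp: red_mult algebraic_int_power)

lemma red_surj: obtains x where "algebraic_int x" "red x = a"
  using red unfolding brauer_reduction_def by (metis (no_types, lifting) UNIV_I imageE mem_Collect_eq)

lemma of_nat_k_eq_0: "(of_nat m :: 'k) = 0 \<longleftrightarrow> p dvd m"
  using of_nat_eq_0_iff_char_dvd char_k by metis

text \<open>The polynomial is made monic, lifted coefficientwise to algebraic integers and solved in
  the complex numbers. The solution is integral, hence has a reduction, and that reduction is a root
  of \<open>f\<close>.\<close>

lemma alg_closed:
  fixes f :: "'k poly"
  assumes "degree f > 0" shows "\<exists>a. poly f a = 0"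
proof -
  define n where "n = degree f"
  have "\<exists>r. \<forall>a. algebraic_int (r a) \<and> red (r a) = a"
    by (rule choice) (metis red_surj)
  then obtain r where r: "\<And>a. algebraic_int (r a)" "\<And>a. red (r a) = a" by blast
  define l where "l = lead_coeff f"
  have l: "l \<noteq> 0" using assms by (auto simp: l_def)
  \<comment> \<open>The leading coefficient is 1 itself and not a chosen lift of 1, so that
    \<open>F\<close> is monic.\<close>
  define F where "F = monom 1 n + (\<Sum>i<n. monom (r (coeff f i / l)) i)"
  have cF: "coeff F i = (if i = n then 1 else if i < n then r (coeff f i / l) else 0)" for i
    by (simp add: F_def coeff_sum)
  have dF: "degree F = n"
  proof (rule antisym)
    show "degree F \<le> n" by (rule degree_le) (simp add: cF)
    show "n \<le> degree F" by (rule le_degree) (simp add: cF)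
  qed
  obtain z where z: "poly F z = 0"
    using fundamental_theorem_of_algebra_alt[of F] dF assms n_def by (metis degree_pCons_0 less_irrefl)
  have co: "algebraic_int (coeff F i)" for i by (auto simp: cF r int_imp_algebraic_int)
  have az: "algebraic_int z"
    using algebraic_int_monic_root[OF _ z co] dF cF by simp
  have "0 = red (poly F z)" using z by simp
  also have "poly F z = (\<Sum>i\<le>n. coeff F i * z ^ i)" by (simp add: poly_altdef dF)
  also have "red \<dots> = (\<Sum>i\<le>n. red (coeff F i) * red z ^ i)"
    using az co by (simp add: red_sum red_mult red_power algebraic_int_mult algebraic_int_power)
  also have "\<dots> = (\<Sum>i\<le>n. (coeff f i / l) * red z ^ i)"
  proof (rule sum.cong[OF refl])
    fix i assume "i \<in> {..n}"
    then have "red (coeff F i) = coeff f i / l"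
      using l by (cases "i = n") (simp_all add: cF r, simp add: l_def n_def)
    then show "red (coeff F i) * red z ^ i = coeff f i / l * red z ^ i" by simp
  qed
  also have "\<dots> = poly f (red z) / l"
    unfolding poly_altdef n_def sum_divide_distrib times_divide_eq_left ..
  finally have "poly f (red z) = 0" using l by simp
  then show ?thesis by blast
qed

section \<open>Roots of unity and the Brauer lift\<close>

text \<open>The quotient \<open>u\<close> of the two roots reduces to 1. If it were not 1, the sum
  of its powers below \<open>m\<close> would be 0, whereas that sum reduces to \<open>m\<close>,
  which is nonzero in the residue field.\<close>

lemma red_inj_roots:
  assumes z: "z ^ m = 1" and w: "w ^ m = 1" and m: "m > 0" "\<not> p dvd m" and eq: "red z = red w"
  shows "z = w"
proof (rule ccontr)
  assume "z \<noteq> w"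
  have w0: "w \<noteq> 0" using w m by (metis power_0_left zero_neq_one less_irrefl)
  \<comment> \<open>\<open>w ^ (m - 1)\<close> is the inverse of \<open>w\<close>; in this form the
    quotient is visibly an algebraic integer.\<close>
  define u where "u = z * w ^ (m - 1)"
  have ww: "w * w ^ (m - 1) = 1" using w m by (metis Suc_diff_1 power_Suc)
  have az: "algebraic_int z" "algebraic_int w" using z w m algebraic_int_root_of_unity by auto
  have u1: "u \<noteq> 1"
  proof
    assume "u = 1"
    then have "z * (w * w ^ (m - 1)) = w" unfolding u_def by (metis mult.left_commute mult.right_neutral)
    then show False using ww \<open>z \<noteq> w\<close> by (metis mult.right_neutral)
  qed
  have "(w ^ (m - 1)) ^ m = (w ^ m) ^ (m - 1)"
    by (simp only: power_mult[symmetric] mult.commute[of m])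
  then have um: "u ^ m = 1" using z w by (simp add: u_def power_mult_distrib)
  have au: "algebraic_int u" using um m algebraic_int_root_of_unity by auto
  have "red u = red w * red (w ^ (m - 1))"
    using az eq by (simp add: u_def red_mult algebraic_int_power)
  also have "\<dots> = red (w * w ^ (m - 1))" using az by (simp add: red_mult algebraic_int_power)
  finally have ru: "red u = 1" using ww by simp
  have "(\<Sum>i<m. u ^ i) = 0" using u1 um geometric_sum[of u m] by simp
  then have "0 = red (\<Sum>i<m. u ^ i)" by simp
  also have "\<dots> = of_nat m" using au ru by (simp add: red_sum algebraic_int_power red_power)
  finally show False using of_nat_k_eq_0 m by metis
qed

text \<open>For any preimage \<open>x\<close> of \<open>a\<close>, the number
  \<open>x ^ m - 1\<close> is the product of the differences \<open>x - z\<close> over the m-th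
  roots of unity. It reduces to 0, so one of the factors does.\<close>

lemma root_of_unity_lift:
  assumes a: "a ^ m = (1::'k)" and m: "m > 0" "\<not> p dvd m"
  shows "\<exists>z. z ^ m = 1 \<and> red z = a"
proof -
  obtain x where x: "algebraic_int x" "red x = a" by (rule red_surj)
  define R where "R = {z::complex. z ^ m = 1}"
  have fR: "finite R" using finite_roots_unity[of m] m by (simp add: R_def)
  have P: "(\<Prod>z\<in>R. (x - z)) = x ^ m - 1"
  proof -
    define P where "P = monom (1::complex) m + [:-1:]"
    have d: "degree P = m" "lead_coeff P = 1" using m(1)
      by (auto simp: P_def degree_add_eq_left degree_monom_eq coeff_pCons split: nat.splits)
    have P0: "P \<noteq> 0" using d by auto
    have roots: "poly P z = 0 \<longleftrightarrow> z \<in> R" for z by (simp add: P_def poly_monom R_def)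
    have cR: "card R = m" using card_roots_unity_eq[of m] m by (simp add: R_def)
    define Q where "Q = (\<Prod>z\<in>R. [:- z, 1:])"
    have dQ: "degree Q = m" using cR by (simp add: Q_def degree_prod_eq_sum_degree)
    moreover have "lead_coeff Q = 1" unfolding Q_def lead_coeff_prod by simp
    ultimately have dQ: "degree Q = m" "lead_coeff Q = 1" by auto
    \<comment> \<open>Both polynomials are monic of degree \<open>m\<close> and vanish on the
      \<open>m\<close> elements of \<open>R\<close>; a nonzero difference would have degree below
      \<open>m\<close> and still \<open>m\<close> roots.\<close>
    have "P = Q"
    proof (rule ccontr)
      assume "P \<noteq> Q"
      then have D0: "P - Q \<noteq> 0" by simp
      have "degree (P - Q) < m"
      proof -
        have "degree (P - Q) \<le> m" using d dQ by (simp add: degree_diff_le)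
        moreover have "coeff (P - Q) m = 0" using d dQ by simp
        ultimately show ?thesis using D0 by (metis leading_coeff_0_iff le_neq_implies_less)
      qed
      moreover have "poly Q z = 0" if "z \<in> R" for z
        using that fR by (auto simp: Q_def poly_prod)
      then have "R \<subseteq> {z. poly (P - Q) z = 0}"
        using roots by auto
      then have "card R \<le> card {z. poly (P - Q) z = 0}"
        by (intro card_mono poly_roots_finite D0)
      then have "m \<le> degree (P - Q)" using card_poly_roots_bound[OF D0] cR by linarith
      ultimately show False by simp
    qed
    then have "poly P x = (\<Prod>z\<in>R. (x - z))" by (simp add: Q_def poly_prod)
    then show ?thesis by (simp add: P_def poly_monom)
  qed
  have aR: "algebraic_int z" if "z \<in> R" for z
    using that m algebraic_int_root_of_unity by (auto simp: R_def)
  have ad: "algebraic_int (x - z)" if "z \<in> R" for z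
    using algebraic_int_add[of x "-z"] aR[OF that] x by simp
  have rd: "red (x - z) = a - red z" if "z \<in> R" for z
    using red_add[of x "-z"] red_minus[of z] aR[OF that] x by simp
  have "red (\<Prod>z\<in>R. (x - z)) = (\<Prod>z\<in>R. (a - red z))"
    using ad rd by (simp add: red_prod)
  also have "red (\<Prod>z\<in>R. (x - z)) = a ^ m - 1"
    unfolding P using red_add[of "x ^ m" "-1"] red_minus[of 1] x
    by (simp add: algebraic_int_power red_power int_imp_algebraic_int)
  finally have "(\<Prod>z\<in>R. (a - red z)) = 0" using a by simp
  then obtain z where "z \<in> R" "a = red z" using fR by auto
  then show ?thesis by (auto simp: R_def)
qed

abbreviation lift :: "'k \<Rightarrow> complex" where "lift \<equiv> brauer_lift p red"

lemma coprime_p: "coprime m p \<longleftrightarrow> \<not> p dvd m"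
proof
  assume "coprime m p"
  show "\<not> p dvd m"
  proof
    assume "p dvd m"
    have "is_unit p" by (rule coprime_common_divisor[OF \<open>coprime m p\<close> \<open>p dvd m\<close> dvd_refl])
    from not_prime_unit[OF this] show False using prime_p by contradiction
  qed
next
  assume "\<not> p dvd m"
  then have "coprime p m" by (rule prime_imp_coprime[OF prime_p])
  then show "coprime m p" by (rule coprime_commute[THEN iffD1])
qed

text \<open>Uniqueness for the definite description in \<open>brauer_lift\<close>: two candidates
  with exponents \<open>m\<close> and \<open>m'\<close> share the exponent \<open>m * m'\<close>,
  which is still not divisible by \<open>p\<close>, and there reduction is injective.\<close>

lemma lift_eqI:
  assumes "z ^ m = 1" "m > 0" "\<not> p dvd m" "red z = a"
  shows "lift a = z"
  unfolding brauer_lift_def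
proof (rule the_equality)
  show "(\<exists>m>0. coprime m p \<and> z ^ m = 1) \<and> red z = a"
    using assms by (auto simp: coprime_p)
next
  fix w assume "(\<exists>m>0. coprime m p \<and> w ^ m = 1) \<and> red w = a"
  then obtain m' where m': "m' > 0" "\<not> p dvd m'" "w ^ m' = 1" "red w = a"
    by (auto simp: coprime_p)
  have "z ^ (m * m') = 1" using assms by (simp add: power_mult)
  moreover have "w ^ (m * m') = 1" using m' by (simp add: power_mult mult.commute[of m])
  moreover have "m * m' > 0" "\<not> p dvd m * m'"
    using assms m' prime_p by (simp_all add: prime_dvd_mult_iff)
  ultimately show "w = z" using red_inj_roots[of w "m * m'" z] assms m' by simp
qed

lemma lift_root:
  assumes "a ^ m = (1::'k)" "m > 0" "\<not> p dvd m"
  shows "lift a ^ m = 1" "red (lift a) = a"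
proof -
  obtain z where z: "z ^ m = 1" "red z = a" using root_of_unity_lift[OF assms] by blast
  then have "lift a = z" using lift_eqI assms by blast
  with z show "lift a ^ m = 1" "red (lift a) = a" by simp_all
qed

lemma lift_1 [simp]: "lift 1 = 1"
  using prime_p by (intro lift_eqI[of _ 1]) (auto simp: not_prime_unit)

lemma lift_mult:
  assumes "a ^ m = (1::'k)" "b ^ m = (1::'k)" "m > 0" "\<not> p dvd m"
  shows "lift (a * b) = lift a * lift b"
proof (rule lift_eqI[of _ m])
  have *: "lift a ^ m = 1" "lift b ^ m = 1" using lift_root(1) assms by blast+
  then show "(lift a * lift b) ^ m = 1" by (simp add: power_mult_distrib)
  have "algebraic_int (lift a)" "algebraic_int (lift b)"
    using * assms(3) algebraic_int_root_of_unity by blast+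
  then show "red (lift a * lift b) = a * b"
    using lift_root(2)[OF assms(1,3,4)] lift_root(2)[OF assms(2,3,4)] by (simp add: red_mult)
qed fact+

end

section \<open>Subspaces and block matrices\<close>

definition vsub :: "nat \<Rightarrow> 'k::field vec set \<Rightarrow> bool" where
  "vsub n W \<longleftrightarrow> W \<subseteq> carrier_vec n \<and> 0\<^sub>v n \<in> W \<and> (\<forall>u\<in>W. \<forall>v\<in>W. u + v \<in> W) \<and> (\<forall>c. \<forall>v\<in>W. c \<cdot>\<^sub>v v \<in> W)"

lemma subspace_iff_vsub:
  "VectorSpace.subspace class_ring W (module_vec TYPE('k::field) n) \<longleftrightarrow> vsub n W"
proof -
  interpret vec_space "TYPE('k)" n .
  show ?thesis
    unfolding VectorSpace.subspace_def submodule_def vsub_def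
    using vec_vs vec_module by (auto simp: module_vec_simps class_ring_simps)
qed

lemma vsubD:
  assumes "vsub n W"
  shows "\<And>v. v \<in> W \<Longrightarrow> v \<in> carrier_vec n" "0\<^sub>v n \<in> W"
    "\<And>u v. u \<in> W \<Longrightarrow> v \<in> W \<Longrightarrow> u + v \<in> W" "\<And>c v. v \<in> W \<Longrightarrow> c \<cdot>\<^sub>v v \<in> W"
  using assms by (auto simp: vsub_def)

lemma mult_mat_vec_index:
  "A \<in> carrier_mat m n \<Longrightarrow> v \<in> carrier_vec n \<Longrightarrow> i < m \<Longrightarrow> (A *\<^sub>v v) $ i = (\<Sum>j<n. A $$ (i,j) * v $ j)"
  by (simp add: scalar_prod_def lessThan_atLeast0)

lemma mult_mat_index:
  "A \<in> carrier_mat m n \<Longrightarrow> B \<in> carrier_mat n l \<Longrightarrow> i < m \<Longrightarrow> j < l \<Longrightarrow>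
   (A * B) $$ (i,j) = (\<Sum>k<n. A $$ (i,k) * B $$ (k,j))"
  by (simp add: scalar_prod_def lessThan_atLeast0)

text \<open>The product is the combination of the columns of \<open>P\<close> with coefficients from
  \<open>u\<close>; the induction builds its partial sums inside \<open>W\<close>, skipping columns
  with coefficient 0.\<close>

lemma vsub_mult_mat_vec:
  assumes W: "vsub n W" and P: "P \<in> carrier_mat n m" and u: "u \<in> carrier_vec m"
    and col: "\<And>j. j < m \<Longrightarrow> u $ j \<noteq> 0 \<Longrightarrow> col P j \<in> W"
  shows "P *\<^sub>v u \<in> W"
proof -
  have "k \<le> m \<Longrightarrow> vec n (\<lambda>i. \<Sum>j<k. P $$ (i,j) * u $ j) \<in> W" for k
  proof (induction k)
    case 0
    have "vec n (\<lambda>i. \<Sum>j<0. P $$ (i,j) * u $ j) = 0\<^sub>v n" by (rule eq_vecI) auto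
    then show ?case using vsubD(2)[OF W] by simp
  next
    case (Suc k)
    then have IH: "vec n (\<lambda>i. \<Sum>j<k. P $$ (i,j) * u $ j) \<in> W" and k: "k < m" by auto
    show ?case
    proof (cases "u $ k = 0")
      case True
      then show ?thesis using IH by simp
    next
      case False
      have "vec n (\<lambda>i. \<Sum>j<Suc k. P $$ (i,j) * u $ j)
        = vec n (\<lambda>i. \<Sum>j<k. P $$ (i,j) * u $ j) + u $ k \<cdot>\<^sub>v col P k"
        by (rule eq_vecI) (use P k in \<open>auto simp: mult.commute\<close>)
      then show ?thesis using IH vsubD[OF W] col[OF k False] by simp
    qed
  qed
  from this[of m] have "vec n (\<lambda>i. \<Sum>j<m. P $$ (i,j) * u $ j) \<in> W" by simp
  moreover have "P *\<^sub>v u = vec n (\<lambda>i. \<Sum>j<m. P $$ (i,j) * u $ j)"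
    by (rule eq_vecI) (use P u mult_mat_vec_index[OF P u] in auto)
  ultimately show ?thesis by simp
qed

lemma mat_vec_unit:
  assumes A: "(A :: 'k::comm_semiring_1 mat) \<in> carrier_mat m n" and j: "j < n"
  shows "A *\<^sub>v unit_vec n j = col A j"
proof (rule eq_vecI)
  fix i assume "i < dim_vec (col A j)"
  then have i: "i < m" using A by simp
  have "(A *\<^sub>v unit_vec n j) $ i = (\<Sum>k<n. A $$ (i,k) * unit_vec n j $ k)"
    using mult_mat_vec_index[OF A _ i] by simp
  also have "\<dots> = (\<Sum>k<n. if k = j then A $$ (i,k) else 0)"
    by (rule sum.cong) (auto simp: unit_vec_def)
  finally show "(A *\<^sub>v unit_vec n j) $ i = col A j $ i" using A i j by simp
qed (use A in auto)

section \<open>Invertible matrices and the dimension of a subspace\<close>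

text \<open>The inverse is carried as explicit data, since changes of basis \<open>Q * A * P\<close>
  and coordinate vectors \<open>Q *\<^sub>v v\<close> refer to it constantly.\<close>

definition mat_inv :: "nat \<Rightarrow> 'k::field mat \<Rightarrow> 'k mat \<Rightarrow> bool" where
  "mat_inv n P Q \<longleftrightarrow> P \<in> carrier_mat n n \<and> Q \<in> carrier_mat n n \<and> P * Q = 1\<^sub>m n \<and> Q * P = 1\<^sub>m n"

lemma mat_invD:
  assumes "mat_inv n P Q"
  shows "P \<in> carrier_mat n n" "Q \<in> carrier_mat n n" "P * Q = 1\<^sub>m n" "Q * P = 1\<^sub>m n"
  using assms by (auto simp: mat_inv_def)

lemma mat_inv_vec:
  assumes "mat_inv n P Q" "v \<in> carrier_vec n"
  shows "P *\<^sub>v (Q *\<^sub>v v) = v" "Q *\<^sub>v (P *\<^sub>v v) = v"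
proof -
  note D = mat_invD[OF assms(1)]
  show "P *\<^sub>v (Q *\<^sub>v v) = v"
    using assoc_mult_mat_vec[OF D(1,2) assms(2)] D(3) assms(2) by simp
  show "Q *\<^sub>v (P *\<^sub>v v) = v"
    using assoc_mult_mat_vec[OF D(2,1) assms(2)] D(4) assms(2) by simp
qed

lemma mat_inv_one: "mat_inv n (1\<^sub>m n) (1\<^sub>m n)"
  by (simp add: mat_inv_def)

lemma mat_inv_sym: "mat_inv n P Q \<Longrightarrow> mat_inv n Q P"
  by (auto simp: mat_inv_def)

lemma mat_inv_mult:
  assumes "mat_inv n P Q" "mat_inv n P' Q'" shows "mat_inv n (P * P') (Q' * Q)"
proof -
  note D = mat_invD[OF assms(1)] and D' = mat_invD[OF assms(2)]
  have "P * P' * (Q' * Q) = P * (P' * Q') * Q"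
    using D(1,2) D'(1,2) by (simp add: assoc_mult_mat[of _ n n _ n _ n])
  moreover have "Q' * Q * (P * P') = Q' * (Q * P) * P'"
    using D(1,2) D'(1,2) by (simp add: assoc_mult_mat[of _ n n _ n _ n])
  ultimately show ?thesis using D D' by (simp add: mat_inv_def)
qed

lemma mat_inv_if_kernel_trivial:
  assumes A: "A \<in> carrier_mat n n"
    and ker: "\<And>v. v \<in> carrier_vec n \<Longrightarrow> A *\<^sub>v v = 0\<^sub>v n \<Longrightarrow> v = 0\<^sub>v n"
  obtains B where "mat_inv n A (B :: 'k::field mat)"
proof -
  have "det A \<noteq> 0" using det_0_iff_vec_prod_zero_field[OF A] ker by auto
  from det_non_zero_imp_unit[OF A this, of "()"]
  obtain B where "B \<in> carrier_mat n n" "A * B = 1\<^sub>m n" "B * A = 1\<^sub>m n"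
    by (auto simp: Units_def ring_mat_simps)
  then show ?thesis using that A by (auto simp: mat_inv_def)
qed

text \<open>The columns of \<open>P\<close> form a basis of the whole space whose first
  \<open>r\<close> members lie in \<open>W\<close>; \<open>Q\<close> computes coordinates in this
  basis.\<close>

definition adapted :: "nat \<Rightarrow> 'k::field vec set \<Rightarrow> nat \<Rightarrow> 'k mat \<Rightarrow> 'k mat \<Rightarrow> bool" where
  "adapted n W r P Q \<longleftrightarrow> r \<le> n \<and> mat_inv n P Q \<and> (\<forall>j<r. col P j \<in> W)"

text \<open>The exchange step: the coordinate vector of \<open>w\<close> replaces a column of the identity matrix.\<close>

lemma adapted_exchange:
  assumes W: "vsub n W" and ad: "adapted n W r P Q" and w: "w \<in> W"
    and j: "r \<le> j" "j < n" "(Q *\<^sub>v w) $ j \<noteq> 0"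
  shows "\<exists>P' Q'. adapted n W (Suc r) P' Q'"
proof -
  have inv: "mat_inv n P Q" and r: "r \<le> n" and colP: "\<And>i. i < r \<Longrightarrow> col P i \<in> W"
    using ad by (auto simp: adapted_def)
  note D = mat_invD[OF inv]
  have wc: "w \<in> carrier_vec n" using W w vsubD by auto
  define u where "u = Q *\<^sub>v w"
  have u: "u \<in> carrier_vec n" using D wc by (simp add: u_def)
  have Pu: "P *\<^sub>v u = w" using mat_inv_vec[OF inv wc] by (simp add: u_def)
  have uj: "u $ j \<noteq> 0" using j by (simp add: u_def)
  \<comment> \<open>Column \<open>r\<close> receives the coordinates \<open>u\<close> of
    \<open>w\<close>, and for \<open>j\<close> different from \<open>r\<close> the displaced unit
    vector moves to column \<open>j\<close>. Thus \<open>w\<close> becomes the basis vector number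
    \<open>r\<close>, and invertibility rests on \<open>u $ j\<close> being nonzero.\<close>
  define E where "E = mat n n (\<lambda>(i,c). if c = r then u $ i else if c = j then (if i = r then 1 else 0)
     else if i = c then 1 else 0)"
  have E: "E \<in> carrier_mat n n" by (simp add: E_def)
  have Ev: "(E *\<^sub>v v) $ i = u $ i * v $ r + (if i = r \<and> j \<noteq> r then v $ j else 0)
      + (if i \<noteq> r \<and> i \<noteq> j then v $ i else 0)" if v: "v \<in> carrier_vec n" and i: "i < n" for v i
  proof -
    have "(E *\<^sub>v v) $ i = (\<Sum>c<n. E $$ (i,c) * v $ c)"
      using mult_mat_vec_index[OF E v i] .
    also have "\<dots> = (\<Sum>c<n. (if c = r then u $ i * v $ r else 0)
        + (if c = j then if i = r \<and> j \<noteq> r then v $ j else 0 else 0)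
        + (if c = i then if i \<noteq> r \<and> i \<noteq> j then v $ i else 0 else 0))"
      using i by (intro sum.cong) (auto simp: E_def)
    also have "\<dots> = u $ i * v $ r + (if i = r \<and> j \<noteq> r then v $ j else 0)
      + (if i \<noteq> r \<and> i \<noteq> j then v $ i else 0)"
      using i j r unfolding sum.distrib by (simp add: sum.delta)
    finally show ?thesis .
  qed
  obtain F where F: "mat_inv n E F"
  proof (rule mat_inv_if_kernel_trivial[OF E])
    fix v assume v: "v \<in> carrier_vec n" and 0: "E *\<^sub>v v = 0\<^sub>v n"
    have eq: "u $ i * v $ r + (if i = r \<and> j \<noteq> r then v $ j else 0)
      + (if i \<noteq> r \<and> i \<noteq> j then v $ i else 0) = 0" if "i < n" for i
      using Ev[OF v that] 0 that by simp
    \<comment> \<open>Row \<open>j\<close> contains only the term \<open>u $ j * v $ r\<close>; once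
      \<open>v $ r\<close> is 0, row \<open>r\<close> yields \<open>v $ j\<close> and the other rows
      yield the remaining entries.\<close>
    have vr: "v $ r = 0" using eq[of j] j uj by (simp split: if_splits)
    have vj: "v $ j = 0" using eq[of r] vr j by (cases "j = r") auto
    show "v = 0\<^sub>v n"
    proof (rule eq_vecI)
      fix i assume "i < dim_vec (0\<^sub>v n :: 'a vec)"
      then show "v $ i = 0\<^sub>v n $ i" using eq[of i] vr vj by (cases "i = r"; cases "i = j") auto
    qed (use v in auto)
  qed
  have colE: "col E c = unit_vec n c" if "c < r" for c
    by (rule eq_vecI) (use that j r in \<open>auto simp: E_def\<close>)
  have colr: "col E r = u" by (rule eq_vecI) (use j r u in \<open>auto simp: E_def\<close>)
  have "col (P * E) c \<in> W" if c: "c < Suc r" for c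
  proof -
    have cn: "c < n" using c j by simp
    have "col (P * E) c = P *\<^sub>v col E c" using col_mult2[OF D(1) E cn] .
    also have "\<dots> \<in> W"
    proof (cases "c = r")
      case True
      then show ?thesis using colr Pu w by simp
    next
      case False
      then have "c < r" using c by simp
      then show ?thesis using colE colP mat_vec_unit[OF D(1) cn] by simp
    qed
    finally show ?thesis .
  qed
  then have "adapted n W (Suc r) (P * E) (F * Q)"
    using mat_inv_mult[OF inv F] j by (simp add: adapted_def)
  then show ?thesis by blast
qed

text \<open>For a subspace this is its dimension. Defining it by extremality means that the exchange
  step alone delivers both a good basis and strict monotonicity.\<close>

definition vdim :: "nat \<Rightarrow> 'k::field vec set \<Rightarrow> nat" where
  "vdim n W = (GREATEST r. \<exists>P Q. adapted n W r P Q)"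

lemma vdim_adapted: "\<exists>P Q. adapted n W (vdim n W) P Q"
  unfolding vdim_def
proof (rule GreatestI_nat[of "\<lambda>r. \<exists>P Q. adapted n W r P Q" 0 n])
  have "adapted n W 0 (1\<^sub>m n) (1\<^sub>m n)" using mat_inv_one by (auto simp: adapted_def)
  then show "\<exists>P Q. adapted n W 0 P Q" by blast
qed (auto simp: adapted_def)

lemma vdim_ge: "adapted n W r P Q \<Longrightarrow> r \<le> vdim n W"
  unfolding vdim_def
  by (rule Greatest_le_nat[of "\<lambda>r. \<exists>P Q. adapted n W r P Q" _ n]) (blast, auto simp: adapted_def)

lemma vdim_le: "vdim n W \<le> n"
  using vdim_adapted[of n W] by (auto simp: adapted_def)

text \<open>When \<open>r\<close> is maximal no exchange is possible, which says exactly that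
  vectors of \<open>W\<close> have zero coordinates from \<open>r\<close> on. Conversely, a vector
  with such coordinates combines columns that lie in \<open>W\<close>.\<close>

lemma adapted_basis:
  assumes W: "vsub n W"
  obtains P Q where "mat_inv n P Q" "vdim n W \<le> n"
    "\<And>v. v \<in> carrier_vec n \<Longrightarrow> v \<in> W \<longleftrightarrow> (\<forall>i. vdim n W \<le> i \<longrightarrow> i < n \<longrightarrow> (Q *\<^sub>v v) $ i = 0)"
proof -
  define r where "r = vdim n W"
  obtain P Q where ad: "adapted n W r P Q" using vdim_adapted r_def by blast
  have inv: "mat_inv n P Q" and r: "r \<le> n" and colP: "\<And>i. i < r \<Longrightarrow> col P i \<in> W"
    using ad by (auto simp: adapted_def)
  note D = mat_invD[OF inv]
  have "v \<in> W \<longleftrightarrow> (\<forall>i. r \<le> i \<longrightarrow> i < n \<longrightarrow> (Q *\<^sub>v v) $ i = 0)" if v: "v \<in> carrier_vec n" for v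
  proof
    assume "v \<in> W"
    show "\<forall>i. r \<le> i \<longrightarrow> i < n \<longrightarrow> (Q *\<^sub>v v) $ i = 0"
    proof (intro allI impI, rule ccontr)
      fix i assume "r \<le> i" "i < n" "(Q *\<^sub>v v) $ i \<noteq> 0"
      from adapted_exchange[OF W ad \<open>v \<in> W\<close> this] show False
        using vdim_ge[of n W "Suc r"] r_def by auto
    qed
  next
    assume *: "\<forall>i. r \<le> i \<longrightarrow> i < n \<longrightarrow> (Q *\<^sub>v v) $ i = 0"
    have Qv: "Q *\<^sub>v v \<in> carrier_vec n" using D v by simp
    have "P *\<^sub>v (Q *\<^sub>v v) \<in> W"
      by (rule vsub_mult_mat_vec[OF W D(1) Qv]) (use * colP in \<open>meson not_le\<close>)
    then show "v \<in> W" using mat_inv_vec[OF inv v] by simp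
  qed
  then show ?thesis using that inv r r_def by blast
qed

text \<open>A basis adapted to \<open>W\<close> is also adapted to \<open>W'\<close>, and a vector
  of \<open>W'\<close> outside \<open>W\<close> permits one further exchange.\<close>

lemma vdim_mono_strict:
  assumes W: "vsub n W" and W': "vsub n W'" and sub: "W \<subset> W'"
  shows "vdim n W < vdim n W'"
proof -
  define r where "r = vdim n W"
  obtain P Q where ad: "adapted n W r P Q" using vdim_adapted r_def by blast
  then have ad': "adapted n W' r P Q" using sub by (auto simp: adapted_def)
  obtain w where w: "w \<in> W'" "w \<notin> W" using sub by auto
  have wc: "w \<in> carrier_vec n" using W' w vsubD by auto
  have inv: "mat_inv n P Q" and colP: "\<And>i. i < r \<Longrightarrow> col P i \<in> W"
    using ad by (auto simp: adapted_def)
  note D = mat_invD[OF inv]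
  have "\<exists>i. r \<le> i \<and> i < n \<and> (Q *\<^sub>v w) $ i \<noteq> 0"
  proof (rule ccontr)
    assume *: "\<not> ?thesis"
    have Qv: "Q *\<^sub>v w \<in> carrier_vec n" using D wc by simp
    have "P *\<^sub>v (Q *\<^sub>v w) \<in> W"
      by (rule vsub_mult_mat_vec[OF W D(1) Qv]) (use * colP in \<open>meson not_le\<close>)
    then show False using mat_inv_vec[OF inv wc] w by simp
  qed
  then obtain i where "r \<le> i" "i < n" "(Q *\<^sub>v w) $ i \<noteq> 0" by blast
  from adapted_exchange[OF W' ad' w(1) this] show ?thesis
    using vdim_ge[of n W' "Suc r"] r_def by (auto simp: less_eq_Suc_le)
qed

lemma vsub_zero: "vsub n {0\<^sub>v n}" by (auto simp: vsub_def)

lemma vsub_all: "vsub n (carrier_vec n)" by (auto simp: vsub_def)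

section \<open>Block triangular matrices\<close>

definition ul :: "nat \<Rightarrow> 'a mat \<Rightarrow> 'a mat" where "ul r M = mat r r (($$) M)"
definition ur :: "nat \<Rightarrow> 'a mat \<Rightarrow> 'a mat" where
  "ur r M = mat r (dim_col M - r) (\<lambda>(i,j). M $$ (i, r + j))"
definition lr :: "nat \<Rightarrow> 'a mat \<Rightarrow> 'a mat" where
  "lr r M = mat (dim_row M - r) (dim_col M - r) (\<lambda>(i,j). M $$ (r + i, r + j))"

definition block_ut :: "nat \<Rightarrow> 'a::zero mat \<Rightarrow> bool" where
  "block_ut r M \<longleftrightarrow> (\<forall>i j. r \<le> i \<longrightarrow> i < dim_row M \<longrightarrow> j < r \<longrightarrow> M $$ (i,j) = 0)"

lemma block_carrier:
  assumes "M \<in> carrier_mat n n"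
  shows "ul r M \<in> carrier_mat r r" "ur r M \<in> carrier_mat r (n - r)" "lr r M \<in> carrier_mat (n - r) (n - r)"
  using assms by (auto simp: ul_def ur_def lr_def)

lemma block_ut_four_block:
  assumes M: "M \<in> carrier_mat n n" and r: "r \<le> n" and b: "block_ut r M"
  shows "M = four_block_mat (ul r M) (ur r M) (0\<^sub>m (n - r) r) (lr r M)"
proof (rule eq_matI)
  fix i j assume "i < dim_row (four_block_mat (ul r M) (ur r M) (0\<^sub>m (n - r) r) (lr r M))"
    "j < dim_col (four_block_mat (ul r M) (ur r M) (0\<^sub>m (n - r) r) (lr r M))"
  then have "i < n" "j < n" using r M by (auto simp: ul_def lr_def)
  then show "M $$ (i,j) = four_block_mat (ul r M) (ur r M) (0\<^sub>m (n - r) r) (lr r M) $$ (i,j)"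
    using M r b by (auto simp: ul_def ur_def lr_def block_ut_def)
qed (use M r in \<open>auto simp: ul_def lr_def\<close>)

lemma sum_split_at:
  fixes f :: "nat \<Rightarrow> 'a::comm_monoid_add"
  assumes "r \<le> n" shows "(\<Sum>k<n. f k) = (\<Sum>k<r. f k) + (\<Sum>k<n-r. f (r + k))"
proof -
  have "(\<Sum>k<n. f k) = (\<Sum>k=0..<r. f k) + (\<Sum>k=r..<n. f k)"
    using sum.atLeastLessThan_concat[of 0 r n f] assms by (simp add: lessThan_atLeast0)
  also have "(\<Sum>k=r..<n. f k) = (\<Sum>k<n-r. f (r + k))"
    using sum.shift_bounds_nat_ivl[of f 0 r "n - r"] assms by (simp add: lessThan_atLeast0 add.commute)
  finally show ?thesis by (simp add: lessThan_atLeast0)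
qed

lemma block_ut_mult:
  fixes M N :: "'a::comm_semiring_1 mat"
  assumes M: "M \<in> carrier_mat n n" and N: "N \<in> carrier_mat n n" and r: "r \<le> n"
    and b: "block_ut r M" "block_ut r N"
  shows "ul r (M * N) = ul r M * ul r N" "lr r (M * N) = lr r M * lr r N"
    "ur r (M * N) = ul r M * ur r N + ur r M * lr r N"
proof -
  note bM = block_carrier[OF M, of r] and bN = block_carrier[OF N, of r]
  have bz: "M $$ (r + i, j) = 0" "N $$ (r + i, j) = 0" if "i < n - r" "j < r" for i j
    using that b M N by (auto simp: block_ut_def)
  have idx: "(M * N) $$ (i,j) = (\<Sum>k<r. M $$ (i,k) * N $$ (k,j)) + (\<Sum>k<n-r. M $$ (i,r+k) * N $$ (r+k,j))"
    if "i < n" "j < n" for i j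
    using mult_mat_index[OF M N that] sum_split_at[OF r, of "\<lambda>k. M $$ (i,k) * N $$ (k,j)"] by simp
  show "ul r (M * N) = ul r M * ul r N"
  proof (rule eq_matI)
    fix i j assume "i < dim_row (ul r M * ul r N)" "j < dim_col (ul r M * ul r N)"
    then have ij: "i < r" "j < r" using bM bN by auto
    have "(ul r M * ul r N) $$ (i,j) = (\<Sum>k<r. M $$ (i,k) * N $$ (k,j))"
      using mult_mat_index[OF bM(1) bN(1) ij] ij by (simp add: ul_def)
    then show "ul r (M * N) $$ (i,j) = (ul r M * ul r N) $$ (i,j)"
      using idx[of i j] ij r bz by (simp add: ul_def)
  qed (use bM bN in \<open>auto simp: ul_def\<close>)
  show "lr r (M * N) = lr r M * lr r N"
  proof (rule eq_matI)
    fix i j assume "i < dim_row (lr r M * lr r N)" "j < dim_col (lr r M * lr r N)"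
    then have ij: "i < n - r" "j < n - r" using bM bN by auto
    have "(lr r M * lr r N) $$ (i,j) = (\<Sum>k<n-r. M $$ (r+i,r+k) * N $$ (r+k,r+j))"
      using mult_mat_index[OF bM(3) bN(3) ij] ij M N by (simp add: lr_def)
    then show "lr r (M * N) $$ (i,j) = (lr r M * lr r N) $$ (i,j)"
      using idx[of "r+i" "r+j"] ij r bz(1) M N by (simp add: lr_def)
  qed (use bM bN M N in \<open>auto simp: lr_def\<close>)
  show "ur r (M * N) = ul r M * ur r N + ur r M * lr r N"
  proof (rule eq_matI)
    fix i j assume "i < dim_row (ul r M * ur r N + ur r M * lr r N)" "j < dim_col (ul r M * ur r N + ur r M * lr r N)"
    then have ij: "i < r" "j < n - r" using bM bN by auto
    have "(ul r M * ur r N) $$ (i,j) = (\<Sum>k<r. M $$ (i,k) * N $$ (k,r+j))"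
      using mult_mat_index[OF bM(1) bN(2) ij] ij N by (simp add: ul_def ur_def)
    moreover have "(ur r M * lr r N) $$ (i,j) = (\<Sum>k<n-r. M $$ (i,r+k) * N $$ (r+k,r+j))"
      using mult_mat_index[OF bM(2) bN(3) ij] ij M N by (simp add: lr_def ur_def)
    ultimately show "ur r (M * N) $$ (i,j) = (ul r M * ur r N + ur r M * lr r N) $$ (i,j)"
      using idx[of i "r+j"] ij r M N bM bN by (simp add: ur_def)
  qed (use bM bN M N in \<open>auto simp: ur_def\<close>)
qed

lemma block_ut_one: "r \<le> n \<Longrightarrow> block_ut r (1\<^sub>m n)"
  "r \<le> n \<Longrightarrow> ul r (1\<^sub>m n) = 1\<^sub>m r" "r \<le> n \<Longrightarrow> lr r (1\<^sub>m n) = 1\<^sub>m (n - r)" "r \<le> n \<Longrightarrow> ur r (1\<^sub>m n) = 0\<^sub>m r (n - r)"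
  by (auto simp: block_ut_def ul_def lr_def ur_def intro!: eq_matI)

lemma char_poly_four_block:
  fixes A :: "'k::field mat"
  assumes A: "A \<in> carrier_mat n n" and B: "B \<in> carrier_mat n m" and D: "D \<in> carrier_mat m m"
  shows "char_poly (four_block_mat A B (0\<^sub>m m n) D) = char_poly A * char_poly D"
proof -
  have "char_poly_matrix (four_block_mat A B (0\<^sub>m m n) D) =
     four_block_mat (char_poly_matrix A) (map_mat (\<lambda>a. [:-a:]) B) (0\<^sub>m m n) (char_poly_matrix D)"
    using A B D by (intro eq_matI) (auto simp: char_poly_matrix_def)
  then show ?thesis unfolding char_poly_def
    using A B D by (simp add: det_four_block_mat_lower_left_zero[of _ n _ m])
qed

lemma char_poly_block_ut:
  fixes M :: "'k::field mat"
  assumes M: "M \<in> carrier_mat n n" and r: "r \<le> n" and b: "block_ut r M"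
  shows "char_poly M = char_poly (ul r M) * char_poly (lr r M)"
  using block_ut_four_block[OF assms] char_poly_four_block block_carrier[OF M] by metis

text \<open>The first \<open>r\<close> columns of \<open>P\<close> lie in \<open>W\<close>, so
  \<open>B\<close> sends them into \<open>W\<close>, that is, to vectors whose coordinates from
  \<open>r\<close> on vanish. These coordinates are the lower left block.\<close>

lemma invariant_block_ut:
  fixes P :: "'k::field mat"
  assumes W: "vsub n W" and inv: "mat_inv n P Q" and r: "r \<le> n"
    and iff: "\<And>v. v \<in> carrier_vec n \<Longrightarrow> v \<in> W \<longleftrightarrow> (\<forall>i. r \<le> i \<longrightarrow> i < n \<longrightarrow> (Q *\<^sub>v v) $ i = 0)"
    and B: "B \<in> carrier_mat n n" and st: "\<And>w. w \<in> W \<Longrightarrow> B *\<^sub>v w \<in> W"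
  shows "block_ut r (Q * B * P)"
  unfolding block_ut_def
proof (intro allI impI)
  note D = mat_invD[OF inv]
  fix i j assume i: "r \<le> i" "i < dim_row (Q * B * P)" and j: "j < r"
  have "i < n" "j < n" using i j r D by auto
  have ue: "unit_vec n j \<in> carrier_vec n" by simp
  have "P *\<^sub>v unit_vec n j \<in> W"
    using iff[of "P *\<^sub>v unit_vec n j"] D mat_inv_vec(2)[OF inv ue] j by auto
  then have "B *\<^sub>v (P *\<^sub>v unit_vec n j) \<in> W" by (rule st)
  then have "(Q *\<^sub>v (B *\<^sub>v (P *\<^sub>v unit_vec n j))) $ i = 0"
    using iff vsubD(1)[OF W] i \<open>i < n\<close> by blast
  moreover have "Q *\<^sub>v (B *\<^sub>v (P *\<^sub>v unit_vec n j)) = (Q * B * P) *\<^sub>v unit_vec n j"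
    using D B ue by (simp add: assoc_mult_mat_vec[of _ n n _ n])
  moreover have "(Q * B * P) *\<^sub>v unit_vec n j = col (Q * B * P) j"
    using D B \<open>j < n\<close> by (intro mat_vec_unit) auto
  ultimately show "(Q * B * P) $$ (i,j) = 0" using D B \<open>i < n\<close> \<open>j < n\<close> by simp
qed

section \<open>Matrices over the residue field\<close>

definition mtrace :: "'a::comm_monoid_add mat \<Rightarrow> 'a" where
  "mtrace A = (\<Sum>i<dim_row A. A $$ (i,i))"

lemma mtrace_mult_comm:
  fixes A B :: "'a::comm_semiring_1 mat"
  assumes A: "A \<in> carrier_mat n m" and B: "B \<in> carrier_mat m n"
  shows "mtrace (A * B) = mtrace (B * A)"
proof -
  have "mtrace (A * B) = (\<Sum>i<n. \<Sum>k<m. A $$ (i,k) * B $$ (k,i))"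
    using A B mult_mat_index[OF A B] by (simp add: mtrace_def)
  also have "\<dots> = (\<Sum>k<m. \<Sum>i<n. B $$ (k,i) * A $$ (i,k))"
    by (subst sum.swap) (simp add: mult.commute)
  also have "\<dots> = mtrace (B * A)"
    using A B mult_mat_index[OF B A] by (simp add: mtrace_def)
  finally show ?thesis .
qed

lemma mtrace_conj:
  fixes A :: "'a::field mat"
  assumes "mat_inv n P Q" "A \<in> carrier_mat n n" shows "mtrace (P * A * Q) = mtrace A"
proof -
  note D = mat_invD[OF assms(1)]
  have "mtrace (P * A * Q) = mtrace (Q * (P * A))"
    using mtrace_mult_comm[of "P * A" n n Q] D assms(2) by simp
  also have "Q * (P * A) = A" using D assms(2) by (simp flip: assoc_mult_mat[of _ n n _ n _ n])
  finally show ?thesis .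
qed

lemma mtrace_four_block:
  assumes A: "A \<in> carrier_mat n n" and D: "D \<in> carrier_mat m m"
  shows "mtrace (four_block_mat A B C D) = mtrace A + mtrace D"
  using A D sum_split_at[of n "n + m" "\<lambda>i. four_block_mat A B C D $$ (i,i)"]
  by (simp add: mtrace_def)

lemma mtrace_block_ut:
  assumes "M \<in> carrier_mat n n" "r \<le> n" "block_ut r M"
  shows "mtrace M = mtrace (ul r M) + mtrace (lr r M)"
proof -
  have "mtrace M = mtrace (four_block_mat (ul r M) (ur r M) (0\<^sub>m (n - r) r) (lr r M))"
    using block_ut_four_block[OF assms] by simp
  then show ?thesis using mtrace_four_block[OF block_carrier(1,3)[OF assms(1)]] by metis
qed

lemma similar_mat_inv:
  "similar_mat (A :: 'k::field mat) B \<Longrightarrow> A \<in> carrier_mat n n \<Longrightarrow> \<exists>P Q. mat_inv n P Q \<and> A = P * B * Q \<and> B \<in> carrier_mat n n"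
proof -
  assume s: "similar_mat A B" and A: "A \<in> carrier_mat n n"
  then obtain P Q where "similar_mat_wit A B P Q" by (auto simp: similar_mat_def)
  from similar_mat_witD2[OF A this] show ?thesis unfolding mat_inv_def by blast
qed

lemma mat_vec_zero: "A \<in> carrier_mat m n \<Longrightarrow> A *\<^sub>v 0\<^sub>v n = (0\<^sub>v m :: 'k::field vec)"
  by (rule eq_vecI) auto

lemma mat_inv_cancel_left:
  assumes "mat_inv n P Q" "X \<in> carrier_mat n m" shows "P * (Q * X) = X"
proof -
  note D = mat_invD[OF assms(1)]
  have "P * (Q * X) = (P * Q) * X" using D(1,2) assms(2) by simp
  then show ?thesis using D(3) assms(2) by simp
qed

lemma mat_inv_similar:
  "mat_inv n P Q \<Longrightarrow> B \<in> carrier_mat n n \<Longrightarrow> similar_mat (P * B * Q) (B :: 'k::field mat)"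
  by (intro similar_matI[of _ _ P Q n]) (auto simp: mat_inv_def)

lemma mat_inv_cancel:
  assumes "mat_inv n P Q" "M \<in> carrier_mat n n" shows "P * (Q * M * P) * Q = M"
proof -
  note D = mat_invD[OF assms(1)]
  have "P * (Q * M * P) * Q = (P * Q) * M * (P * Q)"
    using D(1,2) assms(2) by (simp add: assoc_mult_mat[of _ n n _ n _ n])
  then show ?thesis using D assms(2) by simp
qed

lemma mat_inv_conj_mult:
  assumes "mat_inv n P Q" "M \<in> carrier_mat n n" "N \<in> carrier_mat n n"
  shows "(Q * M * P) * (Q * N * P) = Q * (M * N) * P"
proof -
  note D = mat_invD[OF assms(1)]
  have "(Q * M * P) * (Q * N * P) = Q * M * (P * Q) * (N * P)"
    using D(1,2) assms by (simp add: assoc_mult_mat[of _ n n _ n _ n])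
  then show ?thesis using D assms by (simp add: assoc_mult_mat[of _ n n _ n _ n])
qed

section \<open>Eigenvectors and triangular form over the residue field\<close>

context brauer
begin

lemma eigenvector_exists:
  fixes A :: "'k mat"
  assumes A: "A \<in> carrier_mat n n" and n: "n > 0"
  obtains v a where "v \<in> carrier_vec n" "v \<noteq> 0\<^sub>v n" "A *\<^sub>v v = a \<cdot>\<^sub>v v"
proof -
  have "degree (char_poly A) > 0" using degree_monic_char_poly[OF A] n by simp
  then obtain a where "poly (char_poly A) a = 0" using alg_closed by blast
  then have "eigenvalue A a" using eigenvalue_root_char_poly[OF A] by simp
  then show ?thesis using that A by (auto simp: eigenvalue_def eigenvector_def)
qed

text \<open>In an adapted basis the upper left block is the restriction of \<open>B\<close> to
  \<open>W\<close>. An eigenvector of that block, padded with zeros and moved back by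
  \<open>P\<close>, is an eigenvector of \<open>B\<close> inside \<open>W\<close>.\<close>

lemma eigenvector_in_invariant:
  fixes B :: "'k mat"
  assumes W: "vsub n W" and nz: "W \<noteq> {0\<^sub>v n}" and B: "B \<in> carrier_mat n n"
    and st: "\<And>w. w \<in> W \<Longrightarrow> B *\<^sub>v w \<in> W"
  obtains v a where "v \<in> W" "v \<noteq> 0\<^sub>v n" "B *\<^sub>v v = a \<cdot>\<^sub>v v"
proof -
  define r where "r = vdim n W"
  obtain P Q where inv: "mat_inv n P Q" and r: "r \<le> n" and
    iff: "\<And>v. v \<in> carrier_vec n \<Longrightarrow> v \<in> W \<longleftrightarrow> (\<forall>i. r \<le> i \<longrightarrow> i < n \<longrightarrow> (Q *\<^sub>v v) $ i = 0)"
    using adapted_basis[OF W] r_def by metis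
  note D = mat_invD[OF inv]
  have "r > 0"
  proof (rule ccontr)
    assume "\<not> r > 0"
    have "w = 0\<^sub>v n" if "w \<in> W" for w
    proof -
      have w: "w \<in> carrier_vec n" using vsubD(1)[OF W that] .
      have "Q *\<^sub>v w = 0\<^sub>v n" by (rule eq_vecI) (use iff[OF w] that \<open>\<not> r > 0\<close> D in auto)
      then have "P *\<^sub>v (Q *\<^sub>v w) = 0\<^sub>v n" using D by (simp add: mat_vec_zero)
      then show ?thesis using mat_inv_vec(1)[OF inv w] by simp
    qed
    then show False using nz vsubD(2)[OF W] by blast
  qed
  define M where "M = Q * B * P"
  have M: "M \<in> carrier_mat n n" using D B by (simp add: M_def)
  have b: "block_ut r M" unfolding M_def by (rule invariant_block_ut[OF W inv r iff B st])
  note bc = block_carrier[OF M, of r]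
  obtain v a where v: "v \<in> carrier_vec r" "v \<noteq> 0\<^sub>v r" "ul r M *\<^sub>v v = a \<cdot>\<^sub>v v"
    using eigenvector_exists[OF bc(1) \<open>r > 0\<close>] by blast
  define u where "u = vec n (\<lambda>i. if i < r then v $ i else 0)"
  have u: "u \<in> carrier_vec n" by (simp add: u_def)
  have Mu: "M *\<^sub>v u = a \<cdot>\<^sub>v u"
  proof (rule eq_vecI)
    fix i assume "i < dim_vec (a \<cdot>\<^sub>v u)"
    then have i: "i < n" using u by simp
    have "(M *\<^sub>v u) $ i = (\<Sum>j<r. M $$ (i,j) * v $ j)"
      using mult_mat_vec_index[OF M u i] sum_split_at[OF r, of "\<lambda>j. M $$ (i,j) * u $ j"] r
      by (simp add: u_def)
    also have "\<dots> = a * u $ i"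
    proof (cases "i < r")
      case True
      then have "(\<Sum>j<r. M $$ (i,j) * v $ j) = (ul r M *\<^sub>v v) $ i"
        using mult_mat_vec_index[OF bc(1) v(1) True] by (simp add: ul_def)
      then show ?thesis using v True i by (simp add: u_def)
    next
      case False
      then have "M $$ (i,j) = 0" if "j < r" for j using b that i M by (auto simp: block_ut_def)
      then show ?thesis using False i by (simp add: u_def)
    qed
    finally show "(M *\<^sub>v u) $ i = (a \<cdot>\<^sub>v u) $ i" using i u by simp
  qed (use M u in auto)
  have "u \<noteq> 0\<^sub>v n"
  proof
    assume "u = 0\<^sub>v n"
    have "v = 0\<^sub>v r"
    proof (rule eq_vecI)
      fix i assume "i < dim_vec (0\<^sub>v r :: 'k vec)"
      then have "i < r" by simp
      then have "v $ i = u $ i" using r by (simp add: u_def)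
      then show "v $ i = 0\<^sub>v r $ i" using \<open>u = 0\<^sub>v n\<close> \<open>i < r\<close> r by simp
    qed (use v in auto)
    then show False using v by simp
  qed
  have Pu: "P *\<^sub>v u \<in> carrier_vec n" using D u by simp
  have "P *\<^sub>v u \<in> W" using iff[OF Pu] mat_inv_vec(2)[OF inv u] by (simp add: u_def)
  moreover have "P *\<^sub>v u \<noteq> 0\<^sub>v n"
    using mat_inv_vec(2)[OF inv u] \<open>u \<noteq> 0\<^sub>v n\<close> mat_vec_zero[OF D(2)] by metis
  moreover have "B *\<^sub>v (P *\<^sub>v u) = a \<cdot>\<^sub>v (P *\<^sub>v u)"
  proof -
    have "B * P \<in> carrier_mat n n" using D B by simp
    from mat_inv_cancel_left[OF inv this] have "P * M = B * P"
      using D B by (simp add: M_def)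
    moreover have "P *\<^sub>v (M *\<^sub>v u) = (P * M) *\<^sub>v u" "B *\<^sub>v (P *\<^sub>v u) = (B * P) *\<^sub>v u"
      using D(1) B M u by simp_all
    ultimately have "B *\<^sub>v (P *\<^sub>v u) = P *\<^sub>v (M *\<^sub>v u)" by metis
    also have "\<dots> = a \<cdot>\<^sub>v (P *\<^sub>v u)" unfolding Mu by (rule mult_mat_vec[OF D(1) u])
    finally show ?thesis .
  qed
  ultimately show ?thesis using that by blast
qed

text \<open>Induction on the size: the invariant line through an eigenvector gives a block
  triangular form, and strict monotonicity of \<open>vdim\<close> gives \<open>0 < r < n\<close>, so
  both diagonal blocks are smaller.\<close>

lemma triangularizable:
  fixes A :: "'k mat"
  shows "A \<in> carrier_mat n n \<Longrightarrow> \<exists>U. similar_mat A U \<and> upper_triangular U"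
proof (induction n arbitrary: A rule: less_induct)
  case (less n)
  note A = less.prems
  show ?case
  proof (cases "n \<le> 1")
    case True
    then have "upper_triangular A" using A by (intro upper_triangularI) auto
    then show ?thesis using similar_mat_refl[OF A] by blast
  next
    case False
    then have n: "n > 1" by simp
    obtain v a where v: "v \<in> carrier_vec n" "v \<noteq> 0\<^sub>v n" "A *\<^sub>v v = a \<cdot>\<^sub>v v"
      using eigenvector_exists[OF A] n by auto
    define W where "W = {c \<cdot>\<^sub>v v | c. True}"
    have W: "vsub n W"
    proof -
      have "0\<^sub>v n = 0 \<cdot>\<^sub>v v" by (rule eq_vecI) (use v(1) in auto)
      moreover have "c \<cdot>\<^sub>v v + d \<cdot>\<^sub>v v = (c + d) \<cdot>\<^sub>v v" for c d using v(1) by (simp add: add_smult_distrib_vec)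
      moreover have "c \<cdot>\<^sub>v (d \<cdot>\<^sub>v v) = (c * d) \<cdot>\<^sub>v v" for c d by (simp add: smult_smult_assoc)
      ultimately show ?thesis unfolding vsub_def W_def using v(1) by auto
    qed
    have st: "A *\<^sub>v w \<in> W" if "w \<in> W" for w
    proof -
      from that obtain c where w: "w = c \<cdot>\<^sub>v v" by (auto simp: W_def)
      have "A *\<^sub>v w = c \<cdot>\<^sub>v (a \<cdot>\<^sub>v v)" using mult_mat_vec[OF A v(1)] v(3) w by simp
      then show ?thesis by (auto simp: W_def smult_smult_assoc)
    qed
    have ne0: "{0\<^sub>v n} \<subset> W"
    proof -
      have "v = 1 \<cdot>\<^sub>v v" by simp
      then have "v \<in> W" unfolding W_def by blast
      then show ?thesis using v vsubD(2)[OF W] by auto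
    qed
    \<comment> \<open>For \<open>n > 1\<close> a line is a proper subspace: the first two unit
      vectors cannot both be multiples of \<open>v\<close>.\<close>
    have ne1: "W \<subset> carrier_vec n"
    proof -
      have "\<not> (unit_vec n 0 \<in> W \<and> unit_vec n 1 \<in> W)"
      proof
        assume "unit_vec n 0 \<in> W \<and> unit_vec n 1 \<in> W"
        then obtain c d where c: "unit_vec n 0 = c \<cdot>\<^sub>v v" and d: "unit_vec n 1 = d \<cdot>\<^sub>v v"
          by (auto simp: W_def)
        have "c * v $ 0 = 1" "c * v $ 1 = 0"
          using arg_cong[OF c, of "\<lambda>x. x $ 0"] arg_cong[OF c, of "\<lambda>x. x $ 1"] n v by auto
        moreover have "d * v $ 1 = 1"
          using arg_cong[OF d, of "\<lambda>x. x $ 1"] n v by auto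
        ultimately show False by auto
      qed
      then show ?thesis using vsubD(1)[OF W] by (metis subsetI psubsetI unit_vec_carrier)
    qed
    define r where "r = vdim n W"
    obtain P Q where inv: "mat_inv n P Q" and r: "r \<le> n" and
      iff: "\<And>v. v \<in> carrier_vec n \<Longrightarrow> v \<in> W \<longleftrightarrow> (\<forall>i. r \<le> i \<longrightarrow> i < n \<longrightarrow> (Q *\<^sub>v v) $ i = 0)"
      using adapted_basis[OF W] r_def by metis
    have "0 < r" using vdim_mono_strict[OF vsub_zero W ne0] r_def by simp
    have "r < n" using vdim_mono_strict[OF W vsub_all ne1] vdim_le[of n "carrier_vec n :: 'k vec set"] r_def by simp
    define M where "M = Q * A * P"
    note D = mat_invD[OF inv]
    have M: "M \<in> carrier_mat n n" using D A by (simp add: M_def)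
    have b: "block_ut r M" unfolding M_def by (rule invariant_block_ut[OF W inv r iff A st])
    note bc = block_carrier[OF M, of r]
    obtain U1 where U1: "similar_mat (ul r M) U1" "upper_triangular U1"
      using less.IH[OF \<open>r < n\<close> bc(1)] by blast
    obtain U2 where U2: "similar_mat (lr r M) U2" "upper_triangular U2"
      using less.IH[OF _ bc(3)] \<open>0 < r\<close> n by auto
    have cU: "U1 \<in> carrier_mat r r" "U2 \<in> carrier_mat (n - r) (n - r)"
      using similar_mat_inv[OF U1(1) bc(1)] similar_mat_inv[OF U2(1) bc(3)] by auto
    obtain B0 where "similar_mat (four_block_mat (ul r M) (ur r M) (0\<^sub>m (n - r) r) (lr r M))
       (four_block_mat U1 B0 (0\<^sub>m (n - r) r) U2)"
      using similar_mat_four_block_0_ex[OF U1(1) U2(1) bc(2,1,3)] by blast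
    then have "similar_mat M (four_block_mat U1 B0 (0\<^sub>m (n - r) r) U2)"
      using block_ut_four_block[OF M r b] by simp
    moreover have "similar_mat A M"
      using mat_inv_similar[OF inv M] mat_inv_cancel[OF inv A] by (simp add: M_def)
    ultimately show ?thesis
      using upper_triangular_four_block[OF cU U1(2) U2(2)] similar_mat_trans by blast
  qed
qed

section \<open>The Brauer value of a matrix\<close>

text \<open>The part of \<open>afforded_brauer\<close> that depends on a single matrix, separated
  from the group so that block decompositions and similarity can be applied to it.\<close>

definition bval :: "'k mat \<Rightarrow> complex" where
  "bval A = (\<Sum>a\<in>#proots (char_poly A). lift a)"

lemma bval_similar: "similar_mat A B \<Longrightarrow> bval A = bval B"
  using char_poly_similar[of A B] by (simp add: bval_def)

lemma char_poly_nonzero: "A \<in> carrier_mat n n \<Longrightarrow> char_poly (A :: 'k mat) \<noteq> 0"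
  using degree_monic_char_poly[of A n] by auto

lemma bval_block_ut:
  assumes M: "M \<in> carrier_mat n n" and "r \<le> n" "block_ut r M"
  shows "bval M = bval (ul r M) + bval (lr r M)"
  using char_poly_block_ut[OF assms] block_carrier[OF M, of r] char_poly_nonzero
  by (simp add: bval_def proots_mult)

lemma proots_linear_factors: "proots (\<Prod>a\<leftarrow>as. [:- (a::'k), 1:]) = mset as"
proof (induction as)
  case (Cons a as)
  have "(\<Prod>a\<leftarrow>as. [:- a, 1:]) \<noteq> (0 :: 'k poly)" by (induction as) (auto simp del: mult_pCons_left)
  then have "proots ([:- a, 1:] * (\<Prod>a\<leftarrow>as. [:- a, 1:])) = {#a#} + mset as"
    using Cons by (subst proots_mult) auto
  then show ?case by simp
qed simp

lemma bval_upper_triangular: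
  assumes U: "U \<in> carrier_mat n n" "upper_triangular U"
  shows "bval U = (\<Sum>i<n. lift (U $$ (i,i)))"
proof -
  have "proots (char_poly U) = mset (diag_mat U)"
    using char_poly_upper_triangular[OF U] proots_linear_factors by simp
  then have "bval U = sum_list (map (\<lambda>i. lift (U $$ (i,i))) [0..<n])"
    using U by (simp add: bval_def diag_mat_def sum_mset_sum_list[symmetric] image_mset.compositionality comp_def)
  then show ?thesis by (simp add: sum_list_sum_nth lessThan_atLeast0)
qed

lemma bval_one: "bval (1\<^sub>m n) = of_nat n"
  using bval_upper_triangular[of "1\<^sub>m n" n] by simp

lemma upper_triangular_mult:
  assumes A: "A \<in> carrier_mat n n" "upper_triangular A" and B: "B \<in> carrier_mat n n" "upper_triangular B"
  shows "upper_triangular (A * B)" "\<And>i. i < n \<Longrightarrow> (A * B) $$ (i,i) = A $$ (i,i) * (B $$ (i,i) :: 'k)"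
proof -
  have z: "A $$ (i,k) * B $$ (k,j) = 0" if "i < n" "k < n" "j < i \<or> (j = i \<and> k \<noteq> i)" for i j k
  proof (cases "k < i")
    case True then show ?thesis using A that by (auto simp: upper_triangular_def)
  next
    case False
    then have "j < k" using that by auto
    then show ?thesis using B that by (auto simp: upper_triangular_def)
  qed
  show "upper_triangular (A * B)"
  proof (rule upper_triangularI)
    fix i j assume ij: "j < i" "i < dim_row (A * B)"
    then have "i < n" "j < n" using A by auto
    have "(A * B) $$ (i,j) = (\<Sum>k<n. A $$ (i,k) * B $$ (k,j))"
      using mult_mat_index[OF A(1) B(1) \<open>i < n\<close> \<open>j < n\<close>] .
    also have "\<dots> = 0" using z ij \<open>i < n\<close> by (intro sum.neutral) auto
    finally show "(A * B) $$ (i,j) = 0" .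
  qed
  fix i assume i: "i < n"
  have "(A * B) $$ (i,i) = (\<Sum>k<n. A $$ (i,k) * B $$ (k,i))"
    using mult_mat_index[OF A(1) B(1) i i] .
  also have "\<dots> = (\<Sum>k<n. if k = i then A $$ (i,i) * B $$ (i,i) else 0)"
    using z[OF i] by (intro sum.cong) auto
  finally show "(A * B) $$ (i,i) = A $$ (i,i) * B $$ (i,i)" using i by simp
qed

lemma upper_triangular_pow:
  assumes A: "A \<in> carrier_mat n n" "upper_triangular A"
  shows "upper_triangular (A ^\<^sub>m k) \<and> (\<forall>i<n. (A ^\<^sub>m k) $$ (i,i) = (A $$ (i,i) :: 'k) ^ k)"
proof (induction k)
  case 0
  then show ?case using A by simp
next
  case (Suc k)
  then show ?case
    using upper_triangular_mult[OF pow_carrier_mat[OF A(1), of k] _ A] by (simp add: mult.commute)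
qed

text \<open>Collects what the diagonal of a triangular form knows about the eigenvalues: their power
  sums are the traces of powers, and an equation \<open>A ^\<^sub>m m = 1\<^sub>m n\<close> makes
  them roots of unity, to which lifting applies.\<close>

lemma triangular_form:
  fixes A :: "'k mat"
  assumes A: "A \<in> carrier_mat n n"
  obtains P Q U where "mat_inv n P Q" "A = P * U * Q" "U \<in> carrier_mat n n" "upper_triangular U"
    "\<And>k. mtrace (A ^\<^sub>m k) = (\<Sum>i<n. (U $$ (i,i)) ^ k)"
    "\<And>m i. A ^\<^sub>m m = 1\<^sub>m n \<Longrightarrow> i < n \<Longrightarrow> (U $$ (i,i)) ^ m = 1"
proof -
  obtain U where U: "similar_mat A U" "upper_triangular U" using triangularizable[OF A] by blast
  obtain P Q where PQ: "similar_mat_wit A U P Q" using U(1) by (auto simp: similar_mat_def)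
  note w = similar_mat_witD2[OF A PQ]
  have inv: "mat_inv n P Q" using w by (auto simp: mat_inv_def)
  have pow: "A ^\<^sub>m k = P * U ^\<^sub>m k * Q" for k
    using similar_mat_wit_pow[OF PQ, of k] similar_mat_witD2[OF pow_carrier_mat[OF A]] by blast
  have Uc: "U \<in> carrier_mat n n" using w by blast
  note up = upper_triangular_pow[OF Uc U(2)]
  have tr: "mtrace (A ^\<^sub>m k) = (\<Sum>i<n. (U $$ (i,i)) ^ k)" for k
  proof -
    have "mtrace (A ^\<^sub>m k) = mtrace (U ^\<^sub>m k)"
      unfolding pow by (rule mtrace_conj[OF inv pow_carrier_mat[OF Uc]])
    also have "\<dots> = (\<Sum>i<n. (U $$ (i,i)) ^ k)" using up[of k] Uc by (simp add: mtrace_def)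
    finally show ?thesis .
  qed
  have one: "(U $$ (i,i)) ^ m = 1" if "A ^\<^sub>m m = 1\<^sub>m n" "i < n" for m i
  proof -
    have "U ^\<^sub>m m = Q * (P * U ^\<^sub>m m * Q) * P"
      using mat_inv_cancel[OF mat_inv_sym[OF inv] pow_carrier_mat[OF Uc]] by simp
    also have "\<dots> = 1\<^sub>m n" using that pow[of m] mat_invD[OF inv] by simp
    finally show ?thesis using up[of m] that by auto
  qed
  show ?thesis using that[OF inv _ Uc U(2) tr one] w by blast
qed

lemma bval_triangular:
  assumes "mat_inv n P Q" "A = P * U * Q" "U \<in> carrier_mat n n" "upper_triangular U"
  shows "bval A = (\<Sum>i<n. lift (U $$ (i,i)))"
  using bval_similar[OF mat_inv_similar[OF assms(1,3)]] bval_upper_triangular[OF assms(3,4)] assms(2) by simp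

text \<open>Each eigenvalue is a root of unity of order prime to \<open>p\<close>, so reducing its
  lift returns it, and the sum of the eigenvalues is the trace.\<close>

lemma red_bval:
  assumes A: "A \<in> carrier_mat n n" and m: "A ^\<^sub>m m = 1\<^sub>m n" "m > 0" "\<not> p dvd m"
  shows "red (bval A) = mtrace A"
proof -
  obtain P Q U where U: "mat_inv n P Q" "A = P * U * Q" "U \<in> carrier_mat n n" "upper_triangular U"
    and tr: "\<And>k. mtrace (A ^\<^sub>m k) = (\<Sum>i<n. (U $$ (i,i)) ^ k)"
    and one: "\<And>m i. A ^\<^sub>m m = 1\<^sub>m n \<Longrightarrow> i < n \<Longrightarrow> (U $$ (i,i)) ^ m = 1"
    by (rule triangular_form[OF A]) blast
  have l: "lift (U $$ (i,i)) ^ m = 1" "red (lift (U $$ (i,i))) = U $$ (i,i)" if "i < n" for i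
    using lift_root[OF one[OF m(1) that] m(2,3)] by auto
  have "red (bval A) = (\<Sum>i<n. U $$ (i,i))"
  proof -
    have "red (\<Sum>i<n. lift (U $$ (i,i))) = (\<Sum>i<n. red (lift (U $$ (i,i))))"
      using l m algebraic_int_root_of_unity by (intro red_sum) blast
    then show ?thesis using l by (simp add: bval_triangular[OF U])
  qed
  also have "\<dots> = mtrace A" using tr[of 1] A by simp
  finally show ?thesis .
qed

text \<open>Lifting is multiplicative on roots of unity of order prime to \<open>p\<close>. This
  will show that the nontrivially permuted cosets contribute 0 to an induced character.\<close>

lemma bval_scale:
  assumes A: "A \<in> carrier_mat n n" and m: "A ^\<^sub>m m = 1\<^sub>m n" "m > 0" "\<not> p dvd m" and z: "z ^ m = 1"
  shows "bval (z \<cdot>\<^sub>m A) = lift z * bval A"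
proof -
  obtain P Q U where U: "mat_inv n P Q" "A = P * U * Q" "U \<in> carrier_mat n n" "upper_triangular U"
    and tr: "\<And>k. mtrace (A ^\<^sub>m k) = (\<Sum>i<n. (U $$ (i,i)) ^ k)"
    and one: "\<And>m i. A ^\<^sub>m m = 1\<^sub>m n \<Longrightarrow> i < n \<Longrightarrow> (U $$ (i,i)) ^ m = 1"
    by (rule triangular_form[OF A]) blast
  note D = mat_invD[OF U(1)]
  have "P * (z \<cdot>\<^sub>m U) * Q = z \<cdot>\<^sub>m (P * U) * Q"
    using mult_smult_distrib[OF D(1) U(3)] by simp
  also have "\<dots> = z \<cdot>\<^sub>m (P * U * Q)"
    by (rule mult_smult_assoc_mat[of _ n n _ n]) (use D U in auto)
  finally have "z \<cdot>\<^sub>m A = P * (z \<cdot>\<^sub>m U) * Q" using U(2) by simp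
  moreover have "upper_triangular (z \<cdot>\<^sub>m U)" using U(3,4) by (auto simp: upper_triangular_def)
  ultimately have "bval (z \<cdot>\<^sub>m A) = (\<Sum>i<n. lift ((z \<cdot>\<^sub>m U) $$ (i,i)))"
    using U by (intro bval_triangular[of n P Q]) auto
  also have "\<dots> = (\<Sum>i<n. lift z * lift (U $$ (i,i)))"
    using U(3) lift_mult[OF z one[OF m(1)] m(2,3)] by (intro sum.cong) auto
  also have "\<dots> = lift z * bval A" unfolding bval_triangular[OF U] by (simp add: sum_distrib_left)
  finally show ?thesis .
qed

section \<open>Frobenius and traces\<close>

lemma prime_char_k: "prime CHAR('k)" using prime_p char_k by simp

lemma frobenius_pow_add: "((x::'k) + y) ^ (p ^ a) = x ^ (p ^ a) + y ^ (p ^ a)"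
  using freshmans_dream'[OF prime_char_k] char_k by simp

lemma frobenius_sum: "(\<Sum>i\<in>I. f i :: 'k) ^ (p ^ a) = (\<Sum>i\<in>I. f i ^ (p ^ a))"
  by (rule freshmans_dream_sum'[OF prime_char_k]) (simp add: char_k)

lemma frobenius_inj:
  assumes "(x::'k) ^ (p ^ a) = y ^ (p ^ a)" shows "x = y"
proof -
  have "x ^ (p ^ a) = (x - y) ^ (p ^ a) + y ^ (p ^ a)" using frobenius_pow_add[of "x - y" y a] by simp
  then have "(x - y) ^ (p ^ a) = 0" using assms by simp
  then show ?thesis by simp
qed

text \<open>The trace of a power is a power sum of the eigenvalues, and raising to the power
  \<open>p ^ a\<close> is additive. Traces of arbitrary group elements can thus be controlled by
  those of p-regular ones.\<close>

lemma mtrace_frobenius: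
  assumes A: "(A :: 'k mat) \<in> carrier_mat n n"
  shows "mtrace (A ^\<^sub>m (p ^ a)) = mtrace A ^ (p ^ a)"
proof -
  obtain P Q U where U: "mat_inv n P Q" "A = P * U * Q" "U \<in> carrier_mat n n" "upper_triangular U"
    and tr: "\<And>k. mtrace (A ^\<^sub>m k) = (\<Sum>i<n. (U $$ (i,i)) ^ k)"
    and one: "\<And>m i. A ^\<^sub>m m = 1\<^sub>m n \<Longrightarrow> i < n \<Longrightarrow> (U $$ (i,i)) ^ m = 1"
    by (rule triangular_form[OF A]) blast
  then show ?thesis using tr[of 1] A frobenius_sum[of "\<lambda>i. U $$ (i,i)" "{..<n}" a] by simp
qed

end

section \<open>Burnside's theorem\<close>

text \<open>A column times a row, hence a matrix of rank at most one; sums of such matrices give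
  everything.\<close>

definition outer :: "nat \<Rightarrow> 'a::semiring_1 vec \<Rightarrow> 'a vec \<Rightarrow> 'a mat" where
  "outer n u w = mat n n (\<lambda>(i,j). u $ i * w $ j)"

lemma outer_carrier [simp]: "outer n u w \<in> carrier_mat n n" by (simp add: outer_def)

lemma mult_outer:
  fixes A :: "'a::field mat"
  assumes A: "A \<in> carrier_mat n n" and u: "u \<in> carrier_vec n"
  shows "A * outer n u w = outer n (A *\<^sub>v u) w"
proof (rule eq_matI)
  fix i j assume "i < dim_row (outer n (A *\<^sub>v u) w)" "j < dim_col (outer n (A *\<^sub>v u) w)"
  then have ij: "i < n" "j < n" by (auto simp: outer_def)
  have "(A * outer n u w) $$ (i,j) = (\<Sum>k<n. A $$ (i,k) * (u $ k * w $ j))"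
    using mult_mat_index[OF A outer_carrier ij] ij by (simp add: outer_def)
  also have "\<dots> = (A *\<^sub>v u) $ i * w $ j"
    unfolding mult_mat_vec_index[OF A u ij(1)] by (simp add: sum_distrib_right mult.assoc)
  finally show "(A * outer n u w) $$ (i,j) = outer n (A *\<^sub>v u) w $$ (i,j)"
    using ij by (simp add: outer_def)
qed (use A in \<open>auto simp: outer_def\<close>)

lemma outer_mult:
  fixes A :: "'a::field mat"
  assumes A: "A \<in> carrier_mat n n" and w: "w \<in> carrier_vec n"
  shows "outer n u w * A = outer n u (transpose_mat A *\<^sub>v w)"
proof (rule eq_matI)
  have At: "transpose_mat A \<in> carrier_mat n n" using A by simp
  fix i j assume "i < dim_row (outer n u (transpose_mat A *\<^sub>v w))" "j < dim_col (outer n u (transpose_mat A *\<^sub>v w))"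
  then have ij: "i < n" "j < n" by (auto simp: outer_def)
  have "(outer n u w * A) $$ (i,j) = (\<Sum>k<n. (u $ i * w $ k) * A $$ (k,j))"
    using mult_mat_index[OF outer_carrier A ij] ij by (simp add: outer_def)
  also have "\<dots> = u $ i * (transpose_mat A *\<^sub>v w) $ j"
    unfolding mult_mat_vec_index[OF At w ij(2)] using A ij by (simp add: sum_distrib_left mult_ac)
  finally show "(outer n u w * A) $$ (i,j) = outer n u (transpose_mat A *\<^sub>v w) $$ (i,j)"
    using ij by (simp add: outer_def)
qed (use A in \<open>auto simp: outer_def\<close>)

lemma vsub_kernel:
  fixes A :: "'a::field mat"
  assumes A: "A \<in> carrier_mat n n" shows "vsub n {v \<in> carrier_vec n. A *\<^sub>v v = 0\<^sub>v n}"
  using A by (auto simp: vsub_def mat_vec_zero mult_add_distrib_mat_vec[OF A] mult_mat_vec[OF A])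

text \<open>The last row of the coordinate matrix works: it reads off the last coordinate, which
  vanishes on a proper subspace in an adapted basis, and it is nonzero because \<open>Q * P\<close>
  is the identity.\<close>

lemma annihilator:
  assumes U: "vsub n (U :: 'a::field vec set)" and ne: "U \<noteq> carrier_vec n"
  obtains q where "q \<in> carrier_vec n" "q \<noteq> 0\<^sub>v n" "\<And>u. u \<in> U \<Longrightarrow> q \<bullet> u = 0"
proof -
  have "U \<subset> carrier_vec n" using ne vsubD(1)[OF U] by blast
  from vdim_mono_strict[OF U vsub_all this]
  have r: "vdim n U < n" using vdim_le[of n "carrier_vec n :: 'a vec set"] by simp
  obtain P Q where inv: "mat_inv n P Q" and
    iff: "\<And>v. v \<in> carrier_vec n \<Longrightarrow> v \<in> U \<longleftrightarrow> (\<forall>i. vdim n U \<le> i \<longrightarrow> i < n \<longrightarrow> (Q *\<^sub>v v) $ i = 0)"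
    using adapted_basis[OF U] by metis
  note D = mat_invD[OF inv]
  define q where "q = row Q (n - 1)"
  have n: "n - 1 < n" using r by simp
  have q: "q \<in> carrier_vec n" using D by (auto simp: q_def)
  have "(Q * P) $$ (n - 1, n - 1) = q \<bullet> col P (n - 1)" using D(1,2) n by (simp add: q_def)
  then have "q \<bullet> col P (n - 1) = 1" using D(4) n by simp
  then have "q \<noteq> 0\<^sub>v n" using D n by auto
  moreover have "q \<bullet> u = 0" if "u \<in> U" for u
  proof -
    have "(Q *\<^sub>v u) $ (n - 1) = 0" using iff[OF vsubD(1)[OF U that]] that r n by auto
    then show ?thesis using D(2) n by (simp add: q_def)
  qed
  ultimately show ?thesis using that q by blast
qed

context brauer
begin

text \<open>A nonzero element \<open>T\<close> with kernel of maximal dimension has rank one: otherwise there is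
  \<open>A\<close> such that \<open>T A T\<close> is not a multiple of \<open>T\<close>, and an eigenvector of \<open>T A\<close> in the range of \<open>T\<close>,
  for the eigenvalue \<open>a\<close>, shows that \<open>T A T - a T\<close> has a larger kernel.\<close>

theorem burnside:
  fixes \<A> :: "'k mat set"
  assumes n: "n > 0" and car: "\<A> \<subseteq> carrier_mat n n" and one: "1\<^sub>m n \<in> \<A>"
    and add: "\<And>A B. A \<in> \<A> \<Longrightarrow> B \<in> \<A> \<Longrightarrow> A + B \<in> \<A>"
    and smult: "\<And>c A. A \<in> \<A> \<Longrightarrow> c \<cdot>\<^sub>m A \<in> \<A>"
    and mult: "\<And>A B. A \<in> \<A> \<Longrightarrow> B \<in> \<A> \<Longrightarrow> A * B \<in> \<A>"
    and irr: "\<And>W. vsub n W \<Longrightarrow> (\<And>A w. A \<in> \<A> \<Longrightarrow> w \<in> W \<Longrightarrow> A *\<^sub>v w \<in> W) \<Longrightarrow> W = {0\<^sub>v n} \<or> W = carrier_vec n"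
  shows "\<A> = carrier_mat n n"
proof -
  have cA: "A \<in> carrier_mat n n" if "A \<in> \<A>" for A using car that by blast
  \<comment> \<open>The vectors \<open>A *\<^sub>v x\<close> with \<open>A\<close> in the algebra
    form an invariant subspace containing \<open>x\<close>, so irreducibility makes it the whole
    space.\<close>
  have trans: "\<exists>A\<in>\<A>. A *\<^sub>v x = y" if x: "x \<in> carrier_vec n" "x \<noteq> 0\<^sub>v n" and y: "y \<in> carrier_vec n" for x y
  proof -
    define W where "W = {A *\<^sub>v x | A. A \<in> \<A>}"
    have "vsub n W" unfolding vsub_def
    proof (intro conjI ballI allI)
      show "W \<subseteq> carrier_vec n" using cA x mult_mat_vec_carrier by (fastforce simp: W_def)
      have "(0 \<cdot>\<^sub>m 1\<^sub>m n) *\<^sub>v x = 0\<^sub>v n" by (rule eq_vecI) (use x in auto)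
      then show "0\<^sub>v n \<in> W" using smult[OF one, of 0] by (auto simp: W_def) metis
      fix u assume "u \<in> W"
      then obtain A where A: "A \<in> \<A>" "u = A *\<^sub>v x" by (auto simp: W_def)
      have "c \<cdot>\<^sub>v u = (c \<cdot>\<^sub>m A) *\<^sub>v x" for c by (rule eq_vecI) (use A cA[OF A(1)] x in auto)
      then show "c \<cdot>\<^sub>v u \<in> W" for c using smult[OF A(1)] by (auto simp: W_def)
      fix v assume "v \<in> W"
      then obtain B where B: "B \<in> \<A>" "v = B *\<^sub>v x" by (auto simp: W_def)
      have "u + v = (A + B) *\<^sub>v x"
        using A(2) B(2) add_mult_distrib_mat_vec[OF cA[OF A(1)] cA[OF B(1)] x(1)] by simp
      then show "u + v \<in> W" using add[OF A(1) B(1)] by (auto simp: W_def)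
    qed
    moreover have "A *\<^sub>v w \<in> W" if A: "A \<in> \<A>" and w: "w \<in> W" for A w
    proof -
      from w obtain B where B: "B \<in> \<A>" "w = B *\<^sub>v x" by (auto simp: W_def)
      then have "A *\<^sub>v w = (A * B) *\<^sub>v x" using cA A x by (metis assoc_mult_mat_vec)
      then show ?thesis using mult[OF A B(1)] by (auto simp: W_def)
    qed
    ultimately have "W = {0\<^sub>v n} \<or> W = carrier_vec n" by (rule irr)
    moreover have "x \<in> W" using one x by (auto simp: W_def intro!: exI[of _ "1\<^sub>m n"])
    ultimately have "W = carrier_vec n" using x by auto
    then have "y \<in> W" using y by simp
    then show ?thesis by (auto simp: W_def)
  qed
  define ker where "ker T = {v \<in> carrier_vec n. T *\<^sub>v v = 0\<^sub>v n}" for T :: "'k mat"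
  have "\<exists>T. (T \<in> \<A> \<and> T \<noteq> 0\<^sub>m n n) \<and> (\<forall>S. (S \<in> \<A> \<and> S \<noteq> 0\<^sub>m n n) \<longrightarrow> vdim n (ker S) \<le> vdim n (ker T))"
  proof (rule ex_has_greatest_nat[of "\<lambda>T. T \<in> \<A> \<and> T \<noteq> 0\<^sub>m n n" "1\<^sub>m n" _ "Suc n"])
    have "(1\<^sub>m n :: 'k mat) $$ (0,0) \<noteq> 0\<^sub>m n n $$ (0,0)" using n by simp
    then have "(1\<^sub>m n :: 'k mat) \<noteq> 0\<^sub>m n n" by metis
    then show "1\<^sub>m n \<in> \<A> \<and> (1\<^sub>m n :: 'k mat) \<noteq> 0\<^sub>m n n" using one by simp
    show "\<forall>S. S \<in> \<A> \<and> S \<noteq> 0\<^sub>m n n \<longrightarrow> vdim n (ker S) < Suc n"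
      by (simp add: less_Suc_eq_le vdim_le)
  qed
  then obtain T where T: "T \<in> \<A>" "T \<noteq> 0\<^sub>m n n" and
    max: "\<And>S. S \<in> \<A> \<Longrightarrow> S \<noteq> 0\<^sub>m n n \<Longrightarrow> vdim n (ker S) \<le> vdim n (ker T)" by blast
  note cT = cA[OF T(1)]
  have rank1: "\<exists>c. T *\<^sub>v x2 = c \<cdot>\<^sub>v (T *\<^sub>v x1)"
    if x1: "x1 \<in> carrier_vec n" "T *\<^sub>v x1 \<noteq> 0\<^sub>v n" and x2: "x2 \<in> carrier_vec n" for x1 x2
  proof (rule ccontr)
    assume no: "\<not> ?thesis"
    obtain A where A: "A \<in> \<A>" "A *\<^sub>v (T *\<^sub>v x1) = x2" using trans[of "T *\<^sub>v x1" x2] x1 x2 cT by auto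
    note cAA = cA[OF A(1)]
    define R where "R = {T *\<^sub>v v | v. v \<in> carrier_vec n}"
    have R: "vsub n R" unfolding vsub_def
    proof (intro conjI ballI allI)
      show "R \<subseteq> carrier_vec n" using cT by (auto simp: R_def)
      have "0\<^sub>v n = T *\<^sub>v 0\<^sub>v n" using mat_vec_zero[OF cT] by simp
      then show "0\<^sub>v n \<in> R" unfolding R_def using zero_carrier_vec by blast
      fix u assume "u \<in> R"
      then obtain u' where u': "u' \<in> carrier_vec n" "u = T *\<^sub>v u'" by (auto simp: R_def)
      have "c \<cdot>\<^sub>v u = T *\<^sub>v (c \<cdot>\<^sub>v u')" for c using mult_mat_vec[OF cT u'(1), of c] u' by simp
      then show "c \<cdot>\<^sub>v u \<in> R" for c unfolding R_def using u'(1) smult_carrier_vec by blast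
      fix v assume "v \<in> R"
      then obtain v' where v': "v' \<in> carrier_vec n" "v = T *\<^sub>v v'" by (auto simp: R_def)
      have "u + v = T *\<^sub>v (u' + v')" using mult_add_distrib_mat_vec[OF cT u'(1) v'(1)] u' v' by simp
      then show "u + v \<in> R" using add_carrier_vec[OF u'(1) v'(1)] unfolding R_def by blast
    qed
    have "T *\<^sub>v x1 \<in> R" using x1 by (auto simp: R_def)
    then have Rnz: "R \<noteq> {0\<^sub>v n}" using x1 by auto
    have TAc: "T * A \<in> carrier_mat n n" using cT cAA by simp
    have "(T * A) *\<^sub>v w \<in> R" if "w \<in> R" for w
      using vsubD(1)[OF R that] cT cAA by (auto simp: R_def)
    from eigenvector_in_invariant[OF R Rnz TAc this]
    obtain y a where y: "y \<in> R" "y \<noteq> 0\<^sub>v n" "(T * A) *\<^sub>v y = a \<cdot>\<^sub>v y" by blast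
    then obtain x where x: "x \<in> carrier_vec n" "y = T *\<^sub>v x" by (auto simp: R_def)
    \<comment> \<open>\<open>S\<close> maps \<open>x1\<close> to
      \<open>T *\<^sub>v x2 - a \<cdot>\<^sub>v (T *\<^sub>v x1)\<close>, which is nonzero by
      assumption. It kills the kernel of \<open>T\<close> and moreover \<open>x\<close>, whose image
      \<open>y\<close> under \<open>T\<close> is a nonzero eigenvector of
      \<open>T * A\<close>.\<close>
    define S where "S = T * A * T + (- a) \<cdot>\<^sub>m T"
    have S: "S \<in> \<A>" unfolding S_def using T A by (intro add mult smult)
    note cS = cA[OF S]
    have Sv: "S *\<^sub>v v = T *\<^sub>v (A *\<^sub>v (T *\<^sub>v v)) + (- a) \<cdot>\<^sub>v (T *\<^sub>v v)" if v: "v \<in> carrier_vec n" for v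
    proof -
      have "(- a) \<cdot>\<^sub>m T *\<^sub>v v = (- a) \<cdot>\<^sub>v (T *\<^sub>v v)" by (rule eq_vecI) (use cT v in auto)
      moreover have "T * A * T *\<^sub>v v = T *\<^sub>v (A *\<^sub>v (T *\<^sub>v v))"
        using assoc_mult_mat_vec[OF TAc cT v] assoc_mult_mat_vec[OF cT cAA, of "T *\<^sub>v v"] cT v by simp
      moreover have "T * A * T \<in> carrier_mat n n" "(- a) \<cdot>\<^sub>m T \<in> carrier_mat n n" using cT cAA by auto
      ultimately show ?thesis unfolding S_def using add_mult_distrib_mat_vec[of "T * A * T" n n "(- a) \<cdot>\<^sub>m T" v] v
        by metis
    qed
    have "S \<noteq> 0\<^sub>m n n"
    proof
      assume "S = 0\<^sub>m n n"
      then have "S *\<^sub>v x1 = 0\<^sub>v n" using x1 by auto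
      then have e: "T *\<^sub>v x2 + (- a) \<cdot>\<^sub>v (T *\<^sub>v x1) = 0\<^sub>v n" using Sv[OF x1(1)] A by simp
      have "T *\<^sub>v x2 = a \<cdot>\<^sub>v (T *\<^sub>v x1)"
      proof (rule eq_vecI)
        fix i assume "i < dim_vec (a \<cdot>\<^sub>v (T *\<^sub>v x1))"
        then have i: "i < n" using cT by simp
        have "(T *\<^sub>v x2 + (- a) \<cdot>\<^sub>v (T *\<^sub>v x1)) $ i = 0" using e i by simp
        then show "(T *\<^sub>v x2) $ i = (a \<cdot>\<^sub>v (T *\<^sub>v x1)) $ i" using i cT by simp
      qed (use cT in auto)
      then show False using no by blast
    qed
    then have le: "vdim n (ker S) \<le> vdim n (ker T)" using max S by blast
    have "ker T \<subset> ker S"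
    proof
      show "ker T \<subseteq> ker S"
      proof
        fix v assume "v \<in> ker T"
        then have v: "v \<in> carrier_vec n" "T *\<^sub>v v = 0\<^sub>v n" by (auto simp: ker_def)
        have "S *\<^sub>v v = 0\<^sub>v n + (- a) \<cdot>\<^sub>v 0\<^sub>v n"
          unfolding Sv[OF v(1)] v(2) using mat_vec_zero[OF cT] mat_vec_zero[OF cAA] by simp
        also have "\<dots> = 0\<^sub>v n" by (rule eq_vecI) auto
        finally show "v \<in> ker S" using v by (simp add: ker_def)
      qed
      have "T *\<^sub>v (A *\<^sub>v y) = a \<cdot>\<^sub>v y" using y(3) cT cAA vsubD(1)[OF R y(1)] by simp
      then have "S *\<^sub>v x = a \<cdot>\<^sub>v y + (- a) \<cdot>\<^sub>v y" unfolding Sv[OF x(1)] x(2)[symmetric] by simp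
      also have "\<dots> = 0\<^sub>v n" by (rule eq_vecI) (use vsubD(1)[OF R y(1)] in auto)
      finally have "x \<in> ker S" using x by (simp add: ker_def)
      moreover have "x \<notin> ker T" using x y by (simp add: ker_def)
      ultimately show "ker T \<noteq> ker S" by blast
    qed
    then have "vdim n (ker T) < vdim n (ker S)"
      unfolding ker_def by (intro vdim_mono_strict vsub_kernel cT cS)
    then show False using le by simp
  qed
  obtain x0 where x0: "x0 \<in> carrier_vec n" "T *\<^sub>v x0 \<noteq> 0\<^sub>v n"
  proof -
    have "\<exists>j<n. T *\<^sub>v unit_vec n j \<noteq> 0\<^sub>v n"
    proof (rule ccontr)
      assume no: "\<not> ?thesis"
      have "T = 0\<^sub>m n n"
      proof (rule eq_matI)
        fix i j assume "i < dim_row (0\<^sub>m n n :: 'k mat)" "j < dim_col (0\<^sub>m n n :: 'k mat)"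
        then have ij: "i < n" "j < n" by auto
        then have "T *\<^sub>v unit_vec n j = 0\<^sub>v n" using no by blast
        then have "col T j $ i = 0" using mat_vec_unit[OF cT ij(2)] ij by simp
        then show "T $$ (i,j) = 0\<^sub>m n n $$ (i,j)" using ij cT by simp
      qed (use cT in auto)
      then show False using T by blast
    qed
    then show ?thesis using that unit_vec_carrier by blast
  qed
  define y0 where "y0 = T *\<^sub>v x0"
  have y0: "y0 \<in> carrier_vec n" "y0 \<noteq> 0\<^sub>v n" using x0 cT by (auto simp: y0_def)
  have "\<forall>j. \<exists>c. T *\<^sub>v unit_vec n j = c \<cdot>\<^sub>v y0" using rank1[OF x0] y0_def by simp
  then obtain c where c: "\<And>j. T *\<^sub>v unit_vec n j = c j \<cdot>\<^sub>v y0" by metis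
  define f where "f = vec n c"
  have f: "f \<in> carrier_vec n" by (simp add: f_def)
  have Tf: "T = outer n y0 f"
  proof (rule eq_matI)
    fix i j assume "i < dim_row (outer n y0 f)" "j < dim_col (outer n y0 f)"
    then have ij: "i < n" "j < n" by (auto simp: outer_def)
    have "T $$ (i,j) = (T *\<^sub>v unit_vec n j) $ i" using mat_vec_unit[OF cT ij(2)] ij cT by simp
    then show "T $$ (i,j) = outer n y0 f $$ (i,j)" using c[of j] ij y0 by (simp add: outer_def f_def)
  qed (use cT in \<open>auto simp: outer_def\<close>)
  have f0: "f \<noteq> 0\<^sub>v n"
  proof
    assume "f = 0\<^sub>v n"
    then have "T = 0\<^sub>m n n" unfolding Tf by (intro eq_matI) (auto simp: outer_def)
    then show False using T by blast
  qed
  \<comment> \<open>Multiplying \<open>T\<close> by \<open>B\<close> from the right replaces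
    \<open>f\<close> by these vectors. If they did not fill the space, a nonzero \<open>q\<close>
    orthogonal to all of them would satisfy \<open>f \<bullet> (B *\<^sub>v q) = 0\<close> for all
    \<open>B\<close>; by transitivity \<open>B *\<^sub>v q\<close> is arbitrary, so \<open>f\<close>
    would be 0.\<close>
  define U where "U = {transpose_mat B *\<^sub>v f | B. B \<in> \<A>}"
  have U: "vsub n U" unfolding vsub_def
  proof (intro conjI ballI allI)
    have "transpose_mat B *\<^sub>v f \<in> carrier_vec n" if "B \<in> \<A>" for B
      using mult_mat_vec_carrier[of "transpose_mat B" n n f] cA[OF that] f by simp
    then show "U \<subseteq> carrier_vec n" by (auto simp: U_def)
    have "transpose_mat (0 \<cdot>\<^sub>m 1\<^sub>m n) *\<^sub>v f = 0\<^sub>v n" by (rule eq_vecI) (use f in auto)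
    then show "0\<^sub>v n \<in> U" using smult[OF one, of 0] unfolding U_def by force
    fix u assume "u \<in> U"
    then obtain A where A: "A \<in> \<A>" "u = transpose_mat A *\<^sub>v f" by (auto simp: U_def)
    have "c \<cdot>\<^sub>v u = transpose_mat (c \<cdot>\<^sub>m A) *\<^sub>v f" for c by (rule eq_vecI) (use A cA[OF A(1)] f in auto)
    then show "c \<cdot>\<^sub>v u \<in> U" for c using smult[OF A(1)] by (auto simp: U_def)
    fix v assume "v \<in> U"
    then obtain B where B: "B \<in> \<A>" "v = transpose_mat B *\<^sub>v f" by (auto simp: U_def)
    have "u + v = transpose_mat (A + B) *\<^sub>v f"
      using A B cA[OF A(1)] cA[OF B(1)] f transpose_add[OF cA[OF A(1)] cA[OF B(1)]]
      by (simp add: add_mult_distrib_mat_vec[of _ n n])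
    then show "u + v \<in> U" using add[OF A(1) B(1)] by (auto simp: U_def)
  qed
  have Uall: "U = carrier_vec n"
  proof (rule ccontr)
    assume "U \<noteq> carrier_vec n"
    then obtain q where q: "q \<in> carrier_vec n" "q \<noteq> 0\<^sub>v n" "\<And>u. u \<in> U \<Longrightarrow> q \<bullet> u = 0"
      using annihilator[OF U] by blast
    have fv: "f \<bullet> v = 0" if v: "v \<in> carrier_vec n" for v
    proof -
      obtain B where B: "B \<in> \<A>" "B *\<^sub>v q = v" using trans[OF q(1,2) v] by blast
      have "q \<bullet> (transpose_mat B *\<^sub>v f) = 0" using q(3) B by (auto simp: U_def)
      moreover have "transpose_mat B *\<^sub>v f \<in> carrier_vec n"
        using mult_mat_vec_carrier[of "transpose_mat B" n n f] cA[OF B(1)] f by simp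
      ultimately show ?thesis using transpose_vec_mult_scalar[OF cA[OF B(1)] q(1) f] B(2)
        comm_scalar_prod[OF q(1)] by metis
    qed
    have "f = 0\<^sub>v n"
    proof (rule eq_vecI)
      fix i assume "i < dim_vec (0\<^sub>v n :: 'k vec)"
      then have i: "i < n" by simp
      then show "f $ i = 0\<^sub>v n $ i" using fv[of "unit_vec n i"] f by simp
    qed (use f in auto)
    then show False using f0 by blast
  qed
  have outers: "outer n x y \<in> \<A>" if x: "x \<in> carrier_vec n" and y: "y \<in> carrier_vec n" for x y
  proof -
    obtain A where A: "A \<in> \<A>" "A *\<^sub>v y0 = x" using trans[OF y0 x] by blast
    have "y \<in> U" using Uall y by simp
    then obtain B where B: "B \<in> \<A>" "transpose_mat B *\<^sub>v f = y" unfolding U_def by blast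
    have "A * T * B = outer n x y"
      unfolding Tf mult_outer[OF cA[OF A(1)] y0(1)] A(2) outer_mult[OF cA[OF B(1)] f] B(2) ..
    then show ?thesis using mult A B T by metis
  qed
  have "M \<in> \<A>" if M: "M \<in> carrier_mat n n" for M
  proof -
    \<comment> \<open>The matrix is assembled column by column; adding column \<open>k\<close> means
      adding one outer product with a unit vector.\<close>
    have "k \<le> n \<Longrightarrow> mat n n (\<lambda>(i,c). if c < k then M $$ (i,c) else 0) \<in> \<A>" for k
    proof (induction k)
      case 0
      have eq: "mat n n (\<lambda>(i,c). if c < 0 then M $$ (i,c) else 0) = 0 \<cdot>\<^sub>m (1\<^sub>m n)" by (rule eq_matI) auto
      show ?case unfolding eq by (rule smult[OF one])
    next
      case (Suc k)
      have "mat n n (\<lambda>(i,c). if c < Suc k then M $$ (i,c) else 0) =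
        mat n n (\<lambda>(i,c). if c < k then M $$ (i,c) else 0) + outer n (col M k) (unit_vec n k)"
        by (rule eq_matI) (use Suc.prems M in \<open>auto simp: outer_def unit_vec_def less_Suc_eq\<close>)
      moreover have "outer n (col M k) (unit_vec n k) \<in> \<A>" by (intro outers) (use M in auto)
      ultimately show ?case using Suc add by simp
    qed
    from this[of n] have "mat n n (\<lambda>(i,c). if c < n then M $$ (i,c) else 0) \<in> \<A>" by simp
    moreover have "mat n n (\<lambda>(i,c). if c < n then M $$ (i,c) else 0) = M"
      by (rule eq_matI) (use M in auto)
    ultimately show ?thesis by simp
  qed
  then show ?thesis using car by blast
qed

end

section \<open>Representations with equal Brauer characters\<close>

lemma representationD:
  fixes G (structure)
  assumes "representation G n X"
  shows "n > 0" "\<And>g. g \<in> carrier G \<Longrightarrow> X g \<in> carrier_mat n n" "X \<one>\<^bsub>G\<^esub> = 1\<^sub>m n"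
    "\<And>g h. g \<in> carrier G \<Longrightarrow> h \<in> carrier G \<Longrightarrow> X (g \<otimes>\<^bsub>G\<^esub> h) = X g * X h"
  using assms by (auto simp: representation_def)

lemma irreducible_representation_iff:
  "irreducible_representation G n X \<longleftrightarrow> representation G n X \<and>
     (\<forall>W. vsub n W \<and> (\<forall>g\<in>carrier G. \<forall>w\<in>W. X g *\<^sub>v w \<in> W) \<longrightarrow> W = {0\<^sub>v n} \<or> W = carrier_vec n)"
  by (simp add: irreducible_representation_def subspace_iff_vsub)

lemma representation_pow:
  fixes G (structure)
  assumes G: "group G" and X: "representation G n X" and g: "g \<in> carrier G"
  shows "X (g [^]\<^bsub>G\<^esub> (k::nat)) = X g ^\<^sub>m k"
proof -
  interpret group G by fact
  note D = representationD[OF X]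
  show ?thesis
  proof (induction k)
    case 0
    then show ?case using D(2)[OF g] D(3) by auto
  next
    case (Suc k)
    then show ?case using D(4) g by simp
  qed
qed

lemma representation_inv:
  fixes G (structure)
  assumes G: "group G" and X: "representation G n X" and g: "g \<in> carrier G"
  shows "mat_inv n (X g) (X (inv\<^bsub>G\<^esub> g))"
proof -
  interpret group G by fact
  note D = representationD[OF X]
  have "X g * X (inv g) = 1\<^sub>m n" "X (inv g) * X g = 1\<^sub>m n"
    using D(3) D(4)[of g "inv g"] D(4)[of "inv g" g] g by auto
  then show ?thesis using D(2) g by (simp add: mat_inv_def)
qed

section \<open>The image of the group algebra and the trace form\<close>

text \<open>The image under \<open>X\<close> of the group algebra element with coefficients
  \<open>c\<close>.\<close>

definition gsum :: "('a, 'b) monoid_scheme \<Rightarrow> nat \<Rightarrow> ('a \<Rightarrow> 'k::field mat) \<Rightarrow> ('a \<Rightarrow> 'k) \<Rightarrow> 'k mat" where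
  "gsum G n X c = mat n n (\<lambda>(i,j). \<Sum>g\<in>carrier G. c g * X g $$ (i,j))"

lemma gsum_carrier [simp]: "gsum G n X c \<in> carrier_mat n n" by (simp add: gsum_def)

lemma mtrace_gsum_mult:
  assumes "\<And>g. g \<in> carrier G \<Longrightarrow> X g \<in> carrier_mat n n" and B: "B \<in> carrier_mat n n"
  shows "mtrace (gsum G n X c * B) = (\<Sum>g\<in>carrier G. c g * mtrace (X g * B))"
proof -
  have "mtrace (gsum G n X c * B) = (\<Sum>i<n. \<Sum>k<n. (\<Sum>g\<in>carrier G. c g * X g $$ (i,k)) * B $$ (k,i))"
    using mult_mat_index[OF gsum_carrier B, of _ _ G X c] by (simp add: mtrace_def) (simp add: gsum_def)
  also have "\<dots> = (\<Sum>i<n. \<Sum>k<n. \<Sum>g\<in>carrier G. c g * (X g $$ (i,k) * B $$ (k,i)))"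
    by (simp add: sum_distrib_right mult.assoc)
  also have "\<dots> = (\<Sum>i<n. \<Sum>g\<in>carrier G. \<Sum>k<n. c g * (X g $$ (i,k) * B $$ (k,i)))"
    by (intro sum.cong refl sum.swap)
  also have "\<dots> = (\<Sum>g\<in>carrier G. \<Sum>i<n. \<Sum>k<n. c g * (X g $$ (i,k) * B $$ (k,i)))"
    by (rule sum.swap)
  also have "\<dots> = (\<Sum>g\<in>carrier G. c g * mtrace (X g * B))"
  proof (rule sum.cong[OF refl])
    fix g assume g: "g \<in> carrier G"
    have "mtrace (X g * B) = (\<Sum>i<n. \<Sum>k<n. X g $$ (i,k) * B $$ (k,i))"
      using mult_mat_index[OF assms(1)[OF g] B] assms(1)[OF g] by (simp add: mtrace_def)
    then show "(\<Sum>i<n. \<Sum>k<n. c g * (X g $$ (i,k) * B $$ (k,i))) = c g * mtrace (X g * B)"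
      by (simp add: sum_distrib_left)
  qed
  finally show ?thesis .
qed

definition emat :: "nat \<Rightarrow> nat \<Rightarrow> nat \<Rightarrow> 'a::zero_neq_one mat" where
  "emat n i j = mat n n (\<lambda>(a,b). if a = i \<and> b = j then 1 else 0)"

text \<open>The entry at \<open>(i,j)\<close> is recovered as the trace against the matrix unit at
  \<open>(j,i)\<close>.\<close>

lemma mtrace_nondegenerate:
  fixes M :: "'k::field mat"
  assumes M: "M \<in> carrier_mat n n" and tr: "\<And>A. A \<in> carrier_mat n n \<Longrightarrow> mtrace (M * A) = 0"
  shows "M = 0\<^sub>m n n"
proof (rule eq_matI)
  fix i j assume "i < dim_row (0\<^sub>m n n :: 'k mat)" "j < dim_col (0\<^sub>m n n :: 'k mat)"
  then have ij: "i < n" "j < n" by auto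
  have E: "(emat n j i :: 'k mat) \<in> carrier_mat n n" by (simp add: emat_def)
  have "mtrace (M * emat n j i) = (\<Sum>a<n. \<Sum>k<n. M $$ (a,k) * emat n j i $$ (k,a))"
    using mult_mat_index[OF M E] M E by (simp add: mtrace_def)
  also have "\<dots> = (\<Sum>a<n. \<Sum>k<n. if k = j then if a = i then M $$ (i,j) else 0 else 0)"
    by (intro sum.cong refl) (auto simp: emat_def)
  also have "\<dots> = M $$ (i,j)" using ij by simp
  finally show "M $$ (i,j) = 0\<^sub>m n n $$ (i,j)" using tr[OF E] ij by simp
qed (use M in auto)

text \<open>Padding with zero rows to a square matrix leaves a matrix with a zero row; it has no
  inverse, so its kernel is nontrivial.\<close>

lemma wide_matrix_kernel:
  fixes A :: "'k::field mat"
  assumes A: "A \<in> carrier_mat m n" and mn: "m < n"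
  obtains v where "v \<in> carrier_vec n" "v \<noteq> 0\<^sub>v n" "A *\<^sub>v v = 0\<^sub>v m"
proof -
  define B where "B = mat n n (\<lambda>(i,j). if i < m then A $$ (i,j) else 0)"
  have B: "B \<in> carrier_mat n n" by (simp add: B_def)
  have "\<not> (\<forall>v. v \<in> carrier_vec n \<longrightarrow> B *\<^sub>v v = 0\<^sub>v n \<longrightarrow> v = 0\<^sub>v n)"
  proof
    assume "\<forall>v. v \<in> carrier_vec n \<longrightarrow> B *\<^sub>v v = 0\<^sub>v n \<longrightarrow> v = 0\<^sub>v n"
    then obtain C where C: "mat_inv n B C" using mat_inv_if_kernel_trivial[OF B] by blast
    note D = mat_invD[OF C]
    have "(B * C) $$ (m,m) = (\<Sum>k<n. B $$ (m,k) * C $$ (k,m))"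
      using mult_mat_index[OF D(1,2) mn mn] .
    also have "\<dots> = 0" using mn by (intro sum.neutral) (auto simp: B_def)
    finally show False using D(3) mn by simp
  qed
  then obtain v where v: "v \<in> carrier_vec n" "B *\<^sub>v v = 0\<^sub>v n" "v \<noteq> 0\<^sub>v n" by blast
  have "A *\<^sub>v v = 0\<^sub>v m"
  proof (rule eq_vecI)
    fix i assume "i < dim_vec (0\<^sub>v m :: 'k vec)"
    then have i: "i < m" "i < n" using mn by auto
    have "(A *\<^sub>v v) $ i = (B *\<^sub>v v) $ i"
      unfolding mult_mat_vec_index[OF A v(1) i(1)] mult_mat_vec_index[OF B v(1) i(2)]
      using i by (intro sum.cong) (auto simp: B_def)
    then show "(A *\<^sub>v v) $ i = 0\<^sub>v m $ i" using v(2) i by simp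
  qed (use A in auto)
  then show ?thesis using that v by blast
qed

text \<open>Reducibility expressed by a change of basis. The strict bounds on \<open>r\<close> make
  both diagonal blocks representations of smaller positive degree.\<close>

definition block_rep :: "('a, 'b) monoid_scheme \<Rightarrow> nat \<Rightarrow> ('a \<Rightarrow> 'k::field mat) \<Rightarrow> nat \<Rightarrow> 'k mat \<Rightarrow> 'k mat \<Rightarrow> bool" where
  "block_rep G n X r P Q \<longleftrightarrow> 0 < r \<and> r < n \<and> mat_inv n P Q \<and> (\<forall>g\<in>carrier G. block_ut r (Q * X g * P))"

lemma reducible_block_rep:
  fixes G (structure)
  assumes X: "representation G n X" and W: "vsub n W" "\<And>g w. g \<in> carrier G \<Longrightarrow> w \<in> W \<Longrightarrow> X g *\<^sub>v w \<in> W"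
    and ne: "W \<noteq> {0\<^sub>v n}" "W \<noteq> carrier_vec n"
  obtains r P Q where "block_rep G n X r P Q"
proof -
  have sub: "{0\<^sub>v n} \<subset> W" "W \<subset> carrier_vec n" using ne vsubD[OF W(1)] by auto
  have "0 < vdim n W" using vdim_mono_strict[OF vsub_zero W(1) sub(1)] by simp
  moreover have "vdim n W < n" using vdim_mono_strict[OF W(1) vsub_all sub(2)]
    by (rule less_le_trans[OF _ vdim_le])
  moreover obtain P Q where inv: "mat_inv n P Q" and r: "vdim n W \<le> n" and
    iff: "\<And>v. v \<in> carrier_vec n \<Longrightarrow> v \<in> W \<longleftrightarrow> (\<forall>i. vdim n W \<le> i \<longrightarrow> i < n \<longrightarrow> (Q *\<^sub>v v) $ i = 0)"
    using adapted_basis[OF W(1)] by metis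
  moreover have "block_ut (vdim n W) (Q * X g * P)" if "g \<in> carrier G" for g
    using invariant_block_ut[OF W(1) inv r iff representationD(2)[OF X that]] W(2) that by blast
  ultimately have "block_rep G n X (vdim n W) P Q" by (simp add: block_rep_def)
  then show ?thesis by (rule that)
qed

lemma block_rep_parts:
  fixes G (structure)
  assumes G: "group G" and X: "representation G n X" and b: "block_rep G n X r P Q"
  shows "representation G r (\<lambda>g. ul r (Q * X g * P))" "representation G (n - r) (\<lambda>g. lr r (Q * X g * P))"
    "\<And>g. g \<in> carrier G \<Longrightarrow> Q * X g * P \<in> carrier_mat n n"
    "\<And>g h. g \<in> carrier G \<Longrightarrow> h \<in> carrier G \<Longrightarrow> Q * X (g \<otimes>\<^bsub>G\<^esub> h) * P = (Q * X g * P) * (Q * X h * P)"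
    "\<And>g. g \<in> carrier G \<Longrightarrow> mtrace (X g) = mtrace (ul r (Q * X g * P)) + mtrace (lr r (Q * X g * P))"
proof -
  interpret group G by fact
  note D = representationD[OF X]
  from b have r: "0 < r" "r < n" and inv: "mat_inv n P Q" and
    bu: "\<And>g. g \<in> carrier G \<Longrightarrow> block_ut r (Q * X g * P)" by (auto simp: block_rep_def)
  note I = mat_invD[OF inv]
  show car: "Q * X g * P \<in> carrier_mat n n" if "g \<in> carrier G" for g using I D(2)[OF that] by simp
  show mul: "Q * X (g \<otimes> h) * P = (Q * X g * P) * (Q * X h * P)" if "g \<in> carrier G" "h \<in> carrier G" for g h
    unfolding D(4)[OF that] using mat_inv_conj_mult[OF inv D(2)[OF that(1)] D(2)[OF that(2)]] by simp
  have one: "Q * X \<one> * P = 1\<^sub>m n" unfolding D(3) using I by simp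
  have rn: "r \<le> n" using r by simp
  show "representation G r (\<lambda>g. ul r (Q * X g * P))" unfolding representation_def
    using r one block_ut_one[OF rn] block_carrier(1)[OF car] block_ut_mult(1)[OF car car rn bu bu] mul by auto
  show "representation G (n - r) (\<lambda>g. lr r (Q * X g * P))" unfolding representation_def
    using r one block_ut_one[OF rn] block_carrier(3)[OF car] block_ut_mult(2)[OF car car rn bu bu] mul by auto
  show "mtrace (X g) = mtrace (ul r (Q * X g * P)) + mtrace (lr r (Q * X g * P))" if "g \<in> carrier G" for g
  proof -
    have "mtrace (X g) = mtrace (P * (Q * X g * P) * Q)"
      using mat_inv_cancel[OF inv D(2)[OF that]] by simp
    also have "\<dots> = mtrace (Q * X g * P)" by (rule mtrace_conj[OF inv car[OF that]])
    also have "\<dots> = mtrace (ul r (Q * X g * P)) + mtrace (lr r (Q * X g * P))"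
      by (rule mtrace_block_ut[OF car[OF that] rn bu[OF that]])
    finally show ?thesis .
  qed
qed

context brauer
begin

text \<open>Burnside's theorem applied to the image of the group algebra. Closure under products is
  convolution: the coefficient at \<open>x\<close> collects all \<open>g\<close> paired with
  \<open>inv g \<otimes> x\<close>.\<close>

lemma gsum_surj:
  fixes G (structure)
  assumes G: "group G" and fin: "finite (carrier G)" and X: "irreducible_representation G n (X :: 'a \<Rightarrow> 'k mat)"
    and M: "M \<in> carrier_mat n n"
  shows "\<exists>c. M = gsum G n X c"
proof -
  interpret group G by fact
  have rX: "representation G n X" using X by (simp add: irreducible_representation_iff)
  note D = representationD[OF rX]
  define \<A> where "\<A> = range (gsum G n X)"
  have X\<A>: "X h \<in> \<A>" if h: "h \<in> carrier G" for h
  proof -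
    have "X h = gsum G n X (\<lambda>g. if g = h then 1 else 0)"
    proof (rule eq_matI)
      fix i j assume "i < dim_row (gsum G n X (\<lambda>g. if g = h then 1 else 0))"
        "j < dim_col (gsum G n X (\<lambda>g. if g = h then 1 else 0))"
      then have ij: "i < n" "j < n" by (auto simp: gsum_def)
      have "(\<Sum>g\<in>carrier G. (if g = h then 1 else 0) * X g $$ (i,j))
        = (\<Sum>g\<in>carrier G. if g = h then X h $$ (i,j) else 0)" by (rule sum.cong) auto
      then show "X h $$ (i,j) = gsum G n X (\<lambda>g. if g = h then 1 else 0) $$ (i,j)"
        using ij fin h by (simp add: gsum_def)
    qed (use D(2)[OF h] in \<open>auto simp: gsum_def\<close>)
    then show ?thesis by (simp add: \<A>_def)
  qed
  have "\<A> = carrier_mat n n"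
  proof (rule burnside)
    show "n > 0" by fact
    show "\<A> \<subseteq> carrier_mat n n" by (auto simp: \<A>_def)
    show "1\<^sub>m n \<in> \<A>" using X\<A>[of \<one>] D(3) by simp
    fix A B assume "A \<in> \<A>" "B \<in> \<A>"
    then obtain c d where A: "A = gsum G n X c" and B: "B = gsum G n X d" by (auto simp: \<A>_def)
    have "A + B = gsum G n X (\<lambda>g. c g + d g)"
      unfolding A B by (rule eq_matI) (auto simp: gsum_def sum.distrib distrib_right)
    then show "A + B \<in> \<A>" by (simp add: \<A>_def)
    have "A * B = gsum G n X (\<lambda>x. \<Sum>g\<in>carrier G. c g * d (inv g \<otimes> x))"
    proof (rule eq_matI)
      fix i j assume "i < dim_row (gsum G n X (\<lambda>x. \<Sum>g\<in>carrier G. c g * d (inv g \<otimes> x)))"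
       "j < dim_col (gsum G n X (\<lambda>x. \<Sum>g\<in>carrier G. c g * d (inv g \<otimes> x)))"
      then have ij: "i < n" "j < n" by (auto simp: gsum_def)
      have "(A * B) $$ (i,j) = (\<Sum>k<n. (\<Sum>g\<in>carrier G. c g * X g $$ (i,k)) * (\<Sum>h\<in>carrier G. d h * X h $$ (k,j)))"
        using mult_mat_index[of A n n B n i j] ij by (simp add: A B gsum_def)
      also have "\<dots> = (\<Sum>k<n. \<Sum>g\<in>carrier G. \<Sum>h\<in>carrier G. c g * d h * (X g $$ (i,k) * X h $$ (k,j)))"
        by (simp add: sum_product mult_ac)
      also have "\<dots> = (\<Sum>g\<in>carrier G. \<Sum>k<n. \<Sum>h\<in>carrier G. c g * d h * (X g $$ (i,k) * X h $$ (k,j)))"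
        by (rule sum.swap)
      also have "\<dots> = (\<Sum>g\<in>carrier G. \<Sum>h\<in>carrier G. \<Sum>k<n. c g * d h * (X g $$ (i,k) * X h $$ (k,j)))"
        by (intro sum.cong refl sum.swap)
      also have "\<dots> = (\<Sum>g\<in>carrier G. \<Sum>h\<in>carrier G. c g * d h * X (g \<otimes> h) $$ (i,j))"
        using D(4) mult_mat_index[OF D(2) D(2) ij] by (intro sum.cong refl) (simp add: sum_distrib_left)
      also have "\<dots> = (\<Sum>g\<in>carrier G. \<Sum>x\<in>carrier G. c g * d (inv g \<otimes> x) * X x $$ (i,j))"
      proof (rule sum.cong[OF refl])
        fix g assume g: "g \<in> carrier G"
        show "(\<Sum>h\<in>carrier G. c g * d h * X (g \<otimes> h) $$ (i,j))
          = (\<Sum>x\<in>carrier G. c g * d (inv g \<otimes> x) * X x $$ (i,j))"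
          by (rule sum.reindex_bij_witness[of _ "\<lambda>x. inv g \<otimes> x" "\<lambda>h. g \<otimes> h"])
            (use g in \<open>auto simp: m_assoc[symmetric]\<close>)
      qed
      also have "\<dots> = (\<Sum>x\<in>carrier G. \<Sum>g\<in>carrier G. c g * d (inv g \<otimes> x) * X x $$ (i,j))"
        by (rule sum.swap)
      finally show "(A * B) $$ (i,j) = gsum G n X (\<lambda>x. \<Sum>g\<in>carrier G. c g * d (inv g \<otimes> x)) $$ (i,j)"
        using ij by (simp add: gsum_def sum_distrib_right)
    qed (auto simp: A B gsum_def)
    then show "A * B \<in> \<A>" by (simp add: \<A>_def)
  next
    fix c :: 'k and A assume "A \<in> \<A>"
    then obtain d where A: "A = gsum G n X d" by (auto simp: \<A>_def)
    have "c \<cdot>\<^sub>m A = gsum G n X (\<lambda>g. c * d g)"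
      unfolding A by (rule eq_matI) (auto simp: gsum_def sum_distrib_left mult.assoc)
    then show "c \<cdot>\<^sub>m A \<in> \<A>" by (simp add: \<A>_def)
  next
    fix W assume "vsub n W" and "\<And>A w. A \<in> \<A> \<Longrightarrow> w \<in> W \<Longrightarrow> A *\<^sub>v w \<in> W"
    then show "W = {0\<^sub>v n} \<or> W = carrier_vec n"
      using X X\<A> unfolding irreducible_representation_iff by blast
  qed
  then show ?thesis using M by (auto simp: \<A>_def)
qed

text \<open>An element in the radical of the trace form of \<open>X\<close> acts as 0: the matrices
  \<open>X h\<close> span all matrices, so the image of the element has trace 0 against every
  matrix.\<close>

lemma gsum_nondegenerate:
  fixes G (structure)
  assumes G: "group G" and fin: "finite (carrier G)" and X: "irreducible_representation G n (X :: 'a \<Rightarrow> 'k mat)"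
    and tr: "\<And>h. h \<in> carrier G \<Longrightarrow> (\<Sum>g\<in>carrier G. c g * mtrace (X (g \<otimes>\<^bsub>G\<^esub> h))) = 0"
  shows "gsum G n X c = 0\<^sub>m n n"
proof (rule mtrace_nondegenerate[OF gsum_carrier])
  interpret group G by fact
  have rX: "representation G n X" using X by (simp add: irreducible_representation_iff)
  note D = representationD[OF rX]
  fix A :: "'k mat" assume A: "A \<in> carrier_mat n n"
  obtain d where d: "A = gsum G n X d" using gsum_surj[OF G fin X A] by blast
  have "mtrace (gsum G n X c * A) = mtrace (A * gsum G n X c)"
    by (rule mtrace_mult_comm[OF gsum_carrier A])
  also have "\<dots> = (\<Sum>h\<in>carrier G. d h * mtrace (X h * gsum G n X c))"
    unfolding d using mtrace_gsum_mult[of G X n "gsum G n X c" d] D(2) gsum_carrier by blast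
  also have "\<dots> = 0"
  proof (rule sum.neutral, rule ballI)
    fix h assume h: "h \<in> carrier G"
    have "mtrace (X h * gsum G n X c) = mtrace (gsum G n X c * X h)"
      by (rule mtrace_mult_comm[OF D(2)[OF h] gsum_carrier])
    also have "\<dots> = (\<Sum>g\<in>carrier G. c g * mtrace (X g * X h))"
      using mtrace_gsum_mult[of G X n "X h" c] D(2) h by blast
    also have "\<dots> = 0" using tr[OF h] D(4) h by simp
    finally show "d h * mtrace (X h * gsum G n X c) = 0" by simp
  qed
  finally show "mtrace (gsum G n X c * A) = 0" .
qed

text \<open>Consider \<open>s - \<one>\<close> in the group algebra. Since
  \<open>Z (s \<otimes> h) = Z h\<close> and the traces of \<open>X\<close> and \<open>Z\<close>
  agree, it lies in the radical of the trace form of \<open>X\<close> and therefore acts as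
  0.\<close>

lemma irreducible_kernel_mono:
  fixes G (structure)
  assumes G: "group G" and fin: "finite (carrier G)" and X: "irreducible_representation G n (X :: 'a \<Rightarrow> 'k mat)"
    and Z: "representation G m Z" and tr: "\<And>g. g \<in> carrier G \<Longrightarrow> mtrace (X g) = mtrace (Z g)"
    and s: "s \<in> carrier G" and Zs: "Z s = 1\<^sub>m m"
  shows "X s = 1\<^sub>m n"
proof -
  interpret group G by fact
  have rX: "representation G n X" using X by (simp add: irreducible_representation_iff)
  note D = representationD[OF rX] and DZ = representationD[OF Z]
  show ?thesis
  proof (cases "s = \<one>")
    case True
    then show ?thesis using D by simp
  next
    case False
    define c where "c g = (if g = s then 1 else if g = \<one> then -1 else (0::'k))" for g
    have sum: "(\<Sum>g\<in>carrier G. c g * f g) = f s - f \<one>" for f :: "'a \<Rightarrow> 'k"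
    proof -
      have "(\<Sum>g\<in>carrier G. c g * f g) = (\<Sum>g\<in>{s,\<one>}. c g * f g)"
        by (rule sum.mono_neutral_right) (use fin s in \<open>auto simp: c_def\<close>)
      then show ?thesis using False by (simp add: c_def)
    qed
    have "gsum G n X c = 0\<^sub>m n n"
    proof (rule gsum_nondegenerate[OF G fin X])
      fix h assume h: "h \<in> carrier G"
      have "mtrace (X (s \<otimes> h)) = mtrace (X (\<one> \<otimes> h))"
        using tr DZ(4)[OF s h] Zs DZ(2)[OF h] s h by simp
      then show "(\<Sum>g\<in>carrier G. c g * mtrace (X (g \<otimes> h))) = 0"
        using sum[of "\<lambda>g. mtrace (X (g \<otimes> h))"] by simp
    qed
    moreover have "gsum G n X c $$ (i,j) = X s $$ (i,j) - X \<one> $$ (i,j)" if "i < n" "j < n" for i j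
      using sum[of "\<lambda>g. X g $$ (i,j)"] that by (simp add: gsum_def)
    ultimately have e: "X s $$ (i,j) = X \<one> $$ (i,j)" if "i < n" "j < n" for i j
      using that by (metis eq_iff_diff_eq_0 index_zero_mat(1))
    have "X s = X \<one>" by (rule eq_matI) (use e D(2)[OF s] D(3) in auto)
    then show ?thesis using D(3) by simp
  qed
qed

text \<open>If \<open>Z\<close> were block triangular, its group algebra would have dimension at most
  \<open>r\<^sup>2 + (n - r)\<^sup>2 < n\<^sup>2\<close> modulo the radical of the trace form, but that of \<open>X\<close> has dimension \<open>n\<^sup>2\<close>.\<close>

lemma irreducible_if_same_trace:
  fixes G (structure)
  assumes G: "group G" and fin: "finite (carrier G)" and X: "irreducible_representation G n (X :: 'a \<Rightarrow> 'k mat)"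
    and Z: "representation G n Z" and tr: "\<And>g. g \<in> carrier G \<Longrightarrow> mtrace (X g) = mtrace (Z g)"
  shows "irreducible_representation G n Z"
  unfolding irreducible_representation_iff
proof (intro conjI allI impI Z, rule ccontr, elim conjE)
  interpret group G by fact
  fix W assume W: "vsub n W" "\<forall>g\<in>carrier G. \<forall>w\<in>W. Z g *\<^sub>v w \<in> W"
    and ne: "\<not> (W = {0\<^sub>v n} \<or> W = carrier_vec n)"
  obtain r P Q where b: "block_rep G n Z r P Q"
    using reducible_block_rep[OF Z W(1), of thesis] W(2) ne by blast
  have r: "0 < r" "r < n" using b by (auto simp: block_rep_def)
  define Z1 where "Z1 g = ul r (Q * Z g * P)" for g
  define Z2 where "Z2 g = lr r (Q * Z g * P)" for g
  have R1: "representation G r Z1" and R2: "representation G (n - r) Z2" and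
    tr12: "\<And>g. g \<in> carrier G \<Longrightarrow> mtrace (Z g) = mtrace (Z1 g) + mtrace (Z2 g)"
    using block_rep_parts[OF G Z b] by (simp_all add: Z1_def[abs_def] Z2_def[abs_def])
  note D1 = representationD[OF R1] and D2 = representationD[OF R2]
  define s where "s = n - r"
  have s: "s > 0" "n = r + s" using r by (auto simp: s_def)
  \<comment> \<open>The matrix units, numbered row by row; \<open>c e\<close> is a group algebra
    element that acts as \<open>E e\<close> under \<open>X\<close>.\<close>
  define E where "E e = (emat n (e div n) (e mod n) :: 'k mat)" for e
  have "\<forall>e. \<exists>c. E e = gsum G n X c"
    using gsum_surj[OF G fin X] by (simp add: E_def emat_def)
  then obtain c where c: "\<And>e. E e = gsum G n X (c e)" by metis
  \<comment> \<open>Column \<open>e\<close> lists the entries of both diagonal blocks of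
    \<open>Z\<close> at \<open>c e\<close>. A kernel vector \<open>t\<close> therefore yields a
    combination \<open>d\<close> of the \<open>c e\<close> that acts as 0 on both blocks.\<close>
  define A where "A = mat (r * r + s * s) (n * n) (\<lambda>(a,e). if a < r * r then gsum G r Z1 (c e) $$ (a div r, a mod r)
     else gsum G s Z2 (c e) $$ ((a - r * r) div s, (a - r * r) mod s))"
  have A: "A \<in> carrier_mat (r * r + s * s) (n * n)" by (simp add: A_def)
  have "r * r + s * s < n * n" using r s by (simp add: algebra_simps)
  from wide_matrix_kernel[OF A this] obtain t
    where t: "t \<in> carrier_vec (n * n)" "t \<noteq> 0\<^sub>v (n * n)" "A *\<^sub>v t = 0\<^sub>v (r * r + s * s)" by blast
  define d where "d g = (\<Sum>e<n*n. t $ e * c e g)" for g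
  have lin: "gsum G l Y d $$ (i,j) = (\<Sum>e<n*n. gsum G l Y (c e) $$ (i,j) * t $ e)"
    if "i < l" "j < l" for l i j and Y :: "'a \<Rightarrow> 'k mat"
  proof -
    have "gsum G l Y d $$ (i,j) = (\<Sum>g\<in>carrier G. \<Sum>e<n*n. c e g * Y g $$ (i,j) * t $ e)"
      using that by (simp add: gsum_def d_def sum_distrib_right sum_distrib_left mult_ac)
    also have "\<dots> = (\<Sum>e<n*n. \<Sum>g\<in>carrier G. c e g * Y g $$ (i,j) * t $ e)" by (rule sum.swap)
    finally show ?thesis using that by (simp add: gsum_def sum_distrib_right)
  qed
  have At: "(\<Sum>e<n*n. A $$ (a,e) * t $ e) = 0" if "a < r * r + s * s" for a
    using mult_mat_vec_index[OF A t(1) that] t(3) that by simp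
  have z1: "gsum G r Z1 d = 0\<^sub>m r r"
  proof (rule eq_matI)
    fix i j assume "i < dim_row (0\<^sub>m r r :: 'k mat)" "j < dim_col (0\<^sub>m r r :: 'k mat)"
    then have ij: "i < r" "j < r" by auto
    define a where "a = i * r + j"
    have "i * r + j < (i + 1) * r" using ij by simp
    also have "\<dots> \<le> r * r" using ij by (intro mult_le_mono1) simp
    finally have a: "a < r * r" "a div r = i" "a mod r = j" using ij by (auto simp: a_def)
    have "(\<Sum>e<n*n. gsum G r Z1 (c e) $$ (i,j) * t $ e) = (\<Sum>e<n*n. A $$ (a,e) * t $ e)"
      using a by (intro sum.cong) (auto simp: A_def)
    then show "gsum G r Z1 d $$ (i,j) = 0\<^sub>m r r $$ (i,j)" using lin[OF ij, of Z1] At[of a] a ij by simp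
  qed (auto simp: gsum_def)
  have z2: "gsum G s Z2 d = 0\<^sub>m s s"
  proof (rule eq_matI)
    fix i j assume "i < dim_row (0\<^sub>m s s :: 'k mat)" "j < dim_col (0\<^sub>m s s :: 'k mat)"
    then have ij: "i < s" "j < s" by auto
    define a where "a = r * r + (i * s + j)"
    have "i * s + j < (i + 1) * s" using ij by simp
    also have "\<dots> \<le> s * s" using ij by (intro mult_le_mono1) simp
    finally have a: "a < r * r + s * s" "\<not> a < r * r" "(a - r * r) div s = i" "(a - r * r) mod s = j"
      using ij by (auto simp: a_def)
    have "(\<Sum>e<n*n. gsum G s Z2 (c e) $$ (i,j) * t $ e) = (\<Sum>e<n*n. A $$ (a,e) * t $ e)"
      using a by (intro sum.cong) (auto simp: A_def)
    then show "gsum G s Z2 d $$ (i,j) = 0\<^sub>m s s $$ (i,j)" using lin[OF ij, of Z2] At[of a] a ij by simp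
  qed (auto simp: gsum_def)
  \<comment> \<open>The trace of \<open>X\<close> is the sum of the traces of the blocks, so
    \<open>d\<close> is in the radical of the trace form of \<open>X\<close>. But \<open>X\<close>
    sends \<open>d\<close> to the matrix with entries \<open>t\<close>, which forces
    \<open>t = 0\<close>.\<close>
  have "gsum G n X d = 0\<^sub>m n n"
  proof (rule gsum_nondegenerate[OF G fin X])
    fix h assume h: "h \<in> carrier G"
    have D2': "\<And>g. g \<in> carrier G \<Longrightarrow> Z2 g \<in> carrier_mat s s" using D2 by (simp add: s_def)
    have "(\<Sum>g\<in>carrier G. d g * mtrace (X (g \<otimes> h))) =
       (\<Sum>g\<in>carrier G. d g * mtrace (Z1 g * Z1 h) + d g * mtrace (Z2 g * Z2 h))"
      using tr tr12 D1(4) D2(4) h by (intro sum.cong refl) (simp add: distrib_left)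
    also have "\<dots> = mtrace (gsum G r Z1 d * Z1 h) + mtrace (gsum G s Z2 d * Z2 h)"
      unfolding sum.distrib using mtrace_gsum_mult[of G Z1 r "Z1 h" d] mtrace_gsum_mult[of G Z2 s "Z2 h" d]
        D1(2) D2' h by simp
    also have "\<dots> = 0" unfolding z1 z2 using D1(2)[OF h] D2'[OF h] by (simp add: mtrace_def)
    finally show "(\<Sum>g\<in>carrier G. d g * mtrace (X (g \<otimes> h))) = 0" .
  qed
  moreover have "gsum G n X d $$ (e div n, e mod n) = t $ e" if e: "e < n * n" for e
  proof -
    have n: "n > 0" using r by simp
    have ij: "e div n < n" "e mod n < n" using e n by (auto simp: less_mult_imp_div_less)
    have "gsum G n X d $$ (e div n, e mod n) = (\<Sum>f<n*n. E f $$ (e div n, e mod n) * t $ f)"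
      using lin[OF ij, of X] c by simp
    also have "\<dots> = (\<Sum>f<n*n. if f = e then t $ e else 0)"
    proof (rule sum.cong[OF refl])
      fix f
      have "(e div n = f div n \<and> e mod n = f mod n) = (f = e)" by (metis div_mult_mod_eq)
      then show "E f $$ (e div n, e mod n) * t $ f = (if f = e then t $ e else 0)"
        using ij by (auto simp: E_def emat_def)
    qed
    finally show ?thesis using e by simp
  qed
  note calculation = calculation this
  have t0: "t $ e = 0" if "e < n * n" for e
  proof -
    have "e div n < n" "e mod n < n" using that r by (auto simp: less_mult_imp_div_less)
    then show ?thesis using calculation(1) calculation(2)[OF that] by simp
  qed
  have "t = 0\<^sub>v (n * n)" by (rule eq_vecI) (use t t0 in auto)
  then show False using t by blast
qed

section \<open>From Brauer characters to traces\<close>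

lemma p_regularD:
  fixes G (structure)
  assumes "group G" "finite (carrier G)" "g \<in> p_regular p G"
  shows "g \<in> carrier G" "group.ord G g > 0" "\<not> p dvd group.ord G g" "g [^]\<^bsub>G\<^esub> group.ord G g = \<one>\<^bsub>G\<^esub>"
  using assms group.ord_ge_1[OF assms(1,2), of g] group.pow_ord_eq_1[OF assms(1), of g] by (auto simp: p_regular_def)

lemma afforded_brauer_bval:
  "afforded_brauer p red G X g = (if g \<in> p_regular p G then bval (X g) else 0)"
  by (simp add: afforded_brauer_def bval_def)

lemma one_p_regular:
  fixes G (structure)
  assumes "group G" shows "\<one>\<^bsub>G\<^esub> \<in> p_regular p G"
proof -
  interpret group G by fact
  show ?thesis using prime_p ord_id by (auto simp: p_regular_def not_prime_unit)
qed

lemma afforded_brauer_one: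
  fixes G (structure)
  assumes "group G" "representation G n X" shows "afforded_brauer p red G X \<one>\<^bsub>G\<^esub> = of_nat n"
  using one_p_regular[OF assms(1)] representationD(3)[OF assms(2)]
  by (simp add: afforded_brauer_bval bval_one)

lemma rep_p_regular_pow:
  fixes G (structure)
  assumes "group G" "finite (carrier G)" "g \<in> p_regular p G" "representation G n X"
  shows "X g ^\<^sub>m group.ord G g = 1\<^sub>m n"
  using representation_pow[OF assms(1,4), of g "group.ord G g"] p_regularD[OF assms(1-3)]
    representationD(3)[OF assms(4)] by simp

text \<open>Let \<open>p ^ a\<close> be the p-part of the order of \<open>g\<close>. Then
  \<open>g [^] (p ^ a)\<close> is p-regular, and the character there reduces to the
  \<open>p ^ a\<close>-th power of the trace at \<open>g\<close>; in characteristic \<open>p\<close>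
  such roots are unique.\<close>

lemma same_brauer_same_trace:
  fixes G (structure)
  assumes G: "group G" and fin: "finite (carrier G)" and X: "representation G n X" and Z: "representation G m Z"
    and eq: "afforded_brauer p red G X = afforded_brauer p red G Z" and g: "g \<in> carrier G"
  shows "mtrace (X g) = mtrace (Z g)"
proof -
  interpret group G by fact
  have o: "ord g > 0" using ord_ge_1[OF fin g] by simp
  obtain k where k: "ord g = p ^ multiplicity p (ord g) * k" "\<not> p dvd k"
    using multiplicity_decompose'[of "ord g" p] o prime_p not_prime_unit by blast
  define a where "a = multiplicity p (ord g)"
  define h where "h = g [^] (p ^ a)"
  have h: "h \<in> carrier G" using g by (simp add: h_def)
  have "h [^] k = \<one>" using g k by (simp add: h_def nat_pow_pow a_def[symmetric] pow_ord_eq_1[symmetric])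
  then have "ord h dvd k" using pow_eq_id[OF h] by blast
  then have hreg: "h \<in> p_regular p G" using h k(2) dvd_trans by (auto simp: p_regular_def)
  have *: "red (afforded_brauer p red G Y h) = mtrace (Y g) ^ (p ^ a)" if Y: "representation G l Y" for Y l
  proof -
    note D = representationD[OF Y]
    have "red (afforded_brauer p red G Y h) = red (bval (Y h))" using hreg by (simp add: afforded_brauer_bval)
    also have "\<dots> = mtrace (Y h)"
      using red_bval[OF D(2)[OF h] rep_p_regular_pow[OF G fin hreg Y]] p_regularD[OF G fin hreg] by blast
    also have "\<dots> = mtrace (Y g) ^ (p ^ a)"
      unfolding h_def representation_pow[OF G Y g] by (rule mtrace_frobenius[OF D(2)[OF g]])
    finally show ?thesis .
  qed
  from *[OF X] *[OF Z] eq show ?thesis using frobenius_inj by metis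
qed

lemma same_brauer_irreducible:
  fixes G (structure)
  assumes G: "group G" and fin: "finite (carrier G)" and X: "irreducible_representation G n X"
    and Z: "representation G m Z" and eq: "afforded_brauer p red G X = afforded_brauer p red G Z"
  shows "irreducible_representation G m Z"
proof -
  have rX: "representation G n X" using X by (simp add: irreducible_representation_iff)
  have "of_nat n = (of_nat m :: complex)"
    using afforded_brauer_one[OF G rX] afforded_brauer_one[OF G Z] eq by simp
  then have "n = m" by simp
  then show ?thesis using irreducible_if_same_trace[OF G fin X] Z same_brauer_same_trace[OF G fin rX Z eq] by blast
qed

lemma same_brauer_kernel:
  fixes G (structure)
  assumes G: "group G" and fin: "finite (carrier G)" and X: "irreducible_representation G n X"
    and Z: "representation G m Z" and eq: "afforded_brauer p red G X = afforded_brauer p red G Z"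
    and s: "s \<in> carrier G" "Z s = 1\<^sub>m m"
  shows "X s = 1\<^sub>m n"
proof -
  have rX: "representation G n X" using X by (simp add: irreducible_representation_iff)
  show ?thesis using irreducible_kernel_mono[OF G fin X Z _ s] same_brauer_same_trace[OF G fin rX Z eq] by blast
qed

end

section \<open>Matrices indexed by finite sets\<close>

text \<open>Induced representations have rows indexed by pairs of a coset and a basis index, for
  which there is no natural numbering. Any choice serves: by \<open>similar_reindex\<close> another
  one gives a similar matrix.\<close>

definition enum :: "'i set \<Rightarrow> nat \<Rightarrow> 'i" where
  "enum I = (SOME e. bij_betw e {..<card I} I)"

definition imat :: "'i set \<Rightarrow> ('i \<Rightarrow> 'i \<Rightarrow> 'k) \<Rightarrow> 'k mat" where
  "imat I A = mat (card I) (card I) (\<lambda>(a,b). A (enum I a) (enum I b))"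

definition ivec :: "'i set \<Rightarrow> ('i \<Rightarrow> 'k) \<Rightarrow> 'k vec" where
  "ivec I f = vec (card I) (\<lambda>a. f (enum I a))"

lemma enum_bij: "finite I \<Longrightarrow> bij_betw (enum I) {..<card I} I"
  unfolding enum_def using ex_bij_betw_nat_finite[of I] by (metis someI_ex lessThan_atLeast0)

lemma enum_in: "finite I \<Longrightarrow> a < card I \<Longrightarrow> enum I a \<in> I"
  using enum_bij[of I] by (auto simp: bij_betw_def)

lemma enum_surj: "finite I \<Longrightarrow> i \<in> I \<Longrightarrow> \<exists>a<card I. enum I a = i"
  using enum_bij[of I] unfolding bij_betw_def by (metis imageE lessThan_iff)

lemma enum_eq_iff: "finite I \<Longrightarrow> a < card I \<Longrightarrow> b < card I \<Longrightarrow> enum I a = enum I b \<longleftrightarrow> a = b"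
  using enum_bij[of I] unfolding bij_betw_def inj_on_def by blast

lemma imat_carrier [simp]: "imat I A \<in> carrier_mat (card I) (card I)" by (simp add: imat_def)
lemma ivec_carrier [simp]: "ivec I f \<in> carrier_vec (card I)" by (simp add: ivec_def)

lemma sum_enum: "finite I \<Longrightarrow> (\<Sum>a<card I. f (enum I a)) = sum f I"
  using sum.reindex_bij_betw[OF enum_bij] .

lemma imat_cong: "finite I \<Longrightarrow> (\<And>i j. i \<in> I \<Longrightarrow> j \<in> I \<Longrightarrow> A i j = B i j) \<Longrightarrow> imat I A = imat I B"
  unfolding imat_def by (rule eq_matI) (auto simp: enum_in)

lemma imat_mult:
  fixes A B :: "'i \<Rightarrow> 'i \<Rightarrow> 'k::comm_semiring_1"
  assumes fin: "finite I"
  shows "imat I A * imat I B = imat I (\<lambda>i j. \<Sum>k\<in>I. A i k * B k j)"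
proof (rule eq_matI)
  fix a b assume "a < dim_row (imat I (\<lambda>i j. \<Sum>k\<in>I. A i k * B k j))" "b < dim_col (imat I (\<lambda>i j. \<Sum>k\<in>I. A i k * B k j))"
  then have ab: "a < card I" "b < card I" by (auto simp: imat_def)
  have "(imat I A * imat I B) $$ (a,b) = (\<Sum>c<card I. A (enum I a) (enum I c) * B (enum I c) (enum I b))"
    unfolding mult_mat_index[OF imat_carrier imat_carrier ab] using ab by (simp add: imat_def)
  also have "\<dots> = (\<Sum>k\<in>I. A (enum I a) k * B k (enum I b))"
    by (rule sum_enum[OF fin])
  finally show "(imat I A * imat I B) $$ (a,b) = imat I (\<lambda>i j. \<Sum>k\<in>I. A i k * B k j) $$ (a,b)"
    using ab by (simp add: imat_def)
qed (auto simp: imat_def)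

lemma imat_ivec:
  fixes A :: "'i \<Rightarrow> 'i \<Rightarrow> 'k::comm_semiring_1"
  assumes fin: "finite I"
  shows "imat I A *\<^sub>v ivec I f = ivec I (\<lambda>i. \<Sum>k\<in>I. A i k * f k)"
proof (rule eq_vecI)
  fix a assume "a < dim_vec (ivec I (\<lambda>i. \<Sum>k\<in>I. A i k * f k))"
  then have a: "a < card I" by (auto simp: ivec_def)
  have "(imat I A *\<^sub>v ivec I f) $ a = (\<Sum>c<card I. A (enum I a) (enum I c) * f (enum I c))"
    unfolding mult_mat_vec_index[OF imat_carrier ivec_carrier a] using a by (simp add: imat_def ivec_def)
  also have "\<dots> = (\<Sum>k\<in>I. A (enum I a) k * f k)"
    by (rule sum_enum[OF fin])
  finally show "(imat I A *\<^sub>v ivec I f) $ a = ivec I (\<lambda>i. \<Sum>k\<in>I. A i k * f k) $ a"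
    using a by (simp add: ivec_def)
qed (auto simp: ivec_def imat_def)

lemma ivec_eq_iff:
  assumes fin: "finite I" shows "ivec I f = ivec I g \<longleftrightarrow> (\<forall>i\<in>I. f i = g i)"
proof
  assume e: "ivec I f = ivec I g"
  show "\<forall>i\<in>I. f i = g i"
  proof
    fix i assume "i \<in> I"
    then obtain a where a: "a < card I" "enum I a = i" using enum_surj[OF fin] by blast
    then have "ivec I f $ a = ivec I g $ a" using e by simp
    then show "f i = g i" using a by (simp add: ivec_def)
  qed
next
  assume "\<forall>i\<in>I. f i = g i"
  then show "ivec I f = ivec I g" unfolding ivec_def by (intro eq_vecI) (auto simp: enum_in[OF fin])
qed

lemma imat_eq_iff:
  assumes fin: "finite I" shows "imat I A = imat I B \<longleftrightarrow> (\<forall>i\<in>I. \<forall>j\<in>I. A i j = B i j)"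
proof
  assume e: "imat I A = imat I B"
  show "\<forall>i\<in>I. \<forall>j\<in>I. A i j = B i j"
  proof (intro ballI)
    fix i j assume "i \<in> I" "j \<in> I"
    then obtain a b where a: "a < card I" "enum I a = i" and b: "b < card I" "enum I b = j"
      using enum_surj[OF fin] by metis
    then have "imat I A $$ (a,b) = imat I B $$ (a,b)" using e by simp
    then show "A i j = B i j" using a b by (simp add: imat_def)
  qed
qed (rule imat_cong[OF fin], blast)

lemma ivec_surj:
  assumes fin: "finite I" and v: "v \<in> carrier_vec (card I)" obtains f where "v = ivec I f"
proof -
  have "v = ivec I (\<lambda>i. v $ (inv_into {..<card I} (enum I) i))"
    by (rule eq_vecI) (use v enum_bij[OF fin] in \<open>auto simp: ivec_def bij_betw_def\<close>)
  then show ?thesis using that by blast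
qed

lemma imat_one: "finite I \<Longrightarrow> imat I (\<lambda>i j. if i = j then 1 else 0) = 1\<^sub>m (card I)"
  unfolding imat_def by (rule eq_matI) (auto simp: enum_eq_iff)

lemma ivec_zero: "ivec I (\<lambda>_. 0) = 0\<^sub>v (card I)"
  unfolding ivec_def by (rule eq_vecI) auto

lemma ivec_add: "ivec I f + ivec I g = ivec I (\<lambda>i. f i + g i)"
  unfolding ivec_def by (rule eq_vecI) auto

lemma ivec_smult: "c \<cdot>\<^sub>v ivec I f = ivec I (\<lambda>i. c * f i)"
  unfolding ivec_def by (rule eq_vecI) auto

text \<open>Allows invariant subspaces to be described by closure properties of a predicate on
  coordinate functions.\<close>

lemma vsub_ivec:
  assumes "P (\<lambda>_. 0)" "\<And>f g. P f \<Longrightarrow> P g \<Longrightarrow> P (\<lambda>i. f i + g i)" "\<And>c f. P f \<Longrightarrow> P (\<lambda>i. c * f i)"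
  shows "vsub (card I) (ivec I ` {f :: 'i \<Rightarrow> 'k::field. P f})"
  unfolding vsub_def using assms by (auto simp: ivec_add ivec_smult simp flip: ivec_zero)

lemma similar_permute:
  fixes M :: "'k::field mat"
  assumes M: "M \<in> carrier_mat n n" and s: "bij_betw s {..<n} {..<n}"
  shows "similar_mat (mat n n (\<lambda>(a,b). M $$ (s a, s b))) M"
proof -
  define P where "P = mat n n (\<lambda>(a,b). if b = s a then 1 else (0::'k))"
  define Q where "Q = mat n n (\<lambda>(a,b). if a = s b then 1 else (0::'k))"
  have sn: "s a < n" if "a < n" for a using s that by (auto simp: bij_betw_def)
  have inj: "s a = s b \<longleftrightarrow> a = b" if "a < n" "b < n" for a b
    using s that by (auto simp: bij_betw_def inj_on_def)
  have P: "P \<in> carrier_mat n n" and Q: "Q \<in> carrier_mat n n" by (auto simp: P_def Q_def)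
  have PQ: "P * Q = 1\<^sub>m n"
  proof (rule eq_matI)
    fix a b assume "a < dim_row (1\<^sub>m n :: 'k mat)" "b < dim_col (1\<^sub>m n :: 'k mat)"
    then have ab: "a < n" "b < n" by auto
    have "(P * Q) $$ (a,b) = (\<Sum>k<n. if k = s a then (if s a = s b then 1 else 0) else 0)"
      unfolding mult_mat_index[OF P Q ab] using ab by (intro sum.cong) (auto simp: P_def Q_def)
    then show "(P * Q) $$ (a,b) = 1\<^sub>m n $$ (a,b)" using ab sn inj by simp
  qed (use P Q in auto)
  have QP: "Q * P = 1\<^sub>m n" using mat_mult_left_right_inverse[OF P Q PQ] .
  have PM: "P * M = mat n n (\<lambda>(a,b). M $$ (s a, b))"
  proof (rule eq_matI)
    fix a b assume "a < dim_row (mat n n (\<lambda>(a,b). M $$ (s a, b)))" "b < dim_col (mat n n (\<lambda>(a,b). M $$ (s a, b)))"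
    then have ab: "a < n" "b < n" by auto
    have "(P * M) $$ (a,b) = (\<Sum>k<n. if k = s a then M $$ (s a, b) else 0)"
      unfolding mult_mat_index[OF P M ab] using ab by (intro sum.cong) (auto simp: P_def)
    then show "(P * M) $$ (a,b) = mat n n (\<lambda>(a,b). M $$ (s a, b)) $$ (a,b)" using ab sn by simp
  qed (use P M in auto)
  have PMQ: "P * M * Q = mat n n (\<lambda>(a,b). M $$ (s a, s b))"
  proof (rule eq_matI)
    fix a b assume "a < dim_row (mat n n (\<lambda>(a,b). M $$ (s a, s b)))" "b < dim_col (mat n n (\<lambda>(a,b). M $$ (s a, s b)))"
    then have ab: "a < n" "b < n" by auto
    have "(P * M * Q) $$ (a,b) = (\<Sum>k<n. if k = s b then M $$ (s a, s b) else 0)"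
      unfolding PM mult_mat_index[OF mat_carrier Q ab] using ab by (intro sum.cong) (auto simp: Q_def)
    then show "(P * M * Q) $$ (a,b) = mat n n (\<lambda>(a,b). M $$ (s a, s b)) $$ (a,b)" using ab sn by simp
  qed (use P M Q in auto)
  have "mat_inv n P Q" using P Q PQ QP by (simp add: mat_inv_def)
  from mat_inv_similar[OF this M] show ?thesis unfolding PMQ .
qed

lemma similar_reindex:
  fixes A :: "'i \<Rightarrow> 'i \<Rightarrow> 'k::field"
  assumes fin: "finite I" and e: "bij_betw e {..<n} I"
  shows "similar_mat (mat n n (\<lambda>(a,b). A (e a) (e b))) (imat I A)"
proof -
  have n: "n = card I" using bij_betw_same_card[OF e] by simp
  define s where "s a = inv_into {..<card I} (enum I) (e a)" for a
  have s: "bij_betw s {..<n} {..<n}"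
    using bij_betw_trans[OF e bij_betw_inv_into[OF enum_bij[OF fin]]] n by (simp add: s_def[abs_def] comp_def)
  have es: "enum I (s a) = e a" "s a < n" if "a < n" for a
  proof -
    have "e a \<in> I" using e that by (auto simp: bij_betw_def)
    then show "enum I (s a) = e a" using enum_bij[OF fin] by (auto simp: s_def bij_betw_def intro: f_inv_into_f)
    show "s a < n" using s that by (auto simp: bij_betw_def)
  qed
  have "mat n n (\<lambda>(a,b). A (e a) (e b)) = mat n n (\<lambda>(a,b). imat I A $$ (s a, s b))"
    by (rule eq_matI) (use es n in \<open>auto simp: imat_def\<close>)
  then show ?thesis using similar_permute[of "imat I A" n s] s n by simp
qed

context brauer
begin

text \<open>Numbering \<open>I\<close> before \<open>J\<close> makes the matrix block
  triangular.\<close>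

lemma bval_imat_Un:
  fixes A :: "'i \<Rightarrow> 'i \<Rightarrow> 'k"
  assumes fin: "finite I" "finite J" and disj: "I \<inter> J = {}" and z: "\<And>i j. j \<in> J \<Longrightarrow> i \<in> I \<Longrightarrow> A j i = 0"
  shows "bval (imat (I \<union> J) A) = bval (imat I A) + bval (imat J A)"
proof -
  define r s where "r = card I" and "s = card J"
  have crs: "card (I \<union> J) = r + s" using fin disj by (simp add: card_Un_disjoint r_def s_def)
  define e where "e a = (if a < r then enum I a else enum J (a - r))" for a
  have "bij_betw e {..<r} I"
    using enum_bij[OF fin(1)] bij_betw_cong[of "{..<r}" e "enum I" I] by (simp add: e_def r_def)
  moreover have "bij_betw e {r..<r+s} J"
  proof -
    have "bij_betw (\<lambda>a. a - r) {r..<r+s} {..<s}"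
      by (rule bij_betwI[of _ _ _ "\<lambda>a. a + r"]) auto
    from bij_betw_trans[OF this enum_bij[OF fin(2), folded s_def]]
    show ?thesis using bij_betw_cong[of "{r..<r+s}" e "enum J \<circ> (\<lambda>a. a - r)" J] by (simp add: e_def)
  qed
  ultimately have "bij_betw e ({..<r} \<union> {r..<r+s}) (I \<union> J)" using disj by (rule bij_betw_combine)
  moreover have "{..<r} \<union> {r..<r+s} = {..<r+s}" by auto
  ultimately have e: "bij_betw e {..<r+s} (I \<union> J)" by simp
  define M where "M = mat (r+s) (r+s) (\<lambda>(a,b). A (e a) (e b))"
  have M: "M \<in> carrier_mat (r+s) (r+s)" by (simp add: M_def)
  have "bval (imat (I \<union> J) A) = bval M"
    unfolding M_def using bval_similar[OF similar_reindex[OF _ e, of A]] fin by simp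
  also have "\<dots> = bval (ul r M) + bval (lr r M)"
  proof (rule bval_block_ut[OF M])
    show "block_ut r M" using z enum_in[OF fin(1)] enum_in[OF fin(2)]
      by (auto simp: block_ut_def M_def e_def r_def s_def)
  qed simp
  also have "ul r M = imat I A" by (rule eq_matI) (auto simp: ul_def M_def imat_def e_def r_def)
  also have "lr r M = imat J A" by (rule eq_matI) (auto simp: lr_def M_def imat_def e_def s_def)
  finally show ?thesis .
qed

text \<open>Entrywise, the relation between \<open>A\<close> and \<open>B\<close> is
  \<open>D * B = A * D\<close> for the diagonal matrix \<open>D\<close> with entries
  \<open>d\<close>; the two matrices are similar.\<close>

lemma bval_imat_diagonal_conj:
  fixes A :: "'i \<Rightarrow> 'i \<Rightarrow> 'k"
  assumes fin: "finite I" and d: "\<And>i. i \<in> I \<Longrightarrow> d i \<noteq> 0"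
    and B: "\<And>i j. i \<in> I \<Longrightarrow> j \<in> I \<Longrightarrow> B i j * d i = A i j * d j"
  shows "bval (imat I B) = bval (imat I A)"
proof -
  define D where "D = imat I (\<lambda>i j. if i = j then d i else 0)"
  define E where "E = imat I (\<lambda>i j. if i = j then inverse (d i) else 0)"
  have "D * E = imat I (\<lambda>i j. if i = j then 1 else 0)" unfolding D_def E_def imat_mult[OF fin]
  proof (rule imat_cong[OF fin])
    fix i j assume "i \<in> I" "j \<in> I"
    have "(\<Sum>k\<in>I. (if i = k then d i else 0) * (if k = j then inverse (d k) else 0)) =
      (\<Sum>k\<in>I. if k = i then (if i = j then 1 else 0) else 0)"
      by (rule sum.cong) (use d \<open>i \<in> I\<close> in auto)
    then show "(\<Sum>k\<in>I. (if i = k then d i else 0) * (if k = j then inverse (d k) else 0)) = (if i = j then 1 else 0)"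
      using \<open>i \<in> I\<close> fin by simp
  qed
  then have DE: "D * E = 1\<^sub>m (card I)" using imat_one[OF fin] by simp
  have Dc: "D \<in> carrier_mat (card I) (card I)" and Ec: "E \<in> carrier_mat (card I) (card I)"
    by (auto simp: D_def E_def)
  have inv: "mat_inv (card I) D E" using DE mat_mult_left_right_inverse[OF Dc Ec DE] Dc Ec
    by (simp add: mat_inv_def)
  have DB: "D * imat I B = imat I (\<lambda>i j. d i * B i j)" unfolding D_def imat_mult[OF fin]
  proof (rule imat_cong[OF fin])
    fix i j assume "i \<in> I" "j \<in> I"
    have "(\<Sum>k\<in>I. (if i = k then d i else 0) * B k j) = (\<Sum>k\<in>I. if k = i then d i * B i j else 0)"
      by (rule sum.cong) auto
    then show "(\<Sum>k\<in>I. (if i = k then d i else 0) * B k j) = d i * B i j" using \<open>i \<in> I\<close> fin by simp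
  qed
  have AD: "imat I A * D = imat I (\<lambda>i j. A i j * d j)" unfolding D_def imat_mult[OF fin]
  proof (rule imat_cong[OF fin])
    fix i j assume "i \<in> I" "j \<in> I"
    have "(\<Sum>k\<in>I. A i k * (if k = j then d k else 0)) = (\<Sum>k\<in>I. if k = j then A i j * d j else 0)"
      by (rule sum.cong) auto
    then show "(\<Sum>k\<in>I. A i k * (if k = j then d k else 0)) = A i j * d j" using \<open>j \<in> I\<close> fin by simp
  qed
  have "D * imat I B = imat I A * D" unfolding DB AD
    by (rule imat_cong[OF fin]) (use B in \<open>simp add: mult.commute\<close>)
  then have "D * imat I B * E = imat I A * (D * E)"
    using assoc_mult_mat[OF imat_carrier[of I A] Dc Ec] by simp
  then have "imat I A = D * imat I B * E" using DE right_mult_one_mat[OF imat_carrier[of I A]] by simp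
  then show ?thesis using bval_similar[OF mat_inv_similar[OF inv imat_carrier[of I B]]] by simp
qed

lemma bval_imat_empty: "bval (imat {} A) = 0"
proof -
  have "imat {} A = 1\<^sub>m 0" by (rule eq_matI) (auto simp: imat_def)
  then show ?thesis using bval_one[of 0] by simp
qed

end

section \<open>Regular elements of subgroups\<close>

text \<open>An exponent prime to \<open>p\<close>, unlike the exact order, is carried along directly
  by conjugation, passage to subgroups and isomorphisms.\<close>

lemma p_regular_iff:
  assumes "group G" "finite (carrier G)"
  shows "g \<in> p_regular p G \<longleftrightarrow> g \<in> carrier G \<and> (\<exists>m>0. \<not> p dvd m \<and> g [^]\<^bsub>G\<^esub> m = \<one>\<^bsub>G\<^esub>)"
proof -
  interpret group G by fact
  show ?thesis
  proof
    assume g: "g \<in> p_regular p G"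
    then show "g \<in> carrier G \<and> (\<exists>m>0. \<not> p dvd m \<and> g [^]\<^bsub>G\<^esub> m = \<one>\<^bsub>G\<^esub>)"
      using ord_ge_1[OF assms(2), of g] pow_ord_eq_1[of g]
      by (auto simp: p_regular_def intro!: exI[of _ "ord g"])
  next
    assume g: "g \<in> carrier G \<and> (\<exists>m>0. \<not> p dvd m \<and> g [^]\<^bsub>G\<^esub> m = \<one>\<^bsub>G\<^esub>)"
    then show "g \<in> p_regular p G" using pow_eq_id[of g] by (auto simp: p_regular_def dest: dvd_trans)
  qed
qed

lemma (in group) sub_group: "subgroup H G \<Longrightarrow> group (G\<lparr>carrier := H\<rparr>)"
  by (rule subgroup.subgroup_is_group[OF _ is_group])

lemma (in group) sub_inv: "subgroup H G \<Longrightarrow> x \<in> H \<Longrightarrow> inv\<^bsub>G\<lparr>carrier := H\<rparr>\<^esub> x = inv x"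
  by (rule m_inv_consistent)

lemma (in group) sub_finite: "subgroup H G \<Longrightarrow> finite (carrier G) \<Longrightarrow> finite (carrier (G\<lparr>carrier := H\<rparr>))"
  using subgroup.subset finite_subset by fastforce

lemma (in group) sub_subgroup_iff:
  assumes "subgroup M G"
  shows "subgroup U (G\<lparr>carrier := M\<rparr>) \<longleftrightarrow> subgroup U G \<and> U \<subseteq> M"
proof
  assume U: "subgroup U (G\<lparr>carrier := M\<rparr>)"
  show "subgroup U G \<and> U \<subseteq> M" using incl_subgroup[OF assms U] subgroup.subset[OF U] by simp
next
  assume "subgroup U G \<and> U \<subseteq> M"
  then show "subgroup U (G\<lparr>carrier := M\<rparr>)" using subgroup_incl[of U M] assms by blast
qed

lemma (in group) sub_p_regular:
  assumes H: "subgroup H G" and fin: "finite (carrier G)"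
  shows "p_regular p (G\<lparr>carrier := H\<rparr>) = p_regular p G \<inter> H"
proof -
  have "x \<in> p_regular p (G\<lparr>carrier := H\<rparr>) \<longleftrightarrow> x \<in> p_regular p G \<inter> H" for x
    unfolding p_regular_iff[OF sub_group[OF H] sub_finite[OF H fin]] p_regular_iff[OF is_group fin] Int_iff
    using subgroup.subset[OF H] by (auto simp: nat_pow_consistent[symmetric])
  then show ?thesis by blast
qed

lemma (in group) inv_cancel_left:
  assumes "y \<in> carrier G" "z \<in> carrier G"
  shows "inv y \<otimes> (y \<otimes> z) = z" "y \<otimes> (inv y \<otimes> z) = z"
  using assms by (simp_all flip: m_assoc)

lemma (in group) conj_pow:
  assumes "y \<in> carrier G" "x \<in> carrier G"
  shows "(y \<otimes> x \<otimes> inv y) [^] (k::nat) = y \<otimes> x [^] k \<otimes> inv y"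
proof (induction k)
  case 0
  then show ?case using assms by simp
next
  case (Suc k)
  then show ?case using assms by (simp add: m_assoc inv_cancel_left)
qed

lemma (in group) conj_p_regular:
  assumes fin: "finite (carrier G)" and y: "y \<in> carrier G" and x: "x \<in> p_regular p G"
  shows "y \<otimes> x \<otimes> inv y \<in> p_regular p G"
proof -
  obtain m where m: "x \<in> carrier G" "m > 0" "\<not> p dvd m" "x [^] m = \<one>"
    using x p_regular_iff[OF is_group fin] by blast
  then have "(y \<otimes> x \<otimes> inv y) [^] m = \<one>" using conj_pow[OF y m(1)] y by simp
  then show ?thesis using p_regular_iff[OF is_group fin] m y by blast
qed

lemma (in group) conj_p_regular_iff:
  assumes fin: "finite (carrier G)" and y: "y \<in> carrier G" and x: "x \<in> carrier G"
  shows "y \<otimes> x \<otimes> inv y \<in> p_regular p G \<longleftrightarrow> x \<in> p_regular p G"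
proof
  assume "y \<otimes> x \<otimes> inv y \<in> p_regular p G"
  from conj_p_regular[OF fin inv_closed[OF y] this] show "x \<in> p_regular p G"
    using x y by (simp add: m_assoc inv_cancel_left)
qed (rule conj_p_regular[OF fin y])

lemma (in brauer) afforded_conj:
  fixes G (structure)
  assumes G: "group G" and fin: "finite (carrier G)" and X: "representation G n X"
    and y: "y \<in> carrier G" and x: "x \<in> carrier G"
  shows "afforded_brauer p red G X (y \<otimes> x \<otimes> inv y) = afforded_brauer p red G X x"
proof -
  interpret group G by fact
  note D = representationD[OF X]
  have "X (y \<otimes> x \<otimes> inv y) = X y * X x * X (inv y)" using D(4) x y by simp
  then have "bval (X (y \<otimes> x \<otimes> inv y)) = bval (X x)"
    using bval_similar[OF mat_inv_similar[OF representation_inv[OF G X y] D(2)[OF x]]] by simp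
  then show ?thesis using conj_p_regular_iff[OF fin y x] by (simp add: afforded_brauer_bval)
qed

lemma (in group) representation_restrict:
  assumes "subgroup H G" "representation G n X" shows "representation (G\<lparr>carrier := H\<rparr>) n X"
  using assms subgroup.subset[OF assms(1)] by (auto simp: representation_def)

lemma (in group) afforded_restrict:
  assumes "subgroup H G" "finite (carrier G)"
  shows "afforded_brauer p red (G\<lparr>carrier := H\<rparr>) X g = (if g \<in> H then afforded_brauer p red G X g else 0)"
  using sub_p_regular[OF assms] by (auto simp: afforded_brauer_def)

section \<open>Induced representations\<close>

locale induced_rep = brauer p red + group G
  for p :: nat and red :: "complex \<Rightarrow> 'k::field" and G :: "('a, 'b) monoid_scheme" (structure) +
  fixes H :: "'a set" and n :: nat and Z :: "'a \<Rightarrow> 'k mat"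
  assumes fin: "finite (carrier G)" and H: "subgroup H G" and Z: "representation (G\<lparr>carrier := H\<rparr>) n Z"
begin

lemma H_sub: "h \<in> H \<Longrightarrow> h \<in> carrier G"
  using subgroup.subset[OF H] by blast

lemma Z_D:
  shows "n > 0" "\<And>g. g \<in> H \<Longrightarrow> Z g \<in> carrier_mat n n" "Z \<one> = 1\<^sub>m n"
    "\<And>g h. g \<in> H \<Longrightarrow> h \<in> H \<Longrightarrow> Z (g \<otimes> h) = Z g * Z h"
  using representationD[OF Z] by auto

text \<open>The choice is made from the coset as a set, so the representative depends on the coset
  only.\<close>

definition rho :: "'a \<Rightarrow> 'a" where "rho g = (SOME x. x \<in> H #> g)"

definition T :: "'a set" where "T = rho ` carrier G"

lemma rho_in: "g \<in> carrier G \<Longrightarrow> rho g \<in> H #> g"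
  unfolding rho_def by (rule someI[of _ g]) (rule rcos_self[OF _ H])

lemma rho_closed [simp]: "g \<in> carrier G \<Longrightarrow> rho g \<in> carrier G"
  using rho_in r_coset_subset_G[OF subgroup.subset[OF H]] by blast

lemma rho_H: "g \<in> carrier G \<Longrightarrow> rho g \<otimes> inv g \<in> H"
  using rho_in subgroup.rcos_module[OF H is_group, of g "rho g"] by simp

lemma rho_H':
  assumes "g \<in> carrier G" shows "g \<otimes> inv (rho g) \<in> H"
  using subgroup.m_inv_closed[OF H rho_H[OF assms]] assms by (simp add: inv_mult_group)

lemma rho_eq_iff:
  assumes g: "g \<in> carrier G" "g' \<in> carrier G" shows "rho g = rho g' \<longleftrightarrow> g \<otimes> inv g' \<in> H"
proof
  assume e: "rho g = rho g'"
  have "(g \<otimes> inv (rho g)) \<otimes> (rho g' \<otimes> inv g') \<in> H"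
    using rho_H'[OF g(1)] rho_H[OF g(2)] by (rule subgroup.m_closed[OF H])
  then show "g \<otimes> inv g' \<in> H" using e g by (simp add: m_assoc inv_cancel_left)
next
  assume "g \<otimes> inv g' \<in> H"
  then have "g \<in> H #> g'" using subgroup.rcos_module[OF H is_group g(2,1)] by simp
  then have "H #> g = H #> g'" using repr_independence[OF _ g(2) H] by simp
  then show "rho g = rho g'" by (simp add: rho_def)
qed

lemma T_sub: "t \<in> T \<Longrightarrow> t \<in> carrier G" by (auto simp: T_def)

lemma T_fin: "finite T" using fin by (simp add: T_def)

lemma rho_T [simp]: "g \<in> carrier G \<Longrightarrow> rho g \<in> T" by (simp add: T_def)

lemma rho_id:
  assumes "t \<in> T" shows "rho t = t"
proof -
  obtain g where g: "g \<in> carrier G" "t = rho g" using assms by (auto simp: T_def)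
  then show ?thesis using rho_eq_iff[of t g] rho_H by simp
qed

lemma in_H_iff: "t \<in> T \<Longrightarrow> g \<in> carrier G \<Longrightarrow> g \<otimes> inv t \<in> H \<longleftrightarrow> t = rho g"
  using rho_eq_iff[of g t] rho_id T_sub by metis

lemma rho_mult: "g \<in> carrier G \<Longrightarrow> x \<in> carrier G \<Longrightarrow> rho (rho g \<otimes> x) = rho (g \<otimes> x)"
  using rho_eq_iff[of "rho g \<otimes> x" "g \<otimes> x"] rho_H by (simp add: inv_mult_group m_assoc inv_cancel_left)

text \<open>The induced representation on right cosets, in blocks: block \<open>(t,s)\<close> is
  \<open>Z (t \<otimes> x \<otimes> inv s)\<close>, and in each row of blocks only
  \<open>s = rho (t \<otimes> x)\<close> contributes.\<close>

definition indA :: "'a \<Rightarrow> 'a \<times> nat \<Rightarrow> 'a \<times> nat \<Rightarrow> 'k" where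
  "indA x i j = (if fst i \<otimes> x \<otimes> inv (fst j) \<in> H then Z (fst i \<otimes> x \<otimes> inv (fst j)) $$ (snd i, snd j) else 0)"

definition Ind :: "'a \<Rightarrow> 'k mat" where "Ind x = imat (T \<times> {..<n}) (indA x)"

lemma indA_eq:
  assumes "t \<in> T" "s \<in> T" "x \<in> carrier G"
  shows "indA x (t,a) (s,b) = (if s = rho (t \<otimes> x) then Z (t \<otimes> x \<otimes> inv s) $$ (a,b) else 0)"
  using in_H_iff[of s "t \<otimes> x"] assms T_sub by (simp add: indA_def)

lemma indA_vec:
  assumes S: "S \<subseteq> T" and t: "t \<in> S" and x: "x \<in> carrier G" and r: "rho (t \<otimes> x) \<in> S"
  shows "(\<Sum>k\<in>S \<times> {..<n}. indA x (t,a) k * f k) =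
     (\<Sum>c<n. Z (t \<otimes> x \<otimes> inv (rho (t \<otimes> x))) $$ (a,c) * f (rho (t \<otimes> x), c))"
proof -
  have fS: "finite S" using S T_fin finite_subset by blast
  let ?s = "rho (t \<otimes> x)"
  have "(\<Sum>k\<in>S \<times> {..<n}. indA x (t,a) k * f k) = (\<Sum>s\<in>S. \<Sum>c<n. indA x (t,a) (s,c) * f (s,c))"
    by (simp add: sum.cartesian_product)
  also have "\<dots> = (\<Sum>s\<in>S. if s = ?s then \<Sum>c<n. Z (t \<otimes> x \<otimes> inv ?s) $$ (a,c) * f (?s, c) else 0)"
    using S t x by (intro sum.cong refl) (auto simp: indA_eq subsetD)
  finally show ?thesis using fS r by simp
qed

text \<open>Writes \<open>t \<otimes> (x \<otimes> y) \<otimes> inv u\<close> as \<open>(t \<otimes>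
  x \<otimes> inv s) \<otimes> (s \<otimes> y \<otimes> inv u)\<close> for the one coset
  \<open>s\<close> reached from \<open>t\<close> by \<open>x\<close>. A set \<open>S\<close> of
  cosets is allowed because the character computation works on orbits of a single element.\<close>

lemma imat_indA_mult:
  assumes S: "S \<subseteq> T" and x: "x \<in> carrier G" and y: "y \<in> carrier G" and r: "\<And>t. t \<in> S \<Longrightarrow> rho (t \<otimes> x) \<in> S"
  shows "imat (S \<times> {..<n}) (indA x) * imat (S \<times> {..<n}) (indA y) = imat (S \<times> {..<n}) (indA (x \<otimes> y))"
proof -
  have fS: "finite (S \<times> {..<n})" using S T_fin finite_subset by blast
  show ?thesis unfolding imat_mult[OF fS]
  proof (rule imat_cong[OF fS])
    fix i j assume i: "i \<in> S \<times> {..<n}" and j: "j \<in> S \<times> {..<n}"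
    obtain t a u b where ij: "i = (t,a)" "j = (u,b)" by (metis surj_pair)
    have t: "t \<in> S" "t \<in> T" "t \<in> carrier G" "a < n" and u: "u \<in> S" "u \<in> T" "u \<in> carrier G" "b < n"
      using i j ij S T_sub by auto
    define s where "s = rho (t \<otimes> x)"
    have s: "s \<in> S" "s \<in> T" "s \<in> carrier G" using r t x by (auto simp: s_def)
    have txs: "t \<otimes> x \<otimes> inv s \<in> H" unfolding s_def using rho_H' t x by simp
    have eq: "t \<otimes> (x \<otimes> y) \<otimes> inv u = (t \<otimes> x \<otimes> inv s) \<otimes> (s \<otimes> y \<otimes> inv u)"
      using t s u x y by (simp add: m_assoc inv_cancel_left)
    have "rho (t \<otimes> (x \<otimes> y)) = rho (s \<otimes> y)"
      using rho_mult[of "t \<otimes> x" y] t x y by (simp add: s_def m_assoc)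
    then have iff: "u = rho (t \<otimes> (x \<otimes> y)) \<longleftrightarrow> u = rho (s \<otimes> y)" by simp
    have "(\<Sum>k\<in>S \<times> {..<n}. indA x i k * indA y k j) = (\<Sum>c<n. Z (t \<otimes> x \<otimes> inv s) $$ (a,c) * indA y (s,c) (u,b))"
      using indA_vec[OF S t(1) x r[OF t(1)], of a "\<lambda>k. indA y k j"] by (simp add: ij s_def)
    also have "\<dots> = indA (x \<otimes> y) i j"
    proof (cases "u = rho (s \<otimes> y)")
      case True
      then have syu: "s \<otimes> y \<otimes> inv u \<in> H" using rho_H' s y by simp
      show ?thesis using True iff indA_eq[OF s(2) u(2) y] indA_eq[OF t(2) u(2), of "x \<otimes> y"] x y ij
          mult_mat_index[OF Z_D(2)[OF txs] Z_D(2)[OF syu] t(4) u(4)] Z_D(4)[OF txs syu] eq by simp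
    next
      case False
      then show ?thesis using iff indA_eq[OF s(2) u(2) y] indA_eq[OF t(2) u(2), of "x \<otimes> y"] x y ij by simp
    qed
    finally show "(\<Sum>k\<in>S \<times> {..<n}. indA x i k * indA y k j) = indA (x \<otimes> y) i j" .
  qed
qed

lemma imat_indA_one:
  assumes S: "S \<subseteq> T"
  shows "imat (S \<times> {..<n}) (indA \<one>) = 1\<^sub>m (card (S \<times> {..<n}))"
proof -
  have fS: "finite (S \<times> {..<n})" using S T_fin finite_subset by blast
  have "imat (S \<times> {..<n}) (indA \<one>) = imat (S \<times> {..<n}) (\<lambda>i j. if i = j then 1 else 0)"
  proof (rule imat_cong[OF fS])
    fix i j assume i: "i \<in> S \<times> {..<n}" and j: "j \<in> S \<times> {..<n}"
    obtain t a u b where ij: "i = (t,a)" "j = (u,b)" by (metis surj_pair)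
    have t: "t \<in> T" "t \<in> carrier G" "a < n" and u: "u \<in> T" "u \<in> carrier G" "b < n"
      using i j ij S T_sub by auto
    show "indA \<one> i j = (if i = j then 1 else 0)"
      using indA_eq[OF t(1) u(1), of \<one>] t u rho_id[OF t(1)] Z_D(3) by (auto simp: ij)
  qed
  then show ?thesis using imat_one[OF fS] by simp
qed

lemma card_I: "card (T \<times> {..<n}) = card T * n" by (simp add: card_cartesian_product)

lemma finI: "finite (T \<times> {..<n})" using T_fin by simp

lemma T_nonempty: "card T > 0" using T_fin rho_T[OF one_closed] card_gt_0_iff by blast

lemma Ind_rep: "representation G (card (T \<times> {..<n})) Ind"
  unfolding representation_def
proof (intro conjI ballI)
  show "card (T \<times> {..<n}) > 0" using Z_D(1) T_nonempty card_I by simp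
  show "Ind \<one> = 1\<^sub>m (card (T \<times> {..<n}))" unfolding Ind_def by (rule imat_indA_one) simp
  show "Ind (g \<otimes> h) = Ind g * Ind h" if "g \<in> carrier G" "h \<in> carrier G" for g h
    unfolding Ind_def using imat_indA_mult[of T g h] that T_sub by simp
qed (simp add: Ind_def)

lemma Ind_ivec: "Ind x *\<^sub>v ivec (T \<times> {..<n}) f = ivec (T \<times> {..<n}) (\<lambda>i. \<Sum>k\<in>T \<times> {..<n}. indA x i k * f k)"
  unfolding Ind_def by (rule imat_ivec[OF finI])

section \<open>Invariant subspaces of the induced representation\<close>

text \<open>The common form of the irreducibility arguments below: a nonzero invariant family of
  coordinate functions contains every function, up to values off the index set. The set
  \<open>K\<close> allows both the whole group and a subgroup as the acting group.\<close>

lemma Ind_irreducibleD: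
  fixes P :: "('a \<times> nat \<Rightarrow> 'k) \<Rightarrow> bool"
  assumes K: "K \<subseteq> carrier G"
    and irr: "irreducible_representation (G\<lparr>carrier := K\<rparr>) (card (T \<times> {..<n})) Ind"
    and P: "P (\<lambda>_. 0)" "\<And>f g. P f \<Longrightarrow> P g \<Longrightarrow> P (\<lambda>i. f i + g i)" "\<And>c f. P f \<Longrightarrow> P (\<lambda>i. c * f i)"
    and st: "\<And>x f. x \<in> K \<Longrightarrow> P f \<Longrightarrow> P (\<lambda>i. \<Sum>k\<in>T \<times> {..<n}. indA x i k * f k)"
    and nz: "P f" "i \<in> T \<times> {..<n}" "f i \<noteq> 0"
  shows "\<exists>f'. P f' \<and> (\<forall>i\<in>T \<times> {..<n}. f' i = h i)"
proof -
  let ?I = "T \<times> {..<n}"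
  define W where "W = ivec ?I ` {f. P f}"
  have "vsub (card ?I) W" unfolding W_def by (rule vsub_ivec[OF P])
  moreover have "\<forall>g\<in>carrier (G\<lparr>carrier := K\<rparr>). \<forall>w\<in>W. Ind g *\<^sub>v w \<in> W"
    using st by (auto simp: W_def Ind_ivec)
  ultimately have "W = {0\<^sub>v (card ?I)} \<or> W = carrier_vec (card ?I)"
    using irr unfolding irreducible_representation_iff by blast
  moreover have "ivec ?I f \<noteq> 0\<^sub>v (card ?I)"
    using ivec_eq_iff[OF finI, of f "\<lambda>_. 0"] nz by (auto simp: ivec_zero)
  ultimately have "W = carrier_vec (card ?I)" using nz(1) by (auto simp: W_def)
  then have "ivec ?I h \<in> W" by simp
  then obtain f' where "P f'" "ivec ?I h = ivec ?I f'" by (auto simp: W_def)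
  then show ?thesis using ivec_eq_iff[OF finI, of h f'] by auto
qed

text \<open>The functions with all components in an invariant subspace \<open>W\<close> are
  invariant. If \<open>W\<close> were proper and nonzero, they would include a constant function
  with value in \<open>W\<close> but not one with value \<open>v\<close> outside
  \<open>W\<close>.\<close>

lemma irreducible_if_Ind_irreducible:
  assumes irr: "irreducible_representation G (card (T \<times> {..<n})) Ind"
  shows "irreducible_representation (G\<lparr>carrier := H\<rparr>) n Z"
  unfolding irreducible_representation_iff
proof (intro conjI Z allI impI, elim conjE)
  fix W assume W: "vsub n W" and inv: "\<forall>g\<in>carrier (G\<lparr>carrier := H\<rparr>). \<forall>w\<in>W. Z g *\<^sub>v w \<in> W"
  show "W = {0\<^sub>v n} \<or> W = carrier_vec n"
  proof (rule disjCI)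
    assume "W \<noteq> carrier_vec n"
    then obtain v where v: "v \<in> carrier_vec n" "v \<notin> W" using vsubD(1)[OF W] by blast
    show "W = {0\<^sub>v n}"
    proof (rule ccontr)
      assume "W \<noteq> {0\<^sub>v n}"
      then obtain w where w: "w \<in> W" "w \<noteq> 0\<^sub>v n" using vsubD(2)[OF W] by blast
      have wc: "w \<in> carrier_vec n" by (rule vsubD(1)[OF W w(1)])
      obtain a where a: "a < n" "w $ a \<noteq> 0" using w(2) wc by (auto simp: vec_eq_iff)
      define P where "P f \<longleftrightarrow> (\<forall>t\<in>T. vec n (\<lambda>a. f (t,a)) \<in> W)" for f :: "'a \<times> nat \<Rightarrow> 'k"
      have t1: "rho \<one> \<in> T" by simp
      have "\<exists>f'. P f' \<and> (\<forall>i\<in>T \<times> {..<n}. f' i = v $ (snd i))"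
      proof (rule Ind_irreducibleD[of "carrier G" P "\<lambda>i. w $ (snd i)" "(rho \<one>, a)"])
        show "irreducible_representation (G\<lparr>carrier := carrier G\<rparr>) (card (T \<times> {..<n})) Ind"
          using irr by (simp add: irreducible_representation_iff representation_def)
        have "vec n (\<lambda>a. 0) = (0\<^sub>v n :: 'k vec)" by (rule eq_vecI) auto
        then show "P (\<lambda>_. 0)" using vsubD(2)[OF W] by (simp add: P_def)
        have "vec n (\<lambda>a. f a + g a) = vec n f + vec n g" for f g :: "nat \<Rightarrow> 'k" by (rule eq_vecI) auto
        then show "P (\<lambda>i. f i + g i)" if "P f" "P g" for f g
          using that vsubD(3)[OF W] by (simp add: P_def)
        have "vec n (\<lambda>a. c * f a) = c \<cdot>\<^sub>v vec n f" for c and f :: "nat \<Rightarrow> 'k" by (rule eq_vecI) auto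
        then show "P (\<lambda>i. c * f i)" if "P f" for c f
          using that vsubD(4)[OF W] by (simp add: P_def)
        have "vec n (\<lambda>a. w $ a) = w" by (rule eq_vecI) (use wc in auto)
        then show "P (\<lambda>i. w $ (snd i))" using w by (simp add: P_def)
        show "P (\<lambda>i. \<Sum>k\<in>T \<times> {..<n}. indA x i k * f k)" if x: "x \<in> carrier G" and f: "P f" for x f
          unfolding P_def
        proof
          fix t assume t: "t \<in> T"
          let ?s = "rho (t \<otimes> x)"
          have tx: "t \<otimes> x \<in> carrier G" using t x T_sub by simp
          have hH: "t \<otimes> x \<otimes> inv ?s \<in> H" by (rule rho_H'[OF tx])
          have "vec n (\<lambda>a. \<Sum>k\<in>T \<times> {..<n}. indA x (t,a) k * f k) =
             Z (t \<otimes> x \<otimes> inv ?s) *\<^sub>v vec n (\<lambda>c. f (?s, c))"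
          proof (rule eq_vecI)
            fix b assume "b < dim_vec (Z (t \<otimes> x \<otimes> inv ?s) *\<^sub>v vec n (\<lambda>c. f (?s, c)))"
            then have b: "b < n" using Z_D(2)[OF hH] by simp
            then show "vec n (\<lambda>a. \<Sum>k\<in>T \<times> {..<n}. indA x (t,a) k * f k) $ b =
              (Z (t \<otimes> x \<otimes> inv ?s) *\<^sub>v vec n (\<lambda>c. f (?s, c))) $ b"
              using indA_vec[OF subset_refl t x rho_T[OF tx], of b f]
                mult_mat_vec_index[OF Z_D(2)[OF hH], of "vec n (\<lambda>c. f (?s, c))" b] by simp
          qed (use Z_D(2)[OF hH] in auto)
          then show "vec n (\<lambda>a. \<Sum>k\<in>T \<times> {..<n}. indA x (t,a) k * f k) \<in> W"
            using inv hH f rho_T[OF tx] by (simp add: P_def)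
        qed
      qed (use a t1 in auto)
      then obtain f' where f': "P f'" "\<And>i. i \<in> T \<times> {..<n} \<Longrightarrow> f' i = v $ (snd i)" by blast
      have "vec n (\<lambda>a. f' (rho \<one>, a)) = v" by (rule eq_vecI) (use f'(2) t1 v in auto)
      then show False using f'(1) t1 v by (auto simp: P_def)
    qed
  qed
qed

text \<open>Functions supported on \<open>H K\<close> form a \<open>K\<close>-invariant subspace.\<close>

lemma Ind_irreducible_restrict:
  assumes K: "subgroup K G" and irr: "irreducible_representation (G\<lparr>carrier := K\<rparr>) (card (T \<times> {..<n})) Ind"
    and g: "g \<in> carrier G"
  shows "\<exists>h\<in>H. \<exists>k\<in>K. g = h \<otimes> k"
proof -
  define D where "D = {h \<otimes> k | h k. h \<in> H \<and> k \<in> K}"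
  define P where "P f \<longleftrightarrow> (\<forall>t\<in>T. \<forall>a. t \<notin> D \<longrightarrow> f (t,a) = 0)" for f :: "'a \<times> nat \<Rightarrow> 'k"
  have Kc: "k \<in> carrier G" if "k \<in> K" for k using subgroup.subset[OF K] that by blast
  \<comment> \<open>\<open>D\<close> is a union of right cosets of \<open>H\<close>, so membership
    can be tested on representatives.\<close>
  have D_left: "y \<in> D" if "x \<in> D" "y \<otimes> inv x \<in> H" "y \<in> carrier G" for x y
  proof -
    from that obtain h k where hk: "x = h \<otimes> k" "h \<in> H" "k \<in> K" by (auto simp: D_def)
    then have xc: "x \<in> carrier G" using H_sub Kc by simp
    have "y = (y \<otimes> inv x) \<otimes> x" using that xc by (simp add: m_assoc)
    also have "\<dots> = ((y \<otimes> inv x) \<otimes> h) \<otimes> k" using hk H_sub Kc that xc by (simp add: m_assoc)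
    finally show ?thesis using hk subgroup.m_closed[OF H that(2) hk(2)] by (auto simp: D_def)
  qed
  have "\<exists>f'. P f' \<and> (\<forall>i\<in>T \<times> {..<n}. f' i = 1)"
  proof (rule Ind_irreducibleD[of K P "\<lambda>i. if fst i \<in> D then 1 else 0" "(rho \<one>, 0)"])
    show "K \<subseteq> carrier G" using subgroup.subset[OF K] .
    have "\<one> \<otimes> \<one> \<in> D" using subgroup.one_closed[OF H] subgroup.one_closed[OF K] unfolding D_def by blast
    then have "\<one> \<in> D" by simp
    then have "rho \<one> \<in> D" using rho_H[of \<one>] D_left by simp
    then show "(if fst (rho \<one>, 0) \<in> D then 1 else 0) \<noteq> (0::'k)" by simp
    show "P (\<lambda>i. \<Sum>k\<in>T \<times> {..<n}. indA x i k * f k)" if x: "x \<in> K" and f: "P f" for x f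
      unfolding P_def
    proof (intro ballI allI impI)
      fix t a assume t: "t \<in> T" "t \<notin> D"
      have xc: "x \<in> carrier G" and tc: "t \<in> carrier G" using x Kc t T_sub by auto
      let ?s = "rho (t \<otimes> x)"
      have "?s \<notin> D"
      proof
        assume "?s \<in> D"
        then have "t \<otimes> x \<in> D" using D_left[of ?s "t \<otimes> x"] rho_H'[of "t \<otimes> x"] xc tc by simp
        then obtain h k where hk: "t \<otimes> x = h \<otimes> k" "h \<in> H" "k \<in> K" by (auto simp: D_def)
        have "t = (t \<otimes> x) \<otimes> inv x" using tc xc by (simp add: m_assoc)
        also have "\<dots> = h \<otimes> (k \<otimes> inv x)" using hk H_sub Kc xc by (simp add: m_assoc)
        finally show False using t hk subgroup.m_closed[OF K hk(3) subgroup.m_inv_closed[OF K x]]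
          by (auto simp: D_def)
      qed
      then have "f (?s, c) = 0" for c using f xc tc by (simp add: P_def)
      then show "(\<Sum>k\<in>T \<times> {..<n}. indA x (t,a) k * f k) = 0"
        using indA_vec[OF subset_refl t(1) xc, of a f] xc tc by simp
    qed
  qed (use irr Z_D(1) in \<open>auto simp: P_def\<close>)
  then obtain f' where f': "P f'" "\<And>i. i \<in> T \<times> {..<n} \<Longrightarrow> f' i = 1" by blast
  have "f' (rho g, 0) = 1" using f'(2) g Z_D(1) by simp
  then have "rho g \<in> D" using f'(1) g by (auto simp: P_def)
  then have "g \<in> D" using D_left rho_H'[OF g] g by blast
  then show ?thesis by (auto simp: D_def)
qed

text \<open>\<open>Ind\<close> is the permutation module on the cosets of \<open>H\<close>, in which
  the constant functions are invariant. Irreducibility leaves room for one coset only.\<close>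

lemma trivial_Ind_irreducible:
  assumes n: "n = 1" "\<And>h. h \<in> H \<Longrightarrow> Z h = 1\<^sub>m n"
    and irr: "irreducible_representation G (card (T \<times> {..<n})) Ind" and g: "g \<in> carrier G"
  shows "g \<in> H"
proof -
  define P where "P f \<longleftrightarrow> (\<exists>c. \<forall>i\<in>T \<times> {..<n}. f i = c)" for f :: "'a \<times> nat \<Rightarrow> 'k"
  have "\<exists>f'. P f' \<and> (\<forall>i\<in>T \<times> {..<n}. f' i = (if fst i = rho \<one> then 1 else 0))"
  proof (rule Ind_irreducibleD[of "carrier G" P "\<lambda>_. 1" "(rho \<one>, 0)"])
    show "irreducible_representation (G\<lparr>carrier := carrier G\<rparr>) (card (T \<times> {..<n})) Ind"
      using irr by (simp add: irreducible_representation_iff representation_def)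
    show "P (\<lambda>_. 0)" "P (\<lambda>_. 1)" by (auto simp: P_def)
    show "P (\<lambda>i. f i + g i)" if "P f" "P g" for f g using that by (auto simp: P_def)
    show "P (\<lambda>i. c * f i)" if "P f" for c f using that by (auto simp: P_def)
    show "P (\<lambda>i. \<Sum>k\<in>T \<times> {..<n}. indA x i k * f k)" if x: "x \<in> carrier G" and f: "P f" for x f
    proof -
      from f obtain c where c: "\<And>i. i \<in> T \<times> {..<n} \<Longrightarrow> f i = c" by (auto simp: P_def)
      have "(\<Sum>k\<in>T \<times> {..<n}. indA x (t,a) k * f k) = c" if ta: "t \<in> T" "a < n" for t a
      proof -
        have tx: "t \<otimes> x \<in> carrier G" using ta x T_sub by simp
        show ?thesis using indA_vec[OF subset_refl ta(1) x rho_T[OF tx], of a f] n(2)[OF rho_H'[OF tx]]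
            c[of "(rho (t \<otimes> x), 0)"] tx ta n(1) by simp
      qed
      then show ?thesis unfolding P_def by (intro exI[of _ c]) auto
    qed
  qed (use n in auto)
  then obtain f' where f': "P f'" "\<And>i. i \<in> T \<times> {..<n} \<Longrightarrow> f' i = (if fst i = rho \<one> then 1 else 0)" by blast
  have "f' (rho g, 0) = f' (rho \<one>, 0)" using f'(1) g n by (auto simp: P_def)
  then have "rho g = rho \<one>" using f'(2)[of "(rho g, 0)"] f'(2)[of "(rho \<one>, 0)"] g n by (auto split: if_splits)
  then show ?thesis using rho_eq_iff[OF g one_closed] g by simp
qed

text \<open>The diagonal entry at the representative of \<open>H\<close> can be nonzero only if
  \<open>x\<close> fixes this coset.\<close>

lemma Ind_one_in_H:
  assumes x: "x \<in> carrier G" and e: "Ind x = 1\<^sub>m (card (T \<times> {..<n}))"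
  shows "x \<in> H"
proof -
  let ?t = "rho \<one>"
  have t: "?t \<in> T" "?t \<in> carrier G" by auto
  have tH: "?t \<in> H" using rho_H[of \<one>] by simp
  have "indA x (?t,0) (?t,0) = 1"
  proof -
    have "imat (T \<times> {..<n}) (indA x) = imat (T \<times> {..<n}) (\<lambda>i j. if i = j then 1 else 0)"
      using e by (simp add: Ind_def imat_one[OF finI])
    then have "\<forall>i\<in>T \<times> {..<n}. \<forall>j\<in>T \<times> {..<n}. indA x i j = (if i = j then 1 else 0)"
      by (rule imat_eq_iff[OF finI, THEN iffD1])
    then show ?thesis using t Z_D(1) by simp
  qed
  then have "?t \<otimes> x \<otimes> inv ?t \<in> H" by (auto simp: indA_def split: if_splits)
  then have "inv ?t \<otimes> (?t \<otimes> x \<otimes> inv ?t) \<otimes> ?t \<in> H"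
    using tH subgroup.m_closed[OF H] subgroup.m_inv_closed[OF H] by blast
  then show ?thesis using x t by (simp add: m_assoc inv_cancel_left)
qed

lemma Ind_eq_one:
  assumes x: "x \<in> carrier G"
    and c: "\<And>g. g \<in> carrier G \<Longrightarrow> g \<otimes> x \<otimes> inv g \<in> H \<and> Z (g \<otimes> x \<otimes> inv g) = 1\<^sub>m n"
  shows "Ind x = 1\<^sub>m (card (T \<times> {..<n}))"
  unfolding Ind_def imat_one[OF finI, symmetric]
proof (rule imat_cong[OF finI])
  fix i j assume i: "i \<in> T \<times> {..<n}" and j: "j \<in> T \<times> {..<n}"
  obtain t a u b where ij: "i = (t,a)" "j = (u,b)" by (metis surj_pair)
  have t: "t \<in> T" "t \<in> carrier G" "a < n" and u: "u \<in> T" "u \<in> carrier G" "b < n"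
    using i j ij T_sub by auto
  have "rho (t \<otimes> x) = rho t" using rho_eq_iff[of "t \<otimes> x" t] c[OF t(2)] t x by simp
  then have "rho (t \<otimes> x) = t" using rho_id[OF t(1)] by simp
  then show "indA x i j = (if i = j then 1 else 0)"
    using indA_eq[OF t(1) u(1) x] c[OF t(2)] t u by (auto simp: ij)
qed

end

section \<open>The Brauer character of the induced representation\<close>

context induced_rep
begin

abbreviation "\<theta> \<equiv> afforded_brauer p red (G\<lparr>carrier := H\<rparr>) Z"

context
  fixes x :: 'a and m :: nat
  assumes x: "x \<in> carrier G" and m: "m > 0" "\<not> p dvd m" "x [^] m = \<one>"
begin

text \<open>Right multiplication by \<open>x\<close> on the cosets, read on representatives. Its
  fixed points are the \<open>t\<close> with \<open>t \<otimes> x \<otimes> inv t\<close> in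
  \<open>H\<close>.\<close>

definition sigma :: "'a \<Rightarrow> 'a" where "sigma t = rho (t \<otimes> x)"

lemma sigma_T: "t \<in> T \<Longrightarrow> sigma t \<in> T"
  using x T_sub by (simp add: sigma_def)

lemma sigma_pow: "t \<in> T \<Longrightarrow> (sigma ^^ k) t = rho (t \<otimes> x [^] k)"
proof (induction k)
  case 0
  then show ?case using rho_id T_sub by simp
next
  case (Suc k)
  then show ?case using x T_sub rho_mult[of "t \<otimes> x [^] k" x] by (simp add: sigma_def m_assoc)
qed

lemma sigma_period: "t \<in> T \<Longrightarrow> (sigma ^^ m) t = t"
  using sigma_pow[of t m] m rho_id T_sub by simp

lemma sigma_inj:
  assumes "s \<in> T" "t \<in> T" "sigma s = sigma t" shows "s = t"
proof -
  have "(sigma ^^ Suc (m - 1)) s = (sigma ^^ Suc (m - 1)) t"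
    using assms(3) by (simp only: funpow_Suc_right comp_apply)
  then show ?thesis using sigma_period[OF assms(1)] sigma_period[OF assms(2)] m(1) by simp
qed

lemma sigma_pow_T: "t \<in> T \<Longrightarrow> (sigma ^^ k) t \<in> T"
  by (induction k) (auto simp: sigma_T)

lemma sigma_pow_inj: "s \<in> T \<Longrightarrow> t \<in> T \<Longrightarrow> (sigma ^^ k) s = (sigma ^^ k) t \<Longrightarrow> s = t"
proof (induction k)
  case (Suc k)
  then have "sigma ((sigma ^^ k) s) = sigma ((sigma ^^ k) t)" by simp
  then have "(sigma ^^ k) s = (sigma ^^ k) t" by (rule sigma_inj[OF sigma_pow_T sigma_pow_T, rotated 2]) fact+
  then show ?case using Suc by simp
qed simp

lemma indA_nz: "t \<in> T \<Longrightarrow> s \<in> T \<Longrightarrow> indA x (t,a) (s,b) \<noteq> 0 \<Longrightarrow> s = sigma t"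
  using indA_eq[OF _ _ x, of t s a b] by (auto simp: sigma_def split: if_splits)

lemma imat_indA_pow:
  assumes S: "S \<subseteq> T" "\<And>t. t \<in> S \<Longrightarrow> sigma t \<in> S"
  shows "imat (S \<times> {..<n}) (indA x) ^\<^sub>m k = imat (S \<times> {..<n}) (indA (x [^] k))"
proof (induction k)
  case 0
  then show ?case using imat_indA_one[OF S(1)] by (simp add: imat_def)
next
  case (Suc k)
  have "rho (t \<otimes> x [^] k) \<in> S" if "t \<in> S" for t
  proof -
    have "(sigma ^^ k) t \<in> S" by (induction k) (use that S(2) in auto)
    then show ?thesis using sigma_pow[of t k] that S(1) by auto
  qed
  then show ?case using Suc imat_indA_mult[OF S(1), of "x [^] k" x] x by simp
qed

text \<open>On an orbit of length \<open>l > 1\<close> the matrix is conjugate to its multiple by a primitive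
  \<open>l\<close>-th root of unity, via a diagonal matrix.\<close>

lemma bval_nontrivial_orbit:
  assumes t: "t \<in> T" and nt: "sigma t \<noteq> t"
  shows "bval (imat (range (\<lambda>i. (sigma ^^ i) t) \<times> {..<n}) (indA x)) = 0"
proof -
  define S where "S = range (\<lambda>i. (sigma ^^ i) t)"
  have S: "S \<subseteq> T" using sigma_pow_T[OF t] by (auto simp: S_def)
  have Sinv: "sigma s \<in> S" if "s \<in> S" for s
  proof -
    from that obtain i where "s = (sigma ^^ i) t" by (auto simp: S_def)
    then have "sigma s = (sigma ^^ Suc i) t" by simp
    then show ?thesis unfolding S_def by blast
  qed
  have fS: "finite (S \<times> {..<n})" using S T_fin finite_subset by blast
  define l where "l = (LEAST k. k > 0 \<and> (sigma ^^ k) t = t)"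
  have l: "l > 0" "(sigma ^^ l) t = t"
    using LeastI[of "\<lambda>k. k > 0 \<and> (sigma ^^ k) t = t" m] m sigma_period[OF t] by (auto simp: l_def)
  have lmin: "k > 0 \<Longrightarrow> (sigma ^^ k) t = t \<Longrightarrow> l \<le> k" for k
    unfolding l_def by (rule Least_le) simp
  have l1: "l \<noteq> 1" using l nt by auto
  have mult: "(sigma ^^ (l * q)) t = t" for q
    by (induction q) (use l in \<open>auto simp: funpow_add\<close>)
  have fix_iff: "l dvd k" if "(sigma ^^ k) t = t" for k
  proof -
    have "(sigma ^^ (k mod l)) t = (sigma ^^ (k mod l)) ((sigma ^^ (l * (k div l))) t)" using mult by simp
    also have "\<dots> = (sigma ^^ k) t" by (metis comp_apply funpow_add mod_mult_div_eq)
    finally have "(sigma ^^ (k mod l)) t = t" using that by simp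
    then have "k mod l = 0" using lmin[of "k mod l"] l(1) by (metis mod_less_divisor not_le neq0_conv)
    then show ?thesis by auto
  qed
  have lm: "l dvd m" using fix_iff sigma_period[OF t] by blast
  have pl: "\<not> p dvd l" using lm m(2) dvd_trans by blast
  have eq_iff: "\<exists>q. j = i + l * q" if "(sigma ^^ i) t = (sigma ^^ j) t" "i \<le> j" for i j
  proof -
    have "(sigma ^^ i) t = (sigma ^^ i) ((sigma ^^ (j - i)) t)" using that
      by (metis comp_apply funpow_add le_add_diff_inverse)
    then have "(sigma ^^ (j - i)) t = t" using sigma_pow_inj[OF t sigma_pow_T[OF t]] by metis
    then obtain q where "j - i = l * q" using fix_iff by blast
    then show ?thesis using that by (intro exI[of _ q]) simp
  qed
  define z where "z = cis (2 * pi / real l)"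
  have zl: "z ^ l = 1" using l(1) by (simp add: z_def DeMoivre)
  have z1: "z \<noteq> 1"
  proof
    assume "z = 1"
    then have "cos (2 * pi / real l) = 1" by (simp add: z_def complex_eq_iff)
    moreover have "0 < 2 * pi / real l" "2 * pi / real l < 2 * pi" using l(1) l1 by (auto simp: field_simps)
    ultimately obtain i :: int where "2 * pi / real l = real_of_int i * 2 * pi"
      using cos_one_2pi_int by blast
    then have "(2 * pi) * (1 / real l) = (2 * pi) * real_of_int i" by simp
    then have "1 / real l = real_of_int i" by (subst (asm) mult_cancel_left) simp
    moreover have "0 < 1 / real l" "1 / real l < 1" using l(1) l1 by (auto simp: field_simps)
    ultimately show False by auto
  qed
  \<comment> \<open>The orbit length \<open>l\<close> divides \<open>m\<close> and so is not
    divisible by \<open>p\<close>. Hence \<open>z\<close> is the lift of its reduction, and scaling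
    a matrix by this reduction multiplies \<open>bval\<close> by \<open>z\<close>.\<close>
  define \<zeta> where "\<zeta> = red z"
  have az: "algebraic_int z" using algebraic_int_root_of_unity[OF zl l(1)] .
  have \<zeta>l: "\<zeta> ^ l = 1" using red_power[OF az, of l] zl by (simp add: \<zeta>_def)
  have lift\<zeta>: "lift \<zeta> = z" using lift_eqI[OF zl l(1) pl] by (simp add: \<zeta>_def)
  have \<zeta>0: "\<zeta> \<noteq> 0" using \<zeta>l l(1) by (metis power_0_left zero_neq_one less_irrefl)
  have \<zeta>q: "\<zeta> ^ (i + l * q) = \<zeta> ^ i" for i q by (simp add: power_add power_mult \<zeta>l)
  \<comment> \<open>The diagonal entries of the conjugating matrix: they gain a factor \<zeta> with
    every application of \<open>sigma\<close>. The choice of \<open>i\<close> does not matter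
    because \<zeta> has \<open>l\<close>-th power 1.\<close>
  define d where "d s = \<zeta> ^ (SOME i. (sigma ^^ i) t = s)" for s
  have d_pow: "d ((sigma ^^ i) t) = \<zeta> ^ i" for i
  proof -
    define j where "j = (SOME j. (sigma ^^ j) t = (sigma ^^ i) t)"
    have "(sigma ^^ j) t = (sigma ^^ i) t" unfolding j_def by (rule someI[of _ i]) simp
    then have "\<zeta> ^ j = \<zeta> ^ i" using eq_iff[of i j] eq_iff[of j i] \<zeta>q by (metis nat_le_linear)
    then show ?thesis by (simp add: d_def j_def)
  qed
  have d_sigma: "d (sigma s) = \<zeta> * d s" if "s \<in> S" for s
  proof -
    from that obtain i where i: "s = (sigma ^^ i) t" by (auto simp: S_def)
    then have "sigma s = (sigma ^^ Suc i) t" by simp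
    then show ?thesis using d_pow[of "Suc i"] d_pow[of i] i by simp
  qed
  let ?A = "imat (S \<times> {..<n}) (indA x)"
  have Am: "?A ^\<^sub>m m = 1\<^sub>m (card (S \<times> {..<n}))"
    using imat_indA_pow[OF S Sinv, of m] imat_indA_one[OF S] m(3) by simp
  have "\<zeta> ^ m = 1" using lm \<zeta>l by (auto simp: power_mult)
  from bval_scale[OF imat_carrier Am m(1,2) this]
  have "bval (\<zeta> \<cdot>\<^sub>m ?A) = z * bval ?A" using lift\<zeta> by simp
  moreover have "\<zeta> \<cdot>\<^sub>m ?A = imat (S \<times> {..<n}) (\<lambda>i j. \<zeta> * indA x i j)"
    by (rule eq_matI) (auto simp: imat_def)
  moreover have "bval (imat (S \<times> {..<n}) (\<lambda>i j. \<zeta> * indA x i j)) = bval ?A"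
  proof (rule bval_imat_diagonal_conj[OF fS, of "\<lambda>i. d (fst i)"])
    show "d (fst i) \<noteq> 0" for i using \<zeta>0 by (simp add: d_def)
    fix i j assume i: "i \<in> S \<times> {..<n}" and j: "j \<in> S \<times> {..<n}"
    obtain s a u b where ij: "i = (s,a)" "j = (u,b)" by (metis surj_pair)
    show "\<zeta> * indA x i j * d (fst i) = indA x i j * d (fst j)"
    proof (cases "indA x i j = 0")
      case False
      then have "u = sigma s" using indA_nz[of s u a b] i j ij S by auto
      then show ?thesis using d_sigma[of s] i ij by simp
    qed simp
  qed
  ultimately have "bval ?A = z * bval ?A" by metis
  then have "(1 - z) * bval ?A = 0" by (simp add: algebra_simps)
  then show ?thesis using z1 by (simp add: S_def)
qed

text \<open>One orbit of \<open>sigma\<close> is removed at a time. An orbit of length one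
  contributes its diagonal block and a longer one contributes 0; orbit and complement are both
  stable, so the values add.\<close>

lemma bval_invariant:
  "S \<subseteq> T \<Longrightarrow> (\<And>t. t \<in> S \<Longrightarrow> sigma t \<in> S) \<Longrightarrow>
   bval (imat (S \<times> {..<n}) (indA x)) = (\<Sum>t\<in>{t\<in>S. sigma t = t}. bval (Z (t \<otimes> x \<otimes> inv t)))"
proof (induction "card S" arbitrary: S rule: less_induct)
  case less
  note S = less.prems
  have fS: "finite S" using S T_fin finite_subset by blast
  show ?case
  proof (cases "S = {}")
    case True
    then show ?thesis using bval_imat_empty by simp
  next
    case False
    then obtain t where t: "t \<in> S" by blast
    then have tT: "t \<in> T" using S by auto
    define R where "R = range (\<lambda>i. (sigma ^^ i) t)"
    have tR: "t \<in> R" unfolding R_def using rangeI[of "\<lambda>i. (sigma ^^ i) t" 0] by simp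
    have "(sigma ^^ i) t \<in> S" for i by (induction i) (use t S in auto)
    then have RS: "R \<subseteq> S" by (auto simp: R_def)
    have Rinv: "sigma s \<in> R \<longleftrightarrow> s \<in> R" if s: "s \<in> S" for s
    proof
      assume "s \<in> R"
      then obtain i where "s = (sigma ^^ i) t" by (auto simp: R_def)
      then have "sigma s = (sigma ^^ Suc i) t" by simp
      then show "sigma s \<in> R" unfolding R_def by blast
    next
      assume "sigma s \<in> R"
      then obtain i where "sigma s = (sigma ^^ i) t" by (auto simp: R_def)
      \<comment> \<open>As \<open>sigma ^^ m\<close> is the identity on \<open>T\<close>, applying
        \<open>sigma\<close> another \<open>m - 1\<close> times to \<open>sigma s\<close> returns to
        \<open>s\<close>.\<close>
      then have "(sigma ^^ m) s = (sigma ^^ (m - 1 + i)) t"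
        using m(1) by (metis Suc_pred' comp_apply funpow_Suc_right funpow_add)
      then have "s = (sigma ^^ (m - 1 + i)) t" using sigma_period s S by (metis subsetD)
      then show "s \<in> R" unfolding R_def by blast
    qed
    have fR: "finite R" using RS fS finite_subset by blast
    have "card (S - R) < card S" using fS t tR by (intro psubset_card_mono) auto
    then have IH: "bval (imat ((S - R) \<times> {..<n}) (indA x)) = (\<Sum>t\<in>{t\<in>S - R. sigma t = t}. bval (Z (t \<otimes> x \<otimes> inv t)))"
      using S Rinv by (intro less.hyps) auto
    have Req: "bval (imat (R \<times> {..<n}) (indA x)) = (\<Sum>t\<in>{t\<in>R. sigma t = t}. bval (Z (t \<otimes> x \<otimes> inv t)))"
    proof (cases "sigma t = t")
      case True
      then have "(sigma ^^ i) t = t" for i by (induction i) auto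
      then have R: "R = {t}" by (auto simp: R_def)
      have tx: "rho (t \<otimes> x) = t" using True by (simp add: sigma_def)
      have H': "t \<otimes> x \<otimes> inv t \<in> H" using rho_H'[of "t \<otimes> x"] tx x tT T_sub by simp
      have e: "bij_betw (\<lambda>a. (t,a)) {..<n} ({t} \<times> {..<n})" by (rule bij_betwI[of _ _ _ snd]) auto
      have "bval (imat ({t} \<times> {..<n}) (indA x)) = bval (mat n n (\<lambda>(a,b). indA x (t,a) (t,b)))"
        using bval_similar[OF similar_reindex[OF _ e, of "indA x"]] by simp
      also have "mat n n (\<lambda>(a,b). indA x (t,a) (t,b)) = Z (t \<otimes> x \<otimes> inv t)"
        by (rule eq_matI) (use Z_D(2)[OF H'] H' in \<open>auto simp: indA_def\<close>)
      finally show ?thesis using R True by (simp add: Collect_conv_if)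
    next
      case False
      have "{t\<in>R. sigma t = t} = {}"
      proof -
        have "(sigma ^^ Suc i) t \<noteq> (sigma ^^ i) t" for i
          using sigma_pow_inj[OF sigma_T[OF tT] tT, of i] False by (metis comp_apply funpow_Suc_right)
        then show ?thesis by (auto simp: R_def)
      qed
      then show ?thesis using bval_nontrivial_orbit[OF tT False] by (simp only: R_def[symmetric] sum.empty)
    qed
    have "S \<times> {..<n} = R \<times> {..<n} \<union> (S - R) \<times> {..<n}" using RS by auto
    then have "bval (imat (S \<times> {..<n}) (indA x)) = bval (imat (R \<times> {..<n} \<union> (S - R) \<times> {..<n}) (indA x))"
      by simp
    also have "\<dots> = bval (imat (R \<times> {..<n}) (indA x)) + bval (imat ((S - R) \<times> {..<n}) (indA x))"
    proof (rule bval_imat_Un)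
      fix i j assume i: "i \<in> R \<times> {..<n}" and j: "j \<in> (S - R) \<times> {..<n}"
      obtain s a u b where ij: "i = (s,a)" "j = (u,b)" by (metis surj_pair)
      show "indA x j i = 0"
      proof (rule ccontr)
        assume "indA x j i \<noteq> 0"
        then have "s = sigma u" using indA_nz[of u s b a] i j ij S RS by auto
        then show False using Rinv[of u] i j ij by auto
      qed
    qed (use fR fS in auto)
    also have "\<dots> = (\<Sum>t\<in>{t\<in>R. sigma t = t} \<union> {t\<in>S - R. sigma t = t}. bval (Z (t \<otimes> x \<otimes> inv t)))"
      unfolding IH Req by (rule sum.union_disjoint[symmetric]) (use fR fS in auto)
    also have "{t\<in>R. sigma t = t} \<union> {t\<in>S - R. sigma t = t} = {t\<in>S. sigma t = t}" using RS by auto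
    finally show ?thesis .
  qed
qed

end

text \<open>Used to turn the average over the whole group in \<open>induced_Brauer\<close> into a
  sum over coset representatives.\<close>

lemma group_decomposition: "bij_betw (\<lambda>(h,t). h \<otimes> t) (H \<times> T) (carrier G)"
proof (rule bij_betwI[of _ _ _ "\<lambda>g. (g \<otimes> inv (rho g), rho g)"])
  show "(\<lambda>(h,t). h \<otimes> t) \<in> H \<times> T \<rightarrow> carrier G" using H_sub T_sub by auto
  show "(\<lambda>g. (g \<otimes> inv (rho g), rho g)) \<in> carrier G \<rightarrow> H \<times> T" using rho_H' by auto
  fix g assume "g \<in> carrier G"
  then show "(\<lambda>(h,t). h \<otimes> t) (g \<otimes> inv (rho g), rho g) = g" by (simp add: m_assoc)
next
  fix a assume "a \<in> H \<times> T"
  then obtain h t where a: "a = (h,t)" "h \<in> H" "t \<in> T" by auto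
  have c: "h \<in> carrier G" "t \<in> carrier G" using a H_sub T_sub by auto
  have "rho (h \<otimes> t) = rho t" using rho_eq_iff[of "h \<otimes> t" t] c a by (simp add: m_assoc)
  then have "rho (h \<otimes> t) = t" using rho_id a by simp
  then show "(\<lambda>g. (g \<otimes> inv (rho g), rho g)) ((\<lambda>(h,t). h \<otimes> t) a) = a" using a c by (simp add: m_assoc)
qed

lemma theta_conj:
  assumes "h \<in> H" "u \<in> H" shows "\<theta> (h \<otimes> u \<otimes> inv h) = \<theta> u"
  using afforded_conj[OF sub_group[OF H] sub_finite[OF H fin] Z, of h u] assms sub_inv[OF H] by simp

text \<open>The matrix side is a sum over the cosets fixed by \<open>x\<close>. On the other side
  the summand is constant on each coset of \<open>H\<close>, as the character of \<open>H\<close> is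
  invariant under conjugation in \<open>H\<close>, and the factor \<open>card H\<close> cancels the
  denominator.\<close>

theorem Ind_brauer: "afforded_brauer p red G Ind = induced_Brauer p G H \<theta>"
proof
  fix x
  show "afforded_brauer p red G Ind x = induced_Brauer p G H \<theta> x"
  proof (cases "x \<in> p_regular p G")
    case True
    then obtain m where x: "x \<in> carrier G" and m: "m > 0" "\<not> p dvd m" "x [^] m = \<one>"
      using p_regular_iff[OF is_group fin] by blast
    have sT: "sigma x t \<in> T" if "t \<in> T" for t using sigma_T[OF x m that] .
    have "bval (Ind x) = (\<Sum>t\<in>{t\<in>T. sigma x t = t}. bval (Z (t \<otimes> x \<otimes> inv t)))"
      unfolding Ind_def using bval_invariant[OF x m subset_refl] sT by blast
    also have "\<dots> = (\<Sum>t\<in>{t\<in>T. t \<otimes> x \<otimes> inv t \<in> H}. \<theta> (t \<otimes> x \<otimes> inv t))"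
    proof (rule sum.cong)
      show "{t\<in>T. sigma x t = t} = {t\<in>T. t \<otimes> x \<otimes> inv t \<in> H}"
        using in_H_iff x T_sub by (auto simp: sigma_def[OF x m])
      fix t assume "t \<in> {t\<in>T. t \<otimes> x \<otimes> inv t \<in> H}"
      then have t: "t \<in> carrier G" "t \<otimes> x \<otimes> inv t \<in> H" using T_sub by auto
      then have "t \<otimes> x \<otimes> inv t \<in> p_regular p (G\<lparr>carrier := H\<rparr>)"
        using conj_p_regular[OF fin t(1) True] sub_p_regular[OF H fin] by blast
      then show "bval (Z (t \<otimes> x \<otimes> inv t)) = \<theta> (t \<otimes> x \<otimes> inv t)" by (simp add: afforded_brauer_bval)
    qed
    finally have 1: "bval (Ind x) = (\<Sum>t\<in>{t\<in>T. t \<otimes> x \<otimes> inv t \<in> H}. \<theta> (t \<otimes> x \<otimes> inv t))" .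
    let ?f = "\<lambda>y. if y \<otimes> x \<otimes> inv y \<in> H then \<theta> (y \<otimes> x \<otimes> inv y) else 0"
    have "(\<Sum>y\<in>{y \<in> carrier G. y \<otimes> x \<otimes> inv y \<in> H}. \<theta> (y \<otimes> x \<otimes> inv y)) = sum ?f (carrier G)"
      using fin by (simp add: sum.inter_filter)
    also have "\<dots> = (\<Sum>(h,t)\<in>H \<times> T. ?f (h \<otimes> t))"
      unfolding sum.reindex_bij_betw[OF group_decomposition, of ?f, symmetric] by (simp only: case_prod_unfold)
    also have "\<dots> = (\<Sum>(h,t)\<in>H \<times> T. ?f t)"
    proof (rule sum.cong[OF refl], clarify)
      fix h t assume h: "h \<in> H" and t: "t \<in> T"
      have c: "h \<in> carrier G" "t \<in> carrier G" using h t H_sub T_sub by auto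
      let ?u = "t \<otimes> x \<otimes> inv t"
      have uc: "?u \<in> carrier G" using c x by simp
      have e: "(h \<otimes> t) \<otimes> x \<otimes> inv (h \<otimes> t) = h \<otimes> ?u \<otimes> inv h"
        using c x by (simp add: inv_mult_group m_assoc)
      have "h \<otimes> ?u \<otimes> inv h \<in> H \<longleftrightarrow> ?u \<in> H"
      proof
        assume "h \<otimes> ?u \<otimes> inv h \<in> H"
        then have "inv h \<otimes> (h \<otimes> ?u \<otimes> inv h) \<otimes> h \<in> H"
          using h subgroup.m_closed[OF H] subgroup.m_inv_closed[OF H] by blast
        then show "?u \<in> H" using c uc by (simp add: m_assoc inv_cancel_left del: inv_mult_group)
      next
        assume "?u \<in> H"
        then show "h \<otimes> ?u \<otimes> inv h \<in> H"
          using h subgroup.m_closed[OF H] subgroup.m_inv_closed[OF H] by blast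
      qed
      then show "?f (h \<otimes> t) = ?f t" unfolding e using theta_conj[OF h, of ?u] by simp
    qed
    also have "\<dots> = of_nat (card H) * sum ?f T"
      by (simp add: sum.cartesian_product[symmetric])
    also have "sum ?f T = bval (Ind x)"
      unfolding 1 using T_fin by (simp add: sum.inter_filter)
    finally have "(\<Sum>y\<in>{y \<in> carrier G. y \<otimes> x \<otimes> inv y \<in> H}. \<theta> (y \<otimes> x \<otimes> inv y)) = of_nat (card H) * bval (Ind x)" .
    moreover have "card H > 0" using H fin subgroup.one_closed subgroup.subset
      by (metis card_gt_0_iff empty_iff finite_subset)
    ultimately show ?thesis using True by (simp add: induced_Brauer_def afforded_brauer_bval)
  next
    case False
    then show ?thesis by (simp add: induced_Brauer_def afforded_brauer_bval)
  qed
qed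

end

section \<open>Induction from and extension of representations of normal subgroups\<close>

lemma mat_eqI_vec:
  fixes A :: "'a::comm_semiring_1 mat"
  assumes A: "A \<in> carrier_mat n m" and B: "B \<in> carrier_mat n m"
    and e: "\<And>v. v \<in> carrier_vec m \<Longrightarrow> A *\<^sub>v v = B *\<^sub>v v"
  shows "A = B"
proof (rule eq_matI)
  fix i j assume "i < dim_row B" "j < dim_col B"
  then have ij: "i < n" "j < m" using B by auto
  have "col A j = col B j" using e[of "unit_vec m j"] mat_vec_unit[OF A ij(2)] mat_vec_unit[OF B ij(2)] by simp
  then have "col A j $ i = col B j $ i" by simp
  then show "A $$ (i,j) = B $$ (i,j)" using ij A B by simp
qed (use A B in auto)

context induced_rep
begin

definition support :: "('a \<times> nat \<Rightarrow> 'k) \<Rightarrow> 'a set" where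
  "support f = {t \<in> T. \<exists>a<n. f (t,a) \<noteq> 0}"

abbreviation proj :: "'a \<Rightarrow> ('a \<times> nat \<Rightarrow> 'k) \<Rightarrow> 'k vec" where
  "proj t f \<equiv> vec n (\<lambda>a. f (t,a))"

abbreviation act :: "'a \<Rightarrow> ('a \<times> nat \<Rightarrow> 'k) \<Rightarrow> 'a \<times> nat \<Rightarrow> 'k" where
  "act x f \<equiv> \<lambda>i. \<Sum>k\<in>T \<times> {..<n}. indA x i k * f k"

lemma proj_act:
  assumes t: "t \<in> T" and x: "x \<in> carrier G"
  shows "proj t (act x f) = Z (t \<otimes> x \<otimes> inv (rho (t \<otimes> x))) *\<^sub>v proj (rho (t \<otimes> x)) f"
proof (rule eq_vecI)
  have H': "t \<otimes> x \<otimes> inv (rho (t \<otimes> x)) \<in> H" using rho_H' t x T_sub by simp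
  fix a assume "a < dim_vec (Z (t \<otimes> x \<otimes> inv (rho (t \<otimes> x))) *\<^sub>v proj (rho (t \<otimes> x)) f)"
  then have a: "a < n" using Z_D(2)[OF H'] by simp
  then show "proj t (act x f) $ a = (Z (t \<otimes> x \<otimes> inv (rho (t \<otimes> x))) *\<^sub>v proj (rho (t \<otimes> x)) f) $ a"
    using indA_vec[OF subset_refl t x, of a f] t x T_sub
      mult_mat_vec_index[OF Z_D(2)[OF H'], of "proj (rho (t \<otimes> x)) f" a] by simp
next
  have H': "t \<otimes> x \<otimes> inv (rho (t \<otimes> x)) \<in> H" using rho_H' t x T_sub by simp
  show "dim_vec (proj t (act x f)) = dim_vec (Z (t \<otimes> x \<otimes> inv (rho (t \<otimes> x))) *\<^sub>v proj (rho (t \<otimes> x)) f)"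
    using Z_D(2)[OF H'] by simp
qed

lemma not_in_support: "t \<in> T \<Longrightarrow> t \<notin> support f \<longleftrightarrow> proj t f = 0\<^sub>v n"
  by (auto simp: support_def vec_eq_iff)

text \<open>In a proper submodule, the elements supported on a minimal nonempty set of cosets project
  isomorphically to each coset of that set; two such cosets give an isomorphism between conjugates of \<open>Z\<close>.\<close>

theorem normal_dichotomy:
  assumes nor: "H \<lhd> G" and irr: "irreducible_representation (G\<lparr>carrier := H\<rparr>) n Z"
    and red: "\<not> irreducible_representation G (card (T \<times> {..<n})) Ind"
  shows "\<exists>h\<in>carrier G - H. \<exists>L L'. mat_inv n L L' \<and> (\<forall>m\<in>H. L * Z m = Z (h \<otimes> m \<otimes> inv h) * L)"
proof -
  let ?I = "T \<times> {..<n}"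
  obtain W where W: "vsub (card ?I) W" and Winv: "\<And>g w. g \<in> carrier G \<Longrightarrow> w \<in> W \<Longrightarrow> Ind g *\<^sub>v w \<in> W"
    and ne: "W \<noteq> {0\<^sub>v (card ?I)}" "W \<noteq> carrier_vec (card ?I)"
    using red Ind_rep unfolding irreducible_representation_iff by blast
  define P where "P f \<longleftrightarrow> ivec ?I f \<in> W" for f :: "'a \<times> nat \<Rightarrow> 'k"
  have P0: "P (\<lambda>_. 0)" using vsubD(2)[OF W] by (simp add: P_def ivec_zero)
  have Padd: "P (\<lambda>i. f i + g i)" if "P f" "P g" for f g
    using that vsubD(3)[OF W] by (simp add: P_def flip: ivec_add)
  have Psm: "P (\<lambda>i. c * f i)" if "P f" for c f
    using that vsubD(4)[OF W] by (simp add: P_def flip: ivec_smult)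
  have Psum: "P (\<lambda>i. \<Sum>j\<in>J. F j i)" if "\<And>j. j \<in> J \<Longrightarrow> P (F j)" for J :: "'j set" and F
    using that by (induction J rule: infinite_finite_induct) (auto intro: P0 Padd)
  have Pact: "P (act x f)" if "x \<in> carrier G" "P f" for x f
    using that Winv[of x "ivec ?I f"] by (simp add: P_def Ind_ivec)
  have Pcong: "P g" if "P f" "\<And>i. i \<in> ?I \<Longrightarrow> f i = g i" for f g
    using that ivec_eq_iff[OF finI, of f g] by (simp add: P_def)
  have norm: "t \<otimes> x \<otimes> inv t \<in> H" if "t \<in> carrier G" "x \<in> H" for t x
    using normal.inv_op_closed2[OF nor that] .
  have rho_norm: "rho (t \<otimes> x) = t" if "t \<in> T" "x \<in> H" for t x
  proof -
    have "rho (t \<otimes> x) = rho t" using rho_eq_iff[of "t \<otimes> x" t] norm that T_sub H_sub by simp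
    then show ?thesis using rho_id that by simp
  qed
  have proj_H: "proj t (act x f) = Z (t \<otimes> x \<otimes> inv t) *\<^sub>v proj t f" if "t \<in> T" "x \<in> H" for t x f
    using proj_act[OF that(1) H_sub[OF that(2)]] rho_norm[OF that] by simp
  obtain f1 where f1: "P f1" "support f1 \<noteq> {}"
  proof -
    obtain w where w: "w \<in> W" "w \<noteq> 0\<^sub>v (card ?I)" using ne(1) vsubD(2)[OF W] by blast
    then obtain f where f: "w = ivec ?I f" using ivec_surj[OF finI] vsubD(1)[OF W] by metis
    then obtain i where "i \<in> ?I" "f i \<noteq> 0" using w ivec_eq_iff[OF finI, of f "\<lambda>_. 0"] by (auto simp: ivec_zero)
    then have "fst i \<in> support f" by (cases i) (auto simp: support_def)
    then show ?thesis using that[of f] w f by (auto simp: P_def)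
  qed
  obtain f0 where f0: "P f0" "support f0 \<noteq> {}" and
    min: "\<And>f. P f \<Longrightarrow> support f \<noteq> {} \<Longrightarrow> card (support f0) \<le> card (support f)"
    using ex_has_least_nat[of "\<lambda>f. P f \<and> support f \<noteq> {}" f1 "\<lambda>f. card (support f)"] f1 by blast
  define S where "S = support f0"
  have ST: "S \<subseteq> T" by (auto simp: S_def support_def)
  have fS: "finite S" using ST T_fin finite_subset by blast
  define Q where "Q f \<longleftrightarrow> P f \<and> support f \<subseteq> S" for f
  have Qiff: "Q f \<longleftrightarrow> P f \<and> (\<forall>t\<in>T - S. \<forall>a<n. f (t,a) = 0)" for f by (auto simp: Q_def support_def)
  have Q0: "Q f0" using f0 by (simp add: Q_def S_def)
  have Qadd: "Q (\<lambda>i. f i + g i)" if "Q f" "Q g" for f g using that Padd by (auto simp: Qiff)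
  have Qsm: "Q (\<lambda>i. c * f i)" if "Q f" for c f using that Psm by (auto simp: Qiff)
  have Qsum: "Q (\<lambda>i. \<Sum>j\<in>J. F j i)" if "\<And>j. j \<in> J \<Longrightarrow> Q (F j)" for J :: "'j set" and F
    using that Psum[of J F] by (auto simp: Qiff intro!: sum.neutral)
  have Qact: "Q (act x f)" if x: "x \<in> H" and f: "Q f" for x f
  proof -
    have "t \<notin> support (act x f)" if t: "t \<in> T" "t \<notin> S" for t
    proof -
      have "proj t f = 0\<^sub>v n" using f t by (auto simp: Q_def simp flip: not_in_support)
      then have "proj t (act x f) = 0\<^sub>v n"
        using proj_H[OF t(1) x] mat_vec_zero[OF Z_D(2)[OF norm[OF T_sub[OF t(1)] x]]] by simp
      then show ?thesis using not_in_support[OF t(1)] by simp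
    qed
    then show ?thesis using Pact[OF H_sub[OF x]] f by (auto simp: Q_def support_def)
  qed
  \<comment> \<open>A member of \<open>Q\<close> that vanishes at one coset of \<open>S\<close> has
    support strictly inside \<open>S\<close>, and minimality makes it zero.\<close>
  have inj: "support f = {}" if "Q f" "t \<in> S" "proj t f = 0\<^sub>v n" for f t
  proof (rule ccontr)
    assume "support f \<noteq> {}"
    then have "card S \<le> card (support f)" using min[of f] that by (simp add: Q_def S_def)
    note calculation = this
    have "support f \<subset> S" using that ST not_in_support[of t f] by (auto simp: Q_def)
    then have "card (support f) < card S" by (rule psubset_card_mono[OF fS])
    then show False using calculation by simp
  qed
  have zero_support: "f (t,a) = 0" if "support f = {}" "t \<in> T" "a < n" for f t a
    using that by (auto simp: support_def)
  have surj: "\<exists>f. Q f \<and> proj t f = v" if t: "t \<in> S" and v: "v \<in> carrier_vec n" for t v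
  proof -
    \<comment> \<open>The components at \<open>t\<close> of members of \<open>Q\<close>. They are
      invariant under \<open>Z\<close> because \<open>Z m\<close> at coset \<open>t\<close> is the
      action of \<open>inv t \<otimes> m \<otimes> t\<close>, which lies in \<open>H\<close> by
      normality.\<close>
    define U where "U = {proj t f | f. Q f}"
    have tT: "t \<in> T" "t \<in> carrier G" using t ST T_sub by auto
    have UI: "u \<in> U" if "Q f" "u = proj t f" for u f
      unfolding U_def by (rule CollectI, rule exI[of _ f], intro conjI that)
    have "vsub n U" unfolding vsub_def
    proof (intro conjI ballI allI)
      show "U \<subseteq> carrier_vec n" by (auto simp: U_def)
      have "Q (\<lambda>_. 0)" using P0 by (auto simp: Qiff)
      then show "0\<^sub>v n \<in> U" by (rule UI) (rule eq_vecI, auto)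
      fix u assume "u \<in> U"
      then obtain f where f: "Q f" "u = proj t f" by (auto simp: U_def)
      have "c \<cdot>\<^sub>v u = proj t (\<lambda>i. c * f i)" for c unfolding f by (rule eq_vecI) auto
      then show "c \<cdot>\<^sub>v u \<in> U" for c by (rule UI[OF Qsm[OF f(1)]])
      fix w assume "w \<in> U"
      then obtain g where g: "Q g" "w = proj t g" by (auto simp: U_def)
      have "u + w = proj t (\<lambda>i. f i + g i)" unfolding f g by (rule eq_vecI) auto
      then show "u + w \<in> U" by (rule UI[OF Qadd[OF f(1) g(1)]])
    qed
    moreover have "\<forall>m\<in>carrier (G\<lparr>carrier := H\<rparr>). \<forall>u\<in>U. Z m *\<^sub>v u \<in> U"
    proof (intro ballI)
      fix m u assume "m \<in> carrier (G\<lparr>carrier := H\<rparr>)" "u \<in> U"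
      then have m: "m \<in> H" by simp
      from \<open>u \<in> U\<close> obtain f where f: "Q f" "u = proj t f" by (auto simp: U_def)
      define x where "x = inv t \<otimes> m \<otimes> t"
      have x: "x \<in> H" using normal.inv_op_closed1[OF nor tT(2) m] by (simp add: x_def)
      have "t \<otimes> x \<otimes> inv t = m" using tT H_sub[OF m] by (simp add: x_def m_assoc inv_cancel_left)
      then have "Z m *\<^sub>v u = proj t (act x f)" using proj_H[OF tT(1) x] f by simp
      then show "Z m *\<^sub>v u \<in> U" by (rule UI[OF Qact[OF x f(1)]])
    qed
    ultimately have "U = {0\<^sub>v n} \<or> U = carrier_vec n"
      using irr unfolding irreducible_representation_iff by blast
    moreover have "proj t f0 \<in> U" using Q0 unfolding U_def by blast
    moreover have "proj t f0 \<noteq> 0\<^sub>v n" using not_in_support[OF tT(1), of f0] t S_def by blast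
    ultimately have "v \<in> U" using v by auto
    then show ?thesis by (auto simp: U_def)
  qed
  obtain t where t: "t \<in> S" using f0 by (auto simp: S_def)
  have tT: "t \<in> T" "t \<in> carrier G" using t ST T_sub by auto
  \<comment> \<open>If \<open>S\<close> were a single coset, the submodule would contain all
    functions supported there; translating by \<open>G\<close> gives the same at every coset, and
    sums give the whole space.\<close>
  have "\<exists>t'\<in>S. t' \<noteq> t"
  proof (rule ccontr)
    assume "\<not> ?thesis"
    then have "\<And>s. s \<in> S \<Longrightarrow> s = t" by blast
    then have S1: "S = {t}" using t by blast
    have single: "P (\<lambda>i. if fst i = u then v $ (snd i) else 0)" if u: "u \<in> T" and v: "v \<in> carrier_vec n" for u v
    proof -
      obtain f where f: "Q f" "proj t f = v" using surj[OF t v] by blast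
      have uc: "u \<in> carrier G" using u T_sub by simp
      define x where "x = inv u \<otimes> t"
      have x: "x \<in> carrier G" using uc tT by (simp add: x_def)
      have ux: "u \<otimes> x = t" using uc tT by (simp add: x_def inv_cancel_left)
      have eq: "act x f i = (if fst i = u then v $ (snd i) else 0)" if i: "i \<in> ?I" for i
      proof -
        obtain s a where sa: "i = (s,a)" "s \<in> T" "a < n" using i by auto
        have "proj s (act x f) = (if s = u then v else 0\<^sub>v n)"
        proof (cases "s = u")
          case True
          then show ?thesis using proj_act[OF u x] ux rho_id[OF tT(1)] tT Z_D(3) f v by simp
        next
          case False
          have sc: "s \<in> carrier G" using sa T_sub by simp
          have "rho (s \<otimes> x) \<noteq> t"
          proof
            assume "rho (s \<otimes> x) = t"
            then have "s \<otimes> x \<otimes> inv (u \<otimes> x) \<in> H" using rho_eq_iff[of "s \<otimes> x" "u \<otimes> x"] sc uc x ux rho_id tT by simp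
            then have "s \<otimes> inv u \<in> H" using sc uc x by (simp add: inv_mult_group m_assoc inv_cancel_left)
            then have "rho s = rho u" using rho_eq_iff sc uc by simp
            then show False using rho_id sa u False by simp
          qed
          then have "rho (s \<otimes> x) \<notin> support f" using f(1) S1 by (auto simp: Q_def)
          then have "proj (rho (s \<otimes> x)) f = 0\<^sub>v n" using not_in_support sc x by simp
          then show ?thesis using proj_act[OF sa(2) x, of f] False
              mat_vec_zero[OF Z_D(2)[OF rho_H'[of "s \<otimes> x"]]] sc x by simp
        qed
        then have "proj s (act x f) $ a = (if s = u then v else 0\<^sub>v n) $ a" by simp
        then show ?thesis using sa v by (simp split: if_splits)
      qed
      show ?thesis by (rule Pcong[OF Pact[OF x]]) (use f eq in \<open>auto simp: Q_def\<close>)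
    qed
    have "P f" for f
    proof -
      have "P (\<lambda>i. \<Sum>u\<in>T. if fst i = u then proj u f $ (snd i) else 0)"
        by (rule Psum) (rule single, auto)
      then show ?thesis by (rule Pcong) (use T_fin in auto)
    qed
    then have "W = carrier_vec (card ?I)" using ivec_surj[OF finI] vsubD(1)[OF W] unfolding P_def by blast
    then show False using ne by blast
  qed
  then obtain t' where t': "t' \<in> S" "t' \<noteq> t" by blast
  have t'T: "t' \<in> T" "t' \<in> carrier G" using t' ST T_sub by auto
  have "\<forall>j. \<exists>f. j < n \<longrightarrow> Q f \<and> proj t f = unit_vec n j" using surj[OF t] by simp
  then obtain F where F: "\<And>j. j < n \<Longrightarrow> Q (F j)" "\<And>j. j < n \<Longrightarrow> proj t (F j) = unit_vec n j" by metis
  \<comment> \<open>The map from the component at \<open>t\<close> to the component at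
    \<open>t'\<close>. Its columns are the values at \<open>t'\<close> of the members
    \<open>F j\<close> of \<open>Q\<close> whose component at \<open>t\<close> is a unit
    vector.\<close>
  define L where "L = mat n n (\<lambda>(a,j). F j (t',a))"
  have L: "L \<in> carrier_mat n n" by (simp add: L_def)
  have Lproj: "L *\<^sub>v proj t f = proj t' f" if f: "Q f" for f
  proof -
    \<comment> \<open>Subtracting the combination with the same component at \<open>t\<close> leaves
      a member of \<open>Q\<close> that vanishes at \<open>t\<close>, and hence at
      \<open>t'\<close>.\<close>
    define g where "g i = f i + (-1) * (\<Sum>j<n. f (t,j) * F j i)" for i
    have Qg: "Q g" unfolding g_def by (intro Qadd Qsm Qsum f F(1)) simp
    have "proj t g = 0\<^sub>v n"
    proof (rule eq_vecI)
      fix a assume "a < dim_vec (0\<^sub>v n :: 'k vec)"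
      then have a: "a < n" by simp
      have "(\<Sum>j<n. f (t,j) * F j (t,a)) = (\<Sum>j<n. if j = a then f (t,a) else 0)"
      proof (rule sum.cong[OF refl])
        fix j assume "j \<in> {..<n}"
        then have "F j (t,a) = unit_vec n j $ a" using F(2)[of j] a by (metis index_vec lessThan_iff)
        then show "f (t,j) * F j (t,a) = (if j = a then f (t,a) else 0)" using a \<open>j \<in> {..<n}\<close> by simp
      qed
      then show "proj t g $ a = 0\<^sub>v n $ a" using a by (simp add: g_def)
    qed simp
    then have g0: "g (t',a) = 0" if "a < n" for a using inj[OF Qg t] zero_support t'T that by blast
    show ?thesis
    proof (rule eq_vecI)
      fix a assume "a < dim_vec (proj t' f)"
      then have a: "a < n" by simp
      have "(L *\<^sub>v proj t f) $ a = (\<Sum>j<n. f (t,j) * F j (t',a))"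
        unfolding mult_mat_vec_index[OF L vec_carrier a] using a by (intro sum.cong) (auto simp: L_def)
      then show "(L *\<^sub>v proj t f) $ a = proj t' f $ a" using g0[OF a] a by (simp add: g_def)
    qed (use L in simp)
  qed
  obtain L' where L': "mat_inv n L L'"
  proof (rule mat_inv_if_kernel_trivial[OF L])
    fix v assume v: "v \<in> carrier_vec n" "L *\<^sub>v v = 0\<^sub>v n"
    obtain f where f: "Q f" "proj t f = v" using surj[OF t v(1)] by blast
    have "proj t' f = 0\<^sub>v n" using Lproj[OF f(1)] f v by simp
    then have "support f = {}" using inj[OF f(1) t'(1)] by simp
    then show "v = 0\<^sub>v n" using not_in_support[OF tT(1), of f] f by auto
  qed
  define h where "h = t' \<otimes> inv t"
  have h: "h \<in> carrier G" using tT t'T by (simp add: h_def)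
  have "h \<notin> H"
  proof
    assume "h \<in> H"
    then have "rho t' = rho t" using rho_eq_iff tT t'T by (simp add: h_def)
    then show False using rho_id tT t'T t' by simp
  qed
  moreover have "L * Z m = Z (h \<otimes> m \<otimes> inv h) * L" if m: "m \<in> H" for m
  proof -
    define x where "x = inv t \<otimes> m \<otimes> t"
    have x: "x \<in> H" using normal.inv_op_closed1[OF nor tT(2) m] by (simp add: x_def)
    have e1: "t \<otimes> x \<otimes> inv t = m" using tT H_sub[OF m] by (simp add: x_def m_assoc inv_cancel_left)
    have e2: "t' \<otimes> x \<otimes> inv t' = h \<otimes> m \<otimes> inv h"
      using tT t'T H_sub[OF m] by (simp add: x_def h_def m_assoc inv_mult_group)
    have hm: "h \<otimes> m \<otimes> inv h \<in> H" by (rule norm[OF h m])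
    show ?thesis
    proof (rule mat_eqI_vec[of _ n n])
      show "L * Z m \<in> carrier_mat n n" using L Z_D(2)[OF m] by simp
      show "Z (h \<otimes> m \<otimes> inv h) * L \<in> carrier_mat n n" using L Z_D(2)[OF hm] by simp
      fix v :: "'k vec" assume v: "v \<in> carrier_vec n"
      obtain f where f: "Q f" "proj t f = v" using surj[OF t v] by blast
      have "(L * Z m) *\<^sub>v v = L *\<^sub>v (Z m *\<^sub>v v)" by (rule assoc_mult_mat_vec[OF L Z_D(2)[OF m] v])
      also have "Z m *\<^sub>v v = proj t (act x f)" using proj_H[OF tT(1) x, of f] e1 f by simp
      also have "L *\<^sub>v proj t (act x f) = proj t' (act x f)" by (rule Lproj[OF Qact[OF x f(1)]])
      also have "\<dots> = Z (h \<otimes> m \<otimes> inv h) *\<^sub>v proj t' f" using proj_H[OF t'T(1) x, of f] e2 by simp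
      also have "proj t' f = L *\<^sub>v v" using Lproj[OF f(1)] f by simp
      also have "Z (h \<otimes> m \<otimes> inv h) *\<^sub>v (L *\<^sub>v v) = (Z (h \<otimes> m \<otimes> inv h) * L) *\<^sub>v v"
        by (rule assoc_mult_mat_vec[OF Z_D(2)[OF hm] L v, symmetric])
      finally show "(L * Z m) *\<^sub>v v = (Z (h \<otimes> m \<otimes> inv h) * L) *\<^sub>v v" .
    qed
  qed
  ultimately show ?thesis using L' h by blast
qed

end

section \<open>Schur's lemma and extension of representations\<close>

context brauer
begin

text \<open>An eigenspace of \<open>C\<close> is nonzero and invariant under \<open>X\<close>, hence
  everything.\<close>

lemma schur:
  assumes X: "irreducible_representation G n X" and C: "(C :: 'k mat) \<in> carrier_mat n n"
    and com: "\<And>g. g \<in> carrier G \<Longrightarrow> C * X g = X g * C"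
  shows "\<exists>c. C = c \<cdot>\<^sub>m 1\<^sub>m n"
proof -
  have rX: "representation G n X" using X by (simp add: irreducible_representation_iff)
  note D = representationD[OF rX]
  obtain v c where v: "v \<in> carrier_vec n" "v \<noteq> 0\<^sub>v n" "C *\<^sub>v v = c \<cdot>\<^sub>v v"
    using eigenvector_exists[OF C D(1)] by blast
  define W where "W = {w \<in> carrier_vec n. C *\<^sub>v w = c \<cdot>\<^sub>v w}"
  have "vsub n W" unfolding vsub_def
  proof (intro conjI ballI allI)
    show "W \<subseteq> carrier_vec n" by (auto simp: W_def)
    have "c \<cdot>\<^sub>v 0\<^sub>v n = 0\<^sub>v n" by (rule eq_vecI) auto
    then show "0\<^sub>v n \<in> W" using mat_vec_zero[OF C] by (simp add: W_def)
    fix u assume u: "u \<in> W"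
    then show "d \<cdot>\<^sub>v u \<in> W" for d
      using mult_mat_vec[OF C, of u d] by (simp add: W_def smult_smult_assoc mult.commute)
    fix w assume w: "w \<in> W"
    then show "u + w \<in> W" using u mult_add_distrib_mat_vec[OF C, of u w]
      by (simp add: W_def smult_add_distrib_vec[of _ n])
  qed
  moreover have "\<forall>g\<in>carrier G. \<forall>w\<in>W. X g *\<^sub>v w \<in> W"
  proof (intro ballI)
    fix g w assume g: "g \<in> carrier G" and "w \<in> W"
    then have w: "w \<in> carrier_vec n" "C *\<^sub>v w = c \<cdot>\<^sub>v w" by (auto simp: W_def)
    have "C *\<^sub>v (X g *\<^sub>v w) = (C * X g) *\<^sub>v w" using C D(2)[OF g] w(1) by simp
    also have "\<dots> = X g *\<^sub>v (C *\<^sub>v w)" unfolding com[OF g] using C D(2)[OF g] w(1) by simp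
    also have "\<dots> = c \<cdot>\<^sub>v (X g *\<^sub>v w)" unfolding w(2) by (rule mult_mat_vec[OF D(2)[OF g] w(1)])
    finally show "X g *\<^sub>v w \<in> W" using mult_mat_vec_carrier[OF D(2)[OF g] w(1)] by (simp add: W_def)
  qed
  ultimately have "W = {0\<^sub>v n} \<or> W = carrier_vec n" using X unfolding irreducible_representation_iff by blast
  moreover have "v \<in> W" using v by (simp add: W_def)
  ultimately have "W = carrier_vec n" using v by auto
  have "C = c \<cdot>\<^sub>m 1\<^sub>m n"
  proof (rule mat_eqI_vec[OF C])
    fix w :: "'k vec" assume w: "w \<in> carrier_vec n"
    have "(c \<cdot>\<^sub>m 1\<^sub>m n) *\<^sub>v w = c \<cdot>\<^sub>v w" by (rule eq_vecI) (use w in auto)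
    then show "C *\<^sub>v w = (c \<cdot>\<^sub>m 1\<^sub>m n) *\<^sub>v w" using w \<open>W = carrier_vec n\<close> by (auto simp: W_def)
  qed simp
  then show ?thesis by blast
qed

end

context induced_rep
begin

text \<open>By Schur's lemma the intertwiner can be rescaled so that its \<open>q\<close>-th power is \<open>Z (h [^] q)\<close>, where
  \<open>h [^] q\<close> is the least power of \<open>h\<close> in \<open>H\<close>; then \<open>m \<otimes> h [^] i\<close> acts as \<open>Z m * L ^\<^sub>m i\<close>.\<close>

theorem extension:
  assumes nor: "H \<lhd> G" and irr: "irreducible_representation (G\<lparr>carrier := H\<rparr>) n Z"
    and h: "h \<in> carrier G" "h \<notin> H" and inv: "mat_inv n L0 L0'"
    and L0: "\<And>m. m \<in> H \<Longrightarrow> L0 * Z m = Z (h \<otimes> m \<otimes> inv h) * L0"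
    and gen: "\<And>K. subgroup K G \<Longrightarrow> H \<subseteq> K \<Longrightarrow> h \<in> K \<Longrightarrow> K = carrier G"
  shows "\<exists>X. representation G n X \<and> (\<forall>m\<in>H. X m = Z m)"
proof -
  have norm: "g \<otimes> m \<otimes> inv g \<in> H" if "g \<in> carrier G" "m \<in> H" for g m
    using normal.inv_op_closed2[OF nor that] .
  have hp: "h [^] (k::nat) \<in> carrier G" for k using h by simp
  have Hm: "a \<otimes> b \<in> H" if "a \<in> H" "b \<in> H" for a b using subgroup.m_closed[OF H that] .
  have Hi: "inv a \<in> H" if "a \<in> H" for a using subgroup.m_inv_closed[OF H that] .
  have Zinv: "mat_inv n (Z m) (Z (inv m))" if m: "m \<in> H" for m
    using representation_inv[OF sub_group[OF H] Z, of m] m sub_inv[OF H] by simp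
  have ordh: "ord h > 0" "h [^] ord h = \<one>" using ord_ge_1[OF fin h(1)] pow_ord_eq_1[OF h(1)] by simp_all
  \<comment> \<open>The order of \<open>h\<close> modulo \<open>H\<close>; it divides every exponent
    with a power in \<open>H\<close>.\<close>
  define q :: nat where "q = (LEAST k. k > 0 \<and> h [^] k \<in> H)"
  have q: "q > 0" "h [^] q \<in> H"
    using LeastI[of "\<lambda>k. k > 0 \<and> h [^] k \<in> H" "ord h"] ordh subgroup.one_closed[OF H] by (auto simp: q_def)
  have qmin: "k > 0 \<Longrightarrow> h [^] k \<in> H \<Longrightarrow> q \<le> k" for k
    unfolding q_def by (rule Least_le) simp
  have hqs: "h [^] (q * s) \<in> H" for s
    by (induction s) (use q Hm h subgroup.one_closed[OF H] in \<open>auto simp: nat_pow_mult[symmetric] add.commute\<close>)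
  have q_dvd: "q dvd k" if "h [^] k \<in> H" for k
  proof -
    have "h [^] k = h [^] (q * (k div q)) \<otimes> h [^] (k mod q)"
      using h by (simp add: nat_pow_mult)
    then have "h [^] (k mod q) = inv (h [^] (q * (k div q))) \<otimes> h [^] k"
      using h by (simp add: inv_cancel_left)
    then have "h [^] (k mod q) \<in> H" using Hm[OF Hi[OF hqs] that] by simp
    then have "k mod q = 0" using qmin[of "k mod q"] q(1) by (metis mod_less_divisor not_le neq0_conv)
    then show ?thesis by auto
  qed
  have comm: "L ^\<^sub>m k * Z m = Z (h [^] k \<otimes> m \<otimes> inv (h [^] k)) * L ^\<^sub>m k"
    if L: "L \<in> carrier_mat n n" and Lc: "\<And>m. m \<in> H \<Longrightarrow> L * Z m = Z (h \<otimes> m \<otimes> inv h) * L" and m: "m \<in> H" for L k m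
    using m
  proof (induction k arbitrary: m)
    case 0
    then show ?case using Z_D(2)[of m] L H_sub[of m] by simp
  next
    case (Suc k)
    have Lk: "L ^\<^sub>m k \<in> carrier_mat n n" using L by simp
    have m': "h \<otimes> m \<otimes> inv h \<in> H" by (rule norm[OF h(1) Suc.prems])
    have m'': "h [^] k \<otimes> (h \<otimes> m \<otimes> inv h) \<otimes> inv (h [^] k) \<in> H" by (rule norm[OF hp m'])
    have "L ^\<^sub>m Suc k * Z m = L ^\<^sub>m k * (L * Z m)"
      using assoc_mult_mat[OF Lk L Z_D(2)[OF Suc.prems]] by simp
    also have "\<dots> = (L ^\<^sub>m k * Z (h \<otimes> m \<otimes> inv h)) * L"
      unfolding Lc[OF Suc.prems] using assoc_mult_mat[OF Lk Z_D(2)[OF m'] L] by simp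
    also have "\<dots> = Z (h [^] k \<otimes> (h \<otimes> m \<otimes> inv h) \<otimes> inv (h [^] k)) * L ^\<^sub>m Suc k"
      unfolding Suc.IH[OF m'] using assoc_mult_mat[OF Z_D(2)[OF m''] Lk L] by simp
    also have "h [^] k \<otimes> (h \<otimes> m \<otimes> inv h) \<otimes> inv (h [^] k) = h [^] Suc k \<otimes> m \<otimes> inv (h [^] Suc k)"
      using h H_sub[OF Suc.prems] hp[of k] by (simp add: m_assoc inv_mult_group)
    finally show ?case .
  qed
  note D0 = mat_invD[OF inv]
  have L0q: "L0 ^\<^sub>m q \<in> carrier_mat n n" using D0(1) by simp
  \<comment> \<open>Both \<open>L0 ^\<^sub>m q\<close> and \<open>Z (h [^] q)\<close> intertwine
    \<open>Z\<close> with its conjugate by \<open>h [^] q\<close>, so their quotient commutes with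
    \<open>Z\<close> and is a scalar.\<close>
  define C where "C = Z (inv (h [^] q)) * L0 ^\<^sub>m q"
  note Zi = mat_invD[OF Zinv[OF q(2)]]
  have C: "C \<in> carrier_mat n n" using Zi L0q by (simp add: C_def)
  have "C * Z m = Z m * C" if m: "m \<in> H" for m
  proof -
    have m': "h [^] q \<otimes> m \<otimes> inv (h [^] q) \<in> H" by (rule norm[OF hp m])
    have "C * Z m = Z (inv (h [^] q)) * (L0 ^\<^sub>m q * Z m)"
      unfolding C_def by (rule assoc_mult_mat[OF Zi(2) L0q Z_D(2)[OF m]])
    also have "\<dots> = Z (inv (h [^] q)) * (Z (h [^] q \<otimes> m \<otimes> inv (h [^] q)) * L0 ^\<^sub>m q)"
      using comm[OF D0(1) L0 m] by simp
    also have "\<dots> = Z (inv (h [^] q) \<otimes> (h [^] q \<otimes> m \<otimes> inv (h [^] q))) * L0 ^\<^sub>m q"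
      using assoc_mult_mat[OF Zi(2) Z_D(2)[OF m'] L0q] Z_D(4)[OF Hi[OF q(2)] m'] by simp
    also have "inv (h [^] q) \<otimes> (h [^] q \<otimes> m \<otimes> inv (h [^] q)) = m \<otimes> inv (h [^] q)"
      using hp H_sub[OF m] by (simp add: m_assoc inv_cancel_left)
    also have "Z (m \<otimes> inv (h [^] q)) * L0 ^\<^sub>m q = Z m * C"
      unfolding C_def Z_D(4)[OF m Hi[OF q(2)]] by (rule assoc_mult_mat[OF Z_D(2)[OF m] Zi(2) L0q])
    finally show ?thesis .
  qed
  then obtain c where c: "C = c \<cdot>\<^sub>m 1\<^sub>m n" using schur[OF irr C] by auto
  have L0qc: "L0 ^\<^sub>m q = c \<cdot>\<^sub>m Z (h [^] q)"
  proof -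
    have "L0 ^\<^sub>m q = Z (h [^] q) * C"
      unfolding C_def by (rule mat_inv_cancel_left[OF Zinv[OF q(2)] L0q, symmetric])
    also have "\<dots> = c \<cdot>\<^sub>m (Z (h [^] q) * 1\<^sub>m n)" unfolding c by (rule mult_smult_distrib[OF Zi(1) one_carrier_mat])
    finally show ?thesis using Zi(1) by simp
  qed
  have powinv: "mat_inv n (L0 ^\<^sub>m k) (L0' ^\<^sub>m k)" for k
  proof (induction k)
    case 0
    then show ?case using D0 mat_inv_one by simp
  next
    case (Suc k)
    have "L0' ^\<^sub>m Suc k = L0' * L0' ^\<^sub>m k" using D0(2) by (induction k) (simp_all add: assoc_mult_mat[of _ n n _ n _ n])
    then show ?case using mat_inv_mult[OF Suc inv] by simp
  qed
  have c0: "c \<noteq> 0"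
  proof
    assume "c = 0"
    then have z: "L0 ^\<^sub>m q = 0\<^sub>m n n" unfolding L0qc by (intro eq_matI) (use Zi(1) in auto)
    have "(1\<^sub>m n :: 'k mat) = 0\<^sub>m n n"
      using mat_invD(3)[OF powinv[of q]] left_mult_zero_mat[OF mat_invD(2)[OF powinv[of q]]] z by metis
    then have "(1\<^sub>m n :: 'k mat) $$ (0,0) = 0\<^sub>m n n $$ (0,0)" by simp
    then show False using Z_D(1) by simp
  qed
  \<comment> \<open>The scalar \<open>c\<close> is removed by multiplying \<open>L0\<close> by a
    q-th root of its inverse, available since the residue field is algebraically closed.\<close>
  obtain d where d: "d ^ q = inverse c"
  proof -
    let ?f = "monom 1 q + [:- inverse c:]"
    have "degree ?f = q" using q(1) by (simp add: degree_add_eq_left degree_monom_eq)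
    then obtain a where "poly ?f a = 0" using alg_closed[of ?f] q(1) by auto
    then show ?thesis using that[of a] by (simp add: poly_monom)
  qed
  define L where "L = d \<cdot>\<^sub>m L0"
  have L: "L \<in> carrier_mat n n" using D0 by (simp add: L_def)
  have Lc: "L * Z m = Z (h \<otimes> m \<otimes> inv h) * L" if m: "m \<in> H" for m
    unfolding L_def mult_smult_assoc_mat[OF D0(1) Z_D(2)[OF m]] L0[OF m]
      mult_smult_distrib[OF Z_D(2)[OF norm[OF h(1) m]] D0(1)] ..
  have Lpow: "L ^\<^sub>m k = d ^ k \<cdot>\<^sub>m L0 ^\<^sub>m k" for k
  proof (induction k)
    case 0
    then show ?case using D0 L by (auto intro!: eq_matI)
  next
    case (Suc k)
    have Lk: "L0 ^\<^sub>m k \<in> carrier_mat n n" using D0 by simp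
    have "L ^\<^sub>m Suc k = (d ^ k \<cdot>\<^sub>m L0 ^\<^sub>m k) * (d \<cdot>\<^sub>m L0)" using Suc L_def by simp
    also have "\<dots> = d ^ k \<cdot>\<^sub>m (d \<cdot>\<^sub>m (L0 ^\<^sub>m k * L0))"
      using mult_smult_assoc_mat[OF Lk, of "d \<cdot>\<^sub>m L0" n "d ^ k"] mult_smult_distrib[OF Lk D0(1), of d] D0(1) by simp
    also have "\<dots> = d ^ Suc k \<cdot>\<^sub>m L0 ^\<^sub>m Suc k" by (rule eq_matI) (auto simp: mult_ac)
    finally show ?case .
  qed
  have Lq: "L ^\<^sub>m q = Z (h [^] q)"
    unfolding Lpow L0qc d by (rule eq_matI) (use c0 Zi(1) in auto)
  have Lcar: "L ^\<^sub>m k \<in> carrier_mat n n" for k using L by simp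
  have Ladd: "L ^\<^sub>m (i + j) = L ^\<^sub>m i * L ^\<^sub>m j" for i j
  proof (induction j)
    case 0
    then show ?case using L Lcar[of i] by simp
  next
    case (Suc j)
    then show ?case using assoc_mult_mat[OF Lcar Lcar L] by simp
  qed
  have Lqs: "L ^\<^sub>m (q * s) = Z (h [^] (q * s))" for s
  proof (induction s)
    case 0
    then show ?case using L Z_D(3) by simp
  next
    case (Suc s)
    have "L ^\<^sub>m (q * Suc s) = L ^\<^sub>m (q * s) * L ^\<^sub>m q" using Ladd[of "q * s" q] by (simp add: add.commute)
    also have "\<dots> = Z (h [^] (q * s) \<otimes> h [^] q)" unfolding Suc Lq using Z_D(4)[OF hqs q(2)] by simp
    also have "h [^] (q * s) \<otimes> h [^] q = h [^] (q * Suc s)" using h by (simp add: nat_pow_mult add.commute)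
    finally show ?case .
  qed
  \<comment> \<open>Two factorisations of one element differ by a power of \<open>h\<close> in
    \<open>H\<close>. Its exponent is a multiple of \<open>q\<close>, and on such powers
    \<open>L\<close> agrees with \<open>Z\<close>.\<close>
  have wd: "Z m * L ^\<^sub>m i = Z m' * L ^\<^sub>m j"
    if m: "m \<in> H" "m' \<in> H" and e: "m \<otimes> h [^] i = m' \<otimes> h [^] j" and ij: "i \<le> j" for m m' i j
  proof -
    have mc: "m \<in> carrier G" "m' \<in> carrier G" using m H_sub by auto
    have "h [^] j = h [^] (j - i) \<otimes> h [^] i" using h ij by (simp add: nat_pow_mult)
    then have "m \<otimes> h [^] i = (m' \<otimes> h [^] (j - i)) \<otimes> h [^] i" using e mc h by (simp add: m_assoc)
    then have mm: "m = m' \<otimes> h [^] (j - i)" using mc h by simp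
    then have "h [^] (j - i) = inv m' \<otimes> m" using mc h by (simp add: inv_cancel_left)
    then have hji: "h [^] (j - i) \<in> H" using Hm[OF Hi[OF m(2)] m(1)] by simp
    then obtain s where s: "j - i = q * s" using q_dvd by blast
    have "Z m * L ^\<^sub>m i = Z m' * Z (h [^] (j - i)) * L ^\<^sub>m i" using mm Z_D(4)[OF m(2) hji] by simp
    also have "\<dots> = Z m' * (L ^\<^sub>m (j - i) * L ^\<^sub>m i)"
      unfolding s Lqs using assoc_mult_mat[OF Z_D(2)[OF m(2)] Z_D(2)[OF hqs] Lcar] by simp
    also have "\<dots> = Z m' * L ^\<^sub>m j" unfolding Ladd[symmetric] using ij by simp
    finally show ?thesis .
  qed
  \<comment> \<open>The subgroup generated by \<open>H\<close> and \<open>h\<close>. Nonnegative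
    exponents suffice because \<open>h\<close> has finite order.\<close>
  define K where "K = {m \<otimes> h [^] i | m i. m \<in> H \<and> (i::nat) \<in> UNIV}"
  have KI: "m \<otimes> h [^] (i::nat) \<in> K" if "m \<in> H" for m i using that by (auto simp: K_def)
  have prod: "(m \<otimes> h [^] i) \<otimes> (m' \<otimes> h [^] j) = (m \<otimes> (h [^] i \<otimes> m' \<otimes> inv (h [^] i))) \<otimes> h [^] (i + j)"
    if "m \<in> H" "m' \<in> H" for m m' and i j :: nat
    using H_sub[OF that(1)] H_sub[OF that(2)] hp[of i] hp[of j]
    by (simp add: m_assoc inv_cancel_left nat_pow_mult[OF h(1), symmetric])
  have Kall: "K = carrier G"
  proof (rule gen)
    show "H \<subseteq> K"
    proof
      fix m assume "m \<in> H"
      then show "m \<in> K" using KI[of m 0] H_sub by simp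
    qed
    show "h \<in> K" using KI[OF subgroup.one_closed[OF H], of 1] h by simp
    show "subgroup K G"
    proof (rule subgroupI)
      show "K \<subseteq> carrier G" using H_sub hp by (auto simp: K_def)
      show "K \<noteq> {}" using KI[OF subgroup.one_closed[OF H]] by blast
      fix a assume "a \<in> K"
      then obtain m and i :: nat where a: "a = m \<otimes> h [^] i" "m \<in> H" by (auto simp: K_def)
      have mc: "m \<in> carrier G" using a H_sub by simp
      \<comment> \<open>\<open>i + j\<close> is a multiple of the order of \<open>h\<close>, so
        \<open>h [^] j\<close> is the inverse of \<open>h [^] i\<close> with a natural
        exponent.\<close>
      define j where "j = i * (ord h - 1)"
      have "i + j = ord h * i" using ordh(1) by (cases "ord h") (auto simp: j_def)
      then have hij: "h [^] i \<otimes> h [^] j = \<one>" using h ordh(2)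
        by (simp add: nat_pow_mult) (simp add: nat_pow_pow[symmetric])
      then have "inv (h [^] i) = h [^] j" using h inv_equality[of "h [^] j" "h [^] i"]
        by (metis hp inv_comm)
      then have "inv a = h [^] j \<otimes> inv m" using a mc h by (simp add: inv_mult_group)
      also have "\<dots> = (h [^] j \<otimes> inv m \<otimes> inv (h [^] j)) \<otimes> h [^] j" using mc hp by (simp add: m_assoc)
      finally show "inv a \<in> K" using KI[OF norm[OF hp Hi[OF a(2)]]] by simp
      fix b assume "b \<in> K"
      then obtain m' and k :: nat where b: "b = m' \<otimes> h [^] k" "m' \<in> H" by (auto simp: K_def)
      show "a \<otimes> b \<in> K" unfolding a(1) b(1) prod[OF a(2) b(2)] by (intro KI Hm a(2) norm hp b(2))
    qed
  qed
  define X where "X g = (let (m,i) = (SOME (m,i). m \<in> H \<and> g = m \<otimes> h [^] (i::nat)) in Z m * L ^\<^sub>m i)" for g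
  have X: "X (m \<otimes> h [^] i) = Z m * L ^\<^sub>m i" if m: "m \<in> H" for m and i :: nat
  proof -
    obtain m' j where s: "(SOME (m',j). m' \<in> H \<and> m \<otimes> h [^] i = m' \<otimes> h [^] (j::nat)) = (m',j)"
      by (rule prod.exhaust)
    have "case (m',j) of (m',j) \<Rightarrow> m' \<in> H \<and> m \<otimes> h [^] i = m' \<otimes> h [^] (j::nat)"
      unfolding s[symmetric] by (rule someI[of _ "(m,i)"]) (use m in simp)
    then have j: "m' \<in> H" "m \<otimes> h [^] i = m' \<otimes> h [^] j" by auto
    have "X (m \<otimes> h [^] i) = Z m' * L ^\<^sub>m j" unfolding X_def s by simp
    also have "\<dots> = Z m * L ^\<^sub>m i"
      using wd[OF m j(1) j(2)] wd[OF j(1) m j(2)[symmetric]] by (metis nat_le_linear)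
    finally show ?thesis .
  qed
  have XH: "X m = Z m" if m: "m \<in> H" for m using X[OF m, of 0] L Z_D(2)[OF m] H_sub[OF m] by simp
  have "representation G n X" unfolding representation_def
  proof (intro conjI ballI)
    show "n > 0" by (rule Z_D(1))
    show "X \<one> = 1\<^sub>m n" using XH[OF subgroup.one_closed[OF H]] Z_D(3) by simp
    fix a assume "a \<in> carrier G"
    then have "a \<in> K" using Kall by simp
    then obtain m and i :: nat where a: "a = m \<otimes> h [^] i" "m \<in> H" by (auto simp: K_def)
    show "X a \<in> carrier_mat n n" unfolding a(1) X[OF a(2)] using Z_D(2)[OF a(2)] Lcar by simp
    fix b assume "b \<in> carrier G"
    then have "b \<in> K" using Kall by simp
    then obtain m' and j :: nat where b: "b = m' \<otimes> h [^] j" "m' \<in> H" by (auto simp: K_def)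
    let ?m = "h [^] i \<otimes> m' \<otimes> inv (h [^] i)"
    have m: "?m \<in> H" by (rule norm[OF hp b(2)])
    have "X (a \<otimes> b) = Z (m \<otimes> ?m) * L ^\<^sub>m (i + j)"
      unfolding a(1) b(1) prod[OF a(2) b(2)] by (rule X[OF Hm[OF a(2) m]])
    also have "\<dots> = Z m * (Z ?m * L ^\<^sub>m i) * L ^\<^sub>m j"
      unfolding Z_D(4)[OF a(2) m] Ladd
      using Z_D(2)[OF a(2)] Z_D(2)[OF m] Lcar[of i] Lcar[of j] by (simp add: assoc_mult_mat[of _ n n _ n _ n])
    also have "Z ?m * L ^\<^sub>m i = L ^\<^sub>m i * Z m'" by (rule comm[OF L Lc b(2), symmetric])
    also have "Z m * (L ^\<^sub>m i * Z m') * L ^\<^sub>m j = X a * X b"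
      unfolding a(1) b(1) X[OF a(2)] X[OF b(2)]
      using Z_D(2)[OF a(2)] Z_D(2)[OF b(2)] Lcar[of i] Lcar[of j] by (simp add: assoc_mult_mat[of _ n n _ n _ n])
    finally show "X (a \<otimes> b) = X a * X b" .
  qed
  then show ?thesis using XH by blast
qed

end

section \<open>Solvability\<close>

text \<open>A perfect subgroup is generated by its commutators, so they alone need to be
  tested.\<close>

lemma (in group) perfect_subset:
  assumes "derived G S = S" "subgroup K G" "\<And>a b. a \<in> S \<Longrightarrow> b \<in> S \<Longrightarrow> a \<otimes> b \<otimes> inv a \<otimes> inv b \<in> K"
  shows "S \<subseteq> K"
proof -
  have "derived G S \<subseteq> K" unfolding derived_def
    by (rule generate_subgroup_incl[OF _ assms(2)]) (use assms(3) in auto)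
  then show ?thesis using assms(1) by simp
qed

text \<open>Matrices of degree one commute, so the representation is 1 on commutators.\<close>

lemma (in group) perfect_trivial_degree_one:
  assumes S: "subgroup S G" "derived G S = S" "S \<subseteq> H" and H: "subgroup H G"
    and Z: "representation (G\<lparr>carrier := H\<rparr>) 1 (Z :: 'a \<Rightarrow> 'k::field mat)" and s: "s \<in> S"
  shows "Z s = 1\<^sub>m 1"
proof -
  have D: "\<And>g. g \<in> H \<Longrightarrow> Z g \<in> carrier_mat 1 1" "Z \<one> = 1\<^sub>m 1"
    "\<And>g h. g \<in> H \<Longrightarrow> h \<in> H \<Longrightarrow> Z (g \<otimes> h) = Z g * Z h"
    using representationD[OF Z] by auto
  have Sc: "a \<in> carrier G" if "a \<in> S" for a using subgroup.subset[OF S(1)] that by blast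
  have SH: "a \<in> H" if "a \<in> S" for a using S(3) that by blast
  have Hm: "a \<otimes> b \<in> H" if "a \<in> H" "b \<in> H" for a b using subgroup.m_closed[OF H that] .
  have Hi: "inv a \<in> H" if "a \<in> H" for a using subgroup.m_inv_closed[OF H that] .
  define f where "f g = Z g $$ (0,0)" for g
  have fm: "f (a \<otimes> b) = f a * f b" if "a \<in> H" "b \<in> H" for a b
    using mult_mat_index[OF D(1)[OF that(1)] D(1)[OF that(2)], of 0 0] D(3)[OF that] by (simp add: f_def)
  have f1: "f \<one> = 1" using D(2) by (simp add: f_def)
  have fi: "f (inv a) * f a = 1" if "a \<in> H" for a
    using fm[OF Hi[OF that] that] f1 that subgroup.subset[OF H] by (metis l_inv subsetD)
  have fe: "Z a = 1\<^sub>m 1 \<longleftrightarrow> f a = 1" if "a \<in> H" for a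
    using D(1)[OF that] by (auto simp: f_def intro!: eq_matI)
  define K where "K = {a \<in> S. f a = 1}"
  have "S \<subseteq> K"
  proof (rule perfect_subset[OF S(2)])
    show "subgroup K G"
    proof (rule subgroupI)
      show "K \<subseteq> carrier G" using Sc by (auto simp: K_def)
      show "K \<noteq> {}" using subgroup.one_closed[OF S(1)] f1 by (auto simp: K_def)
      fix a assume a: "a \<in> K"
      then show "inv a \<in> K" using fi[of a] SH subgroup.m_inv_closed[OF S(1)] by (auto simp: K_def)
      fix b assume "b \<in> K"
      then show "a \<otimes> b \<in> K" using a fm[of a b] SH subgroup.m_closed[OF S(1)] by (auto simp: K_def)
    qed
    fix a b assume ab: "a \<in> S" "b \<in> S"
    have "f (a \<otimes> b \<otimes> inv a \<otimes> inv b) = (f (inv a) * f a) * (f (inv b) * f b)"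
      using fm Hm Hi SH[OF ab(1)] SH[OF ab(2)] by (simp add: mult_ac)
    then have "f (a \<otimes> b \<otimes> inv a \<otimes> inv b) = 1" using fi SH ab by simp
    moreover have "a \<otimes> b \<otimes> inv a \<otimes> inv b \<in> S"
      using ab by (intro subgroup.m_closed[OF S(1)] subgroup.m_inv_closed[OF S(1)])
    ultimately show "a \<otimes> b \<otimes> inv a \<otimes> inv b \<in> K" by (simp add: K_def)
  qed
  then show ?thesis using fe SH s by (auto simp: K_def)
qed

text \<open>The upper right block is additive on \<open>S\<close>, so it vanishes on commutators.\<close>

lemma perfect_trivial_on_blocks:
  fixes G (structure)
  assumes G: "group G" and S: "subgroup S G" "derived G S = S" and V: "representation G n (V :: 'a \<Rightarrow> 'k::field mat)"
    and b: "block_rep G n V r P Q"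
    and 1: "\<And>s. s \<in> S \<Longrightarrow> ul r (Q * V s * P) = 1\<^sub>m r" "\<And>s. s \<in> S \<Longrightarrow> lr r (Q * V s * P) = 1\<^sub>m (n - r)"
    and s: "s \<in> S"
  shows "V s = 1\<^sub>m n"
proof -
  interpret group G by fact
  from b have r: "0 < r" "r < n" and inv: "mat_inv n P Q" and
    bu: "\<And>g. g \<in> carrier G \<Longrightarrow> block_ut r (Q * V g * P)" by (auto simp: block_rep_def)
  note I = mat_invD[OF inv] and DV = representationD[OF V]
  define M where "M g = Q * V g * P" for g
  have Mc: "M g \<in> carrier_mat n n" if "g \<in> carrier G" for g
    using block_rep_parts(3)[OF G V b that] by (simp add: M_def)
  have Mm: "M (g \<otimes> h) = M g * M h" if "g \<in> carrier G" "h \<in> carrier G" for g h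
    using block_rep_parts(4)[OF G V b that] by (simp add: M_def)
  have Sc: "a \<in> carrier G" if "a \<in> S" for a using subgroup.subset[OF S(1)] that by blast
  have rn: "r \<le> n" using r by simp
  have bc: "ur r (M g) \<in> carrier_mat r (n - r)" if "g \<in> carrier G" for g using block_carrier(2)[OF Mc[OF that]] .
  have um: "ur r (M (g \<otimes> h)) = ur r (M h) + ur r (M g)" if g: "g \<in> S" and h: "h \<in> S" for g h
    using block_ut_mult(3)[OF Mc[OF Sc[OF g]] Mc[OF Sc[OF h]] rn] bu[OF Sc[OF g]] bu[OF Sc[OF h]]
      1(1)[OF g] 1(2)[OF h] Mm[OF Sc[OF g] Sc[OF h]] bc[OF Sc[OF g]] bc[OF Sc[OF h]] by (simp add: M_def)
  define f where "f i j g = ur r (M g) $$ (i,j)" for i j g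
  have fm: "f i j (g \<otimes> h) = f i j g + f i j h" if "i < r" "j < n - r" "g \<in> S" "h \<in> S" for i j g h
    using um[OF that(3,4)] bc[OF Sc[OF that(3)]] bc[OF Sc[OF that(4)]] that(1,2) by (simp add: f_def)
  have f1: "f i j \<one> = 0" if "i < r" "j < n - r" for i j
    using fm[OF that subgroup.one_closed[OF S(1)] subgroup.one_closed[OF S(1)]]
    by (metis add_cancel_right_right r_one one_closed)
  have fi: "f i j (inv a) = - f i j a" if ij: "i < r" "j < n - r" and a: "a \<in> S" for i j a
    using fm[OF ij subgroup.m_inv_closed[OF S(1) a] a] f1[OF ij] Sc[OF a] by (simp add: eq_neg_iff_add_eq_0)
  define K where "K = {a \<in> S. \<forall>i<r. \<forall>j<n-r. f i j a = 0}"
  have "S \<subseteq> K"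
  proof (rule perfect_subset[OF S(2)])
    show "subgroup K G"
    proof (rule subgroupI)
      show "K \<subseteq> carrier G" using Sc by (auto simp: K_def)
      show "K \<noteq> {}" using subgroup.one_closed[OF S(1)] f1 by (auto simp: K_def)
      fix a assume a: "a \<in> K"
      then show "inv a \<in> K" using fi subgroup.m_inv_closed[OF S(1)] by (auto simp: K_def)
      fix b assume "b \<in> K"
      then show "a \<otimes> b \<in> K" using a fm subgroup.m_closed[OF S(1)] by (auto simp: K_def)
    qed
    fix a b assume ab: "a \<in> S" "b \<in> S"
    have cl: "a \<otimes> b \<in> S" "a \<otimes> b \<otimes> inv a \<in> S" "a \<otimes> b \<otimes> inv a \<otimes> inv b \<in> S" "inv a \<in> S" "inv b \<in> S"
      using ab by (auto intro!: subgroup.m_closed[OF S(1)] subgroup.m_inv_closed[OF S(1)])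
    have "f i j (a \<otimes> b \<otimes> inv a \<otimes> inv b) = 0" if "i < r" "j < n - r" for i j
      using fm[OF that] fi[OF that] ab cl by simp
    then show "a \<otimes> b \<otimes> inv a \<otimes> inv b \<in> K" using cl by (simp add: K_def)
  qed
  then have "f i j s = 0" if "i < r" "j < n - r" for i j using s that by (auto simp: K_def)
  then have u0: "ur r (M s) = 0\<^sub>m r (n - r)"
    using bc[OF Sc[OF s]] by (intro eq_matI) (auto simp: f_def)
  have sc: "s \<in> carrier G" by (rule Sc[OF s])
  have "M s = four_block_mat (ul r (M s)) (ur r (M s)) (0\<^sub>m (n - r) r) (lr r (M s))"
    by (rule block_ut_four_block[OF Mc[OF sc] rn]) (use bu[OF sc] in \<open>simp add: M_def\<close>)
  also have "\<dots> = four_block_mat (1\<^sub>m r) (0\<^sub>m r (n - r)) (0\<^sub>m (n - r) r) (1\<^sub>m (n - r))"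
    using u0 1[OF s] by (simp add: M_def)
  also have "\<dots> = 1\<^sub>m n" by (rule eq_matI) (use rn in auto)
  finally have "M s = 1\<^sub>m n" .
  then have "V s = P * 1\<^sub>m n * Q" using mat_inv_cancel[OF inv DV(2)[OF sc]] by (simp add: M_def)
  then show ?thesis using I by simp
qed

text \<open>Induction on the degree: the diagonal blocks of a reducible representation are smaller,
  so \<open>S\<close> acts trivially on them, and being perfect it acts trivially on the whole. The
  disjunction in the assumptions excludes exactly the irreducible representations of degree
  \<open>d\<close>, of which nothing is known.\<close>

lemma trivial_if_trivial_on_small_irreducibles:
  fixes G (structure)
  assumes G: "group G" and S: "subgroup S G" "derived G S = S"
    and small: "\<And>m (X :: 'a \<Rightarrow> 'k::field mat) s. m < d \<Longrightarrow> irreducible_representation G m X \<Longrightarrow> s \<in> S \<Longrightarrow> X s = 1\<^sub>m m"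
  shows "representation G n (V :: 'a \<Rightarrow> 'k mat) \<Longrightarrow> n \<le> d \<Longrightarrow> \<not> irreducible_representation G n V \<or> n < d \<Longrightarrow> s \<in> S \<Longrightarrow> V s = 1\<^sub>m n"
proof (induction n arbitrary: V s rule: less_induct)
  case (less n)
  show ?case
  proof (cases "irreducible_representation G n V")
    case True
    then show ?thesis using small less.prems by blast
  next
    case False
    then obtain W where W: "vsub n W" "\<forall>g\<in>carrier G. \<forall>w\<in>W. V g *\<^sub>v w \<in> W" "W \<noteq> {0\<^sub>v n}" "W \<noteq> carrier_vec n"
      using less.prems(1) unfolding irreducible_representation_iff by blast
    obtain r P Q where b: "block_rep G n V r P Q"
      using reducible_block_rep[OF less.prems(1) W(1) _ W(3,4), of thesis] W(2) by blast
    have r: "0 < r" "r < n" using b by (auto simp: block_rep_def)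
    note parts = block_rep_parts[OF G less.prems(1) b]
    show ?thesis
    proof (rule perfect_trivial_on_blocks[OF G S less.prems(1) b _ _ less.prems(4)])
      fix s assume s: "s \<in> S"
      show "ul r (Q * V s * P) = 1\<^sub>m r"
        by (rule less.IH[OF _ parts(1) _ _ s]) (use r less.prems(2) in auto)
      show "lr r (Q * V s * P) = 1\<^sub>m (n - r)"
        by (rule less.IH[OF _ parts(2) _ _ s]) (use r less.prems(2) in auto)
    qed
  qed
qed

section \<open>Taketa's argument and subgroups with abelian quotient\<close>

context brauer
begin

lemma induced_repI:
  "group G \<Longrightarrow> finite (carrier G) \<Longrightarrow> subgroup H G \<Longrightarrow> representation (G\<lparr>carrier := H\<rparr>) n Z \<Longrightarrow> induced_rep p red G H n Z"
  by (intro induced_rep.intro brauer_axioms induced_rep_axioms.intro)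

lemma linear_Brauer_representation:
  assumes "group G" "linear_Brauer p red G l"
  obtains \<Lambda> where "representation G 1 \<Lambda>" "l = afforded_brauer p red G \<Lambda>"
proof -
  from assms(2) obtain m X where X: "l = afforded_brauer p red G X" "representation G m X" "l \<one>\<^bsub>G\<^esub> = 1"
    by (auto simp: linear_Brauer_def Brauer_characters_def)
  then have "of_nat m = (1::complex)" using afforded_brauer_one[OF assms(1) X(2)] by simp
  then have "m = 1" by simp
  then show ?thesis using that X by blast
qed

lemma trivial_representation: "representation G 1 (\<lambda>_. 1\<^sub>m 1 :: 'k mat)"
  by (auto simp: representation_def)

text \<open>Taketa's argument: the perfect subgroup acts trivially on the permutation module on the
  cosets of the inducing subgroup, since the composition factors of that module have smaller degree.\<close>

lemma Mp_perfect_trivial_on_irreducibles: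
  fixes G (structure)
  assumes Mp: "Mp_group p red G" and S: "S \<lhd> G" "derived G S = S"
  shows "irreducible_representation G n (X :: 'a \<Rightarrow> 'k mat) \<Longrightarrow> s \<in> S \<Longrightarrow> X s = 1\<^sub>m n"
proof (induction n arbitrary: X s rule: less_induct)
  case (less n)
  have G: "group G" and fin: "finite (carrier G)" using Mp by (auto simp: Mp_group_def)
  interpret group G by fact
  have sS: "subgroup S G" using S(1) normal_imp_subgroup by blast
  have Sc: "a \<in> carrier G" if "a \<in> S" for a using subgroup.subset[OF sS] that by blast
  have rX: "representation G n X" using less.prems(1) by (simp add: irreducible_representation_iff)
  have "afforded_brauer p red G X \<in> IBr p red G" using less.prems(1) by (auto simp: IBr_def)
  then have "monomial_Brauer p red G (afforded_brauer p red G X)" using Mp by (auto simp: Mp_group_def)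
  then obtain H l where H: "subgroup H G" and lin: "linear_Brauer p red (G\<lparr>carrier := H\<rparr>) l"
    and ind: "induced_Brauer p G H l = afforded_brauer p red G X" by (auto simp: monomial_Brauer_def)
  obtain \<Lambda> where \<Lambda>: "representation (G\<lparr>carrier := H\<rparr>) 1 \<Lambda>" "l = afforded_brauer p red (G\<lparr>carrier := H\<rparr>) \<Lambda>"
    using linear_Brauer_representation[OF sub_group[OF H] lin] by blast
  interpret I: induced_rep p red G H 1 \<Lambda> by (rule induced_repI[OF G fin H \<Lambda>(1)])
  interpret J: induced_rep p red G H 1 "\<lambda>_. 1\<^sub>m 1" by (rule induced_repI[OF G fin H trivial_representation])
  have eq: "afforded_brauer p red G X = afforded_brauer p red G I.Ind" using I.Ind_brauer ind \<Lambda>(2) by simp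
  have deg: "n = card (I.T \<times> {..<1::nat})"
  proof -
    have "of_nat n = (of_nat (card (I.T \<times> {..<1::nat})) :: complex)"
      using afforded_brauer_one[OF G rX] afforded_brauer_one[OF G I.Ind_rep] eq by simp
    then show ?thesis by simp
  qed
  \<comment> \<open>If the permutation module on the cosets of \<open>H\<close> is irreducible, then
    \<open>H\<close> is the whole group. Otherwise the induction hypothesis makes \<open>S\<close>
    act trivially on it, so \<open>S\<close> fixes the coset \<open>H\<close>.\<close>
  have SH: "S \<subseteq> H"
  proof (cases "irreducible_representation G n J.Ind")
    case True
    then show ?thesis using J.trivial_Ind_irreducible Sc deg by auto
  next
    case False
    have rJ: "representation G n J.Ind" using J.Ind_rep deg by simp
    have "J.Ind a = 1\<^sub>m n" if a: "a \<in> S" for a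
      by (rule trivial_if_trivial_on_small_irreducibles[where d = n, OF G sS S(2) _ rJ order_refl _ a])
        (use less.IH False in auto)
    then show ?thesis using J.Ind_one_in_H Sc deg by auto
  qed
  have "I.Ind s = 1\<^sub>m (card (I.T \<times> {..<1::nat}))"
  proof (rule I.Ind_eq_one[OF Sc[OF less.prems(2)]])
    fix g assume g: "g \<in> carrier G"
    then have "g \<otimes> s \<otimes> inv g \<in> S" using normal.inv_op_closed2[OF S(1) g less.prems(2)] by simp
    then show "g \<otimes> s \<otimes> inv g \<in> H \<and> \<Lambda> (g \<otimes> s \<otimes> inv g) = 1\<^sub>m 1"
      using perfect_trivial_degree_one[OF sS S(2) SH H \<Lambda>(1)] SH by blast
  qed
  then show ?case
    using same_brauer_kernel[OF G fin less.prems(1) I.Ind_rep eq Sc[OF less.prems(2)]] by simp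
qed

text \<open>\<open>S\<close> is trivial on all irreducible representations, hence on the regular
  one, which is induced from the trivial subgroup and faithful. The bound is its degree plus one, so
  that irreducibility is no exception.\<close>

lemma Mp_perfect_trivial:
  fixes G (structure)
  assumes Mp: "Mp_group p red G" and S: "S \<lhd> G" "derived G S = S"
  shows "S = {\<one>}"
proof -
  have G: "group G" and fin: "finite (carrier G)" using Mp by (auto simp: Mp_group_def)
  interpret group G by fact
  have sS: "subgroup S G" using S(1) normal_imp_subgroup by blast
  have H: "subgroup {\<one>} G" by (rule triv_subgroup)
  interpret J: induced_rep p red G "{\<one>}" 1 "\<lambda>_. 1\<^sub>m 1" by (rule induced_repI[OF G fin H trivial_representation])
  have "s \<in> {\<one>}" if s: "s \<in> S" for s
  proof (rule J.Ind_one_in_H)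
    show "s \<in> carrier G" using subgroup.subset[OF sS] s by blast
    show "J.Ind s = 1\<^sub>m (card (J.T \<times> {..<1::nat}))"
      by (rule trivial_if_trivial_on_small_irreducibles[OF G sS S(2) _ J.Ind_rep, of "Suc (card (J.T \<times> {..<1::nat}))"])
        (use Mp_perfect_trivial_on_irreducibles[OF Mp S] s in auto)
  qed
  then show ?thesis using subgroup.one_closed[OF sS] by blast
qed

text \<open>A term of least cardinality in the derived series equals its successor, so it is perfect
  and normal, hence trivial.\<close>

lemma Mp_derived_series:
  fixes G (structure)
  assumes Mp: "Mp_group p red G"
  shows "\<exists>k. (derived G ^^ k) (carrier G) = {\<one>}"
proof -
  have G: "group G" and fin: "finite (carrier G)" using Mp by (auto simp: Mp_group_def)
  interpret group G by fact
  define D where "D k = (derived G ^^ k) (carrier G)" for k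
  have nor: "D k \<lhd> G" for k
    by (induction k) (auto simp: D_def normal_self derived_is_normal)
  have sD: "subgroup (D k) G" for k using nor normal_imp_subgroup by blast
  have DSuc: "D (Suc k) = derived G (D k)" for k by (simp add: D_def)
  have sub: "D (Suc k) \<subseteq> D k" for k unfolding DSuc by (rule derived_incl[OF subset_refl sD])
  have fD: "finite (D k)" for k using subgroup.subset[OF sD] fin finite_subset by blast
  obtain k where k: "\<And>j. card (D k) \<le> card (D j)"
    using ex_has_least_nat[of "\<lambda>_. True" 0 "\<lambda>k. card (D k)"] by auto
  have "D (Suc k) = D k" by (rule card_seteq[OF fD sub k])
  then have "D k = {\<one>}" using Mp_perfect_trivial[OF Mp nor] DSuc by simp
  then show ?thesis by (auto simp: D_def)
qed

text \<open>A maximal normal subgroup of a solvable group has an abelian quotient, so every subgroup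
  above it is normal and it is maximal among all subgroups. Prime index is used in this form:
  \<open>M\<close> and any element outside it generate \<open>G\<close>.\<close>

lemma Mp_maximal_normal:
  fixes G (structure)
  assumes Mp: "Mp_group p red G" and N: "N \<lhd> G" "N \<noteq> carrier G"
  obtains M where "M \<lhd> G" "N \<subseteq> M" "M \<noteq> carrier G"
    "\<And>K. subgroup K G \<Longrightarrow> M \<subseteq> K \<Longrightarrow> K = M \<or> K = carrier G"
proof -
  have G: "group G" and fin: "finite (carrier G)" using Mp by (auto simp: Mp_group_def)
  interpret group G by fact
  define \<N> where "\<N> M \<longleftrightarrow> M \<lhd> G \<and> N \<subseteq> M \<and> M \<noteq> carrier G" for M
  have "\<exists>M. \<N> M \<and> (\<forall>M'. \<N> M' \<longrightarrow> card M' \<le> card M)"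
  proof (rule ex_has_greatest_nat[of \<N> N card "Suc (card (carrier G))"])
    show "\<N> N" using N by (simp add: \<N>_def)
    show "\<forall>M. \<N> M \<longrightarrow> card M < Suc (card (carrier G))"
    proof (intro allI impI)
      fix M assume "\<N> M"
      then have "M \<subseteq> carrier G" using normal_imp_subgroup subgroup.subset unfolding \<N>_def by blast
      then show "card M < Suc (card (carrier G))" using card_mono[OF fin] by (simp add: less_Suc_eq_le)
    qed
  qed
  then obtain M where M: "M \<lhd> G" "N \<subseteq> M" "M \<noteq> carrier G" and max: "\<And>M'. \<N> M' \<Longrightarrow> card M' \<le> card M"
    by (auto simp: \<N>_def)
  have sM: "subgroup M G" using M(1) normal_imp_subgroup by blast
  have Mc: "m \<in> carrier G" if "m \<in> M" for m using subgroup.subset[OF sM] that by blast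
  have maxM: "K = M \<or> K = carrier G" if K: "K \<lhd> G" "M \<subseteq> K" for K
  proof (rule disjCI)
    assume "K \<noteq> carrier G"
    then have "card K \<le> card M" using K M(2) by (intro max) (auto simp: \<N>_def)
    moreover have "finite K" using K(1) normal_imp_subgroup subgroup.subset fin finite_subset by metis
    ultimately show "K = M" using card_seteq K(2) by blast
  qed
  have norm: "g \<otimes> m \<otimes> inv g \<in> M" if "g \<in> carrier G" "m \<in> M" for g m
    using normal.inv_op_closed2[OF M(1) that] .
  have Mm: "a \<otimes> b \<in> M" if "a \<in> M" "b \<in> M" for a b using subgroup.m_closed[OF sM that] .
  have Mi: "inv a \<in> M" if "a \<in> M" for a using subgroup.m_inv_closed[OF sM that] .
  obtain k where k: "(derived G ^^ k) (carrier G) = {\<one>}" using Mp_derived_series[OF Mp] by blast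
  define D where "D k = (derived G ^^ k) (carrier G)" for k
  have norD: "D k \<lhd> G" for k
    by (induction k) (auto simp: D_def normal_self derived_is_normal)
  have "\<not> D 0 \<subseteq> M" using M(3) subgroup.subset[OF sM] by (auto simp: D_def)
  moreover have "D k \<subseteq> M" using k subgroup.one_closed[OF sM] by (simp add: D_def)
  \<comment> \<open>The last term of the derived series outside \<open>M\<close>; by maximality its
    product with \<open>M\<close> will be the whole group.\<close>
  ultimately obtain i where i: "\<not> D i \<subseteq> M" "D (Suc i) \<subseteq> M"
    using ex_least_nat_le[of "\<lambda>k. D k \<subseteq> M" k] by (metis Suc_pred' lessI neq0_conv)
  have sD: "subgroup (D i) G" using norD normal_imp_subgroup by blast
  have Dc: "d \<in> carrier G" if "d \<in> D i" for d using subgroup.subset[OF sD] that by blast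
  have normD: "g \<otimes> d \<otimes> inv g \<in> D i" if "g \<in> carrier G" "d \<in> D i" for g d
    using normal.inv_op_closed2[OF norD that] .
  define DM where "DM = {d \<otimes> m | d m. d \<in> D i \<and> m \<in> M}"
  have DMI: "d \<otimes> m \<in> DM" if "d \<in> D i" "m \<in> M" for d m using that by (auto simp: DM_def)
  have "DM \<lhd> G" unfolding normal_inv_iff
  proof (intro conjI ballI)
    show "subgroup DM G"
    proof (rule subgroupI)
      show "DM \<subseteq> carrier G" using Dc Mc by (auto simp: DM_def)
      show "DM \<noteq> {}" using DMI[OF subgroup.one_closed[OF sD] subgroup.one_closed[OF sM]] by blast
      fix a assume "a \<in> DM"
      then obtain d m where a: "a = d \<otimes> m" "d \<in> D i" "m \<in> M" by (auto simp: DM_def)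
      have c: "d \<in> carrier G" "m \<in> carrier G" using a Dc Mc by auto
      have "inv a = inv d \<otimes> (d \<otimes> inv m \<otimes> inv d)" using a c by (simp add: inv_mult_group m_assoc inv_cancel_left)
      then show "inv a \<in> DM" using DMI[OF subgroup.m_inv_closed[OF sD a(2)] norm[OF c(1) Mi[OF a(3)]]] by simp
      fix b assume "b \<in> DM"
      then obtain e l where b: "b = e \<otimes> l" "e \<in> D i" "l \<in> M" by (auto simp: DM_def)
      have c': "e \<in> carrier G" "l \<in> carrier G" using b Dc Mc by auto
      have "a \<otimes> b = (d \<otimes> e) \<otimes> ((inv e \<otimes> m \<otimes> inv (inv e)) \<otimes> l)"
        using a b c c' by (simp add: m_assoc inv_cancel_left)
      then show "a \<otimes> b \<in> DM"
        using DMI[OF subgroup.m_closed[OF sD a(2) b(2)] Mm[OF norm[OF inv_closed[OF c'(1)] a(3)] b(3)]] by simp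
    qed
    fix x a assume x: "x \<in> carrier G" and "a \<in> DM"
    then obtain d m where a: "a = d \<otimes> m" "d \<in> D i" "m \<in> M" by (auto simp: DM_def)
    have c: "d \<in> carrier G" "m \<in> carrier G" using a Dc Mc by auto
    have "x \<otimes> a \<otimes> inv x = (x \<otimes> d \<otimes> inv x) \<otimes> (x \<otimes> m \<otimes> inv x)"
      using a c x by (simp add: m_assoc inv_cancel_left)
    then show "x \<otimes> a \<otimes> inv x \<in> DM" using DMI[OF normD[OF x a(2)] norm[OF x a(3)]] by simp
  qed
  moreover have "M \<subseteq> DM"
  proof
    fix m assume "m \<in> M"
    then show "m \<in> DM" using DMI[OF subgroup.one_closed[OF sD], of m] Mc by simp
  qed
  moreover have "D i \<subseteq> DM"
  proof
    fix d assume "d \<in> D i"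
    then show "d \<in> DM" using DMI[of d \<one>] subgroup.one_closed[OF sM] Dc by simp
  qed
  ultimately have DMall: "DM = carrier G" using maxM[of DM] i(1) by blast
  \<comment> \<open>Commuting modulo \<open>M\<close>. The relation is symmetric, multiplicative in
    the first argument, and holds when one argument is in \<open>M\<close> or both are in
    \<open>D i\<close>. Since \<open>D i\<close> and \<open>M\<close> together give
    \<open>G\<close>, it spreads to one argument and then, by symmetry, to the other.\<close>
  define C where "C a b \<longleftrightarrow> a \<otimes> b \<otimes> inv a \<otimes> inv b \<in> M" for a b
  have C_mult: "C (a \<otimes> a') b" if "C a b" "C a' b" "a \<in> carrier G" "a' \<in> carrier G" "b \<in> carrier G" for a a' b
  proof -
    have "(a \<otimes> a') \<otimes> b \<otimes> inv (a \<otimes> a') \<otimes> inv b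
      = (a \<otimes> (a' \<otimes> b \<otimes> inv a' \<otimes> inv b) \<otimes> inv a) \<otimes> (a \<otimes> b \<otimes> inv a \<otimes> inv b)"
      using that(3-5) by (simp add: m_assoc inv_cancel_left inv_mult_group)
    then show ?thesis using Mm[OF norm[OF that(3) that(2)[unfolded C_def]] that(1)[unfolded C_def]] by (simp add: C_def)
  qed
  have C_sym: "C b a" if "C a b" "a \<in> carrier G" "b \<in> carrier G" for a b
  proof -
    have "b \<otimes> a \<otimes> inv b \<otimes> inv a = inv (a \<otimes> b \<otimes> inv a \<otimes> inv b)"
      using that by (simp add: m_assoc inv_mult_group)
    then show ?thesis using Mi[OF that(1)[unfolded C_def]] by (simp add: C_def)
  qed
  have C_M: "C m b" if "m \<in> M" "b \<in> carrier G" for m b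
  proof -
    have "m \<otimes> b \<otimes> inv m \<otimes> inv b = m \<otimes> (b \<otimes> inv m \<otimes> inv b)" using that Mc by (simp add: m_assoc)
    then show ?thesis using Mm[OF that(1) norm[OF that(2) Mi[OF that(1)]]] by (simp add: C_def)
  qed
  have C_D: "C d e" if "d \<in> D i" "e \<in> D i" for d e
  proof -
    have "d \<otimes> e \<otimes> inv d \<otimes> inv e \<in> derived_set G (D i)" using that by auto
    then have "d \<otimes> e \<otimes> inv d \<otimes> inv e \<in> derived G (D i)" unfolding derived_def by (rule generate.incl)
    then show ?thesis using i(2) by (auto simp: C_def D_def)
  qed
  have C_GD: "C g e" if g: "g \<in> carrier G" and e: "e \<in> D i" for g e
  proof -
    have "g \<in> DM" using g DMall by simp
    then obtain d m where "g = d \<otimes> m" "d \<in> D i" "m \<in> M" by (auto simp: DM_def)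
    then show ?thesis using C_mult[OF C_D C_M] e Dc Mc by simp
  qed
  have C_GG: "C a b" if a: "a \<in> carrier G" and b: "b \<in> carrier G" for a b
  proof -
    have "a \<in> DM" using a DMall by simp
    then obtain d m where dm: "a = d \<otimes> m" "d \<in> D i" "m \<in> M" by (auto simp: DM_def)
    have "C d b" by (rule C_sym[OF C_GD[OF b dm(2)] b Dc[OF dm(2)]])
    then show ?thesis unfolding dm(1) using C_mult[OF _ C_M[OF dm(3) b]] dm Dc Mc b by simp
  qed
  have "K = M \<or> K = carrier G" if K: "subgroup K G" "M \<subseteq> K" for K
  proof (rule maxM[OF _ K(2)])
    show "K \<lhd> G" unfolding normal_inv_iff
    proof (intro conjI K(1) ballI)
      fix x h assume x: "x \<in> carrier G" and h: "h \<in> K"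
      have hc: "h \<in> carrier G" using subgroup.subset[OF K(1)] h by blast
      have "x \<otimes> h \<otimes> inv x \<otimes> inv h \<in> K" using C_GG[OF x hc] K(2) by (auto simp: C_def)
      then have "(x \<otimes> h \<otimes> inv x \<otimes> inv h) \<otimes> h \<in> K" using h by (rule subgroup.m_closed[OF K(1)])
      then show "x \<otimes> h \<otimes> inv x \<in> K" using x hc by (simp add: m_assoc)
    qed
  qed
  then show ?thesis using that M by blast
qed

end

section \<open>Induction of class functions\<close>

text \<open>For each \<open>z\<close> in \<open>M\<close> the substitution \<open>y\<close> to
  \<open>z \<otimes> y\<close> leaves the sum over \<open>G\<close> unchanged, which produces a
  factor \<open>card M\<close>. Elements \<open>y\<close> whose conjugate of \<open>x\<close> falls
  outside \<open>M\<close> contribute nothing because \<open>U\<close> lies in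
  \<open>M\<close>.\<close>

lemma (in group) induced_Brauer_trans:
  assumes fin: "finite (carrier G)" and M: "subgroup M G" and U: "subgroup U G" "U \<subseteq> M"
  shows "induced_Brauer p G M (induced_Brauer p (G\<lparr>carrier := M\<rparr>) U \<psi>) = induced_Brauer p G U \<psi>"
proof
  fix x
  let ?GM = "G\<lparr>carrier := M\<rparr>"
  have Mc: "m \<in> carrier G" if "m \<in> M" for m using subgroup.subset[OF M] that by blast
  have fM: "finite M" using subgroup.subset[OF M] fin finite_subset by blast
  have cM: "card M > 0" using fM subgroup.one_closed[OF M] by (auto simp: card_gt_0_iff)
  show "induced_Brauer p G M (induced_Brauer p ?GM U \<psi>) x = induced_Brauer p G U \<psi> x"
  proof (cases "x \<in> p_regular p G")
    case True
    then have x: "x \<in> carrier G" by (simp add: p_regular_def)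
    let ?c = "\<lambda>y. y \<otimes> x \<otimes> inv y"
    let ?f = "\<lambda>w. if ?c w \<in> U then \<psi> (?c w) else 0"
    have conj: "z \<otimes> ?c y \<otimes> inv z = ?c (z \<otimes> y)" if "z \<in> carrier G" "y \<in> carrier G" for y z
      using that x by (simp add: m_assoc inv_mult_group)
    have inner: "(if ?c y \<in> M then induced_Brauer p ?GM U \<psi> (?c y) else 0) = (\<Sum>z\<in>M. ?f (z \<otimes> y)) / of_nat (card U)"
      if y: "y \<in> carrier G" for y
    proof (cases "?c y \<in> M")
      case c: True
      have "?c y \<in> p_regular p ?GM" using conj_p_regular[OF fin y True] sub_p_regular[OF M fin] c by blast
      then have "induced_Brauer p ?GM U \<psi> (?c y) =
         (\<Sum>z\<in>{z \<in> M. z \<otimes> ?c y \<otimes> inv\<^bsub>?GM\<^esub> z \<in> U}. \<psi> (z \<otimes> ?c y \<otimes> inv\<^bsub>?GM\<^esub> z)) / of_nat (card U)"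
        by (simp add: induced_Brauer_def)
      also have "(\<Sum>z\<in>{z \<in> M. z \<otimes> ?c y \<otimes> inv\<^bsub>?GM\<^esub> z \<in> U}. \<psi> (z \<otimes> ?c y \<otimes> inv\<^bsub>?GM\<^esub> z))
        = (\<Sum>z\<in>{z \<in> M. ?c (z \<otimes> y) \<in> U}. \<psi> (?c (z \<otimes> y)))"
        using sub_inv[OF M] conj[OF Mc y] by (intro sum.cong) auto
      also have "\<dots> = (\<Sum>z\<in>M. ?f (z \<otimes> y))" by (rule sum.inter_filter[OF fM])
      finally show ?thesis using c by simp
    next
      case False
      have "?c (z \<otimes> y) \<notin> U" if z: "z \<in> M" for z
      proof
        assume "?c (z \<otimes> y) \<in> U"
        then have "z \<otimes> ?c y \<otimes> inv z \<in> M" using conj[OF Mc[OF z] y] U(2) by auto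
        then have "inv z \<otimes> (z \<otimes> ?c y \<otimes> inv z) \<otimes> z \<in> M"
          using z subgroup.m_closed[OF M] subgroup.m_inv_closed[OF M] by blast
        moreover have "inv z \<otimes> (z \<otimes> ?c y \<otimes> inv z) \<otimes> z = ?c y"
          using Mc[OF z] y x by (simp add: m_assoc inv_cancel_left)
        ultimately show False using False by simp
      qed
      then show ?thesis using False by simp
    qed
    have "(\<Sum>y\<in>{y \<in> carrier G. ?c y \<in> M}. induced_Brauer p ?GM U \<psi> (?c y))
      = (\<Sum>y\<in>carrier G. if ?c y \<in> M then induced_Brauer p ?GM U \<psi> (?c y) else 0)"
      by (rule sum.inter_filter[OF fin])
    also have "\<dots> = (\<Sum>y\<in>carrier G. (\<Sum>z\<in>M. ?f (z \<otimes> y)) / of_nat (card U))"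
      by (rule sum.cong[OF refl inner])
    also have "\<dots> = (\<Sum>z\<in>M. \<Sum>y\<in>carrier G. ?f (z \<otimes> y)) / of_nat (card U)"
      unfolding sum_divide_distrib[symmetric] by (subst sum.swap) (rule refl)
    also have "(\<Sum>z\<in>M. \<Sum>y\<in>carrier G. ?f (z \<otimes> y)) = (\<Sum>z\<in>M. sum ?f (carrier G))"
    proof (rule sum.cong[OF refl])
      fix z assume "z \<in> M"
      then have z: "z \<in> carrier G" by (rule Mc)
      show "(\<Sum>y\<in>carrier G. ?f (z \<otimes> y)) = sum ?f (carrier G)"
        by (rule sum.reindex_bij_witness[of _ "\<lambda>y. inv z \<otimes> y" "\<lambda>y. z \<otimes> y"])
          (use z in \<open>auto simp: inv_cancel_left\<close>)
    qed
    also have "\<dots> = of_nat (card M) * (\<Sum>y\<in>{y \<in> carrier G. ?c y \<in> U}. \<psi> (?c y))"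
      by (simp add: sum.inter_filter[OF fin])
    finally show ?thesis using True cM by (simp add: induced_Brauer_def)
  next
    case False
    then show ?thesis by (simp add: induced_Brauer_def)
  qed
qed

text \<open>Mackey's formula for a single double coset. Every group element is a product
  \<open>h \<otimes> m\<close> in \<open>card (H \<inter> M)\<close> ways, and the summand does not
  depend on \<open>h\<close>, so the sums over \<open>M\<close> and over \<open>G\<close> are
  proportional.\<close>

lemma (in group) induced_Brauer_restrict:
  assumes fin: "finite (carrier G)" and M: "subgroup M G" and H: "subgroup H G"
    and HM: "\<And>g. g \<in> carrier G \<Longrightarrow> \<exists>h\<in>H. \<exists>m\<in>M. g = h \<otimes> m"
    and cl: "\<And>h u. h \<in> H \<Longrightarrow> u \<in> H \<Longrightarrow> \<psi> (h \<otimes> u \<otimes> inv h) = \<psi> u"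
    and x: "x \<in> M"
  shows "induced_Brauer p G H \<psi> x = induced_Brauer p (G\<lparr>carrier := M\<rparr>) (H \<inter> M) (\<lambda>u. if u \<in> H \<inter> M then \<psi> u else 0) x"
proof (cases "x \<in> p_regular p G")
  case True
  have xc: "x \<in> carrier G" using True by (simp add: p_regular_def)
  have Mc: "m \<in> carrier G" if "m \<in> M" for m using subgroup.subset[OF M] that by blast
  have Hc: "m \<in> carrier G" if "m \<in> H" for m using subgroup.subset[OF H] that by blast
  have fM: "finite M" using subgroup.subset[OF M] fin finite_subset by blast
  have fH: "finite H" using subgroup.subset[OF H] fin finite_subset by blast
  let ?c = "\<lambda>y. y \<otimes> x \<otimes> inv y"
  let ?f = "\<lambda>w. if ?c w \<in> H then \<psi> (?c w) else 0"
  have sHM: "subgroup (H \<inter> M) G" by (rule subgroups_Inter_pair[OF H M])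
  have cHM: "card (H \<inter> M) > 0" using fM subgroup.one_closed[OF sHM] by (auto simp: card_gt_0_iff)
  have cH: "card H > 0" using fH subgroup.one_closed[OF H] by (auto simp: card_gt_0_iff)
  have f_eq: "?f (h \<otimes> m) = ?f m" if h: "h \<in> H" and m: "m \<in> carrier G" for h m
  proof -
    have hc: "h \<in> carrier G" by (rule Hc[OF h])
    have e: "?c (h \<otimes> m) = h \<otimes> ?c m \<otimes> inv h" using hc m xc by (simp add: m_assoc inv_mult_group)
    have "h \<otimes> ?c m \<otimes> inv h \<in> H \<longleftrightarrow> ?c m \<in> H"
    proof
      assume "h \<otimes> ?c m \<otimes> inv h \<in> H"
      then have "inv h \<otimes> (h \<otimes> ?c m \<otimes> inv h) \<otimes> h \<in> H"
        using h subgroup.m_closed[OF H] subgroup.m_inv_closed[OF H] by blast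
      moreover have "inv h \<otimes> (h \<otimes> ?c m \<otimes> inv h) \<otimes> h = ?c m"
        using hc m xc by (simp add: m_assoc inv_cancel_left)
      ultimately show "?c m \<in> H" by simp
    next
      assume "?c m \<in> H"
      then show "h \<otimes> ?c m \<otimes> inv h \<in> H"
        using h subgroup.m_closed[OF H] subgroup.m_inv_closed[OF H] by blast
    qed
    then show ?thesis unfolding e using cl[OF h, of "?c m"] by simp
  qed
  have fib: "card {(h,m) \<in> H \<times> M. h \<otimes> m = y} = card (H \<inter> M)" if y: "y \<in> carrier G" for y
  proof -
    obtain h0 m0 where h0: "h0 \<in> H" "m0 \<in> M" "y = h0 \<otimes> m0" using HM[OF y] by blast
    have c0: "h0 \<in> carrier G" "m0 \<in> carrier G" using h0 Hc Mc by auto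
    \<comment> \<open>All factorisations of \<open>y\<close> arise from one of them by moving an
      element of \<open>H \<inter> M\<close> from one factor to the other.\<close>
    have "bij_betw (\<lambda>u. (h0 \<otimes> u, inv u \<otimes> m0)) (H \<inter> M) {(h,m) \<in> H \<times> M. h \<otimes> m = y}"
    proof (rule bij_betwI[of _ _ _ "\<lambda>(h,m). inv h0 \<otimes> h"])
      show "(\<lambda>u. (h0 \<otimes> u, inv u \<otimes> m0)) \<in> H \<inter> M \<rightarrow> {(h,m) \<in> H \<times> M. h \<otimes> m = y}"
        using h0 c0 Hc subgroup.m_closed[OF H] subgroup.m_closed[OF M] subgroup.m_inv_closed[OF M]
        by (auto simp: m_assoc inv_cancel_left)
      show "(\<lambda>(h,m). inv h0 \<otimes> h) \<in> {(h,m) \<in> H \<times> M. h \<otimes> m = y} \<rightarrow> H \<inter> M"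
      proof (rule funcsetI)
        fix a assume "a \<in> {(h,m) \<in> H \<times> M. h \<otimes> m = y}"
        then obtain h m where a: "a = (h,m)" and hm: "h \<in> H" "m \<in> M" "h \<otimes> m = y" by auto
        have c: "h \<in> carrier G" "m \<in> carrier G" using hm Hc Mc by auto
        have "inv h0 \<otimes> (h \<otimes> m) = m0" using hm h0 c0 by (simp add: inv_cancel_left)
        then have "(inv h0 \<otimes> h) \<otimes> m = m0" using c0 c by (simp add: m_assoc)
        then have "inv h0 \<otimes> h = m0 \<otimes> inv m" using c c0 by (metis inv_closed inv_solve_right m_closed)
        then have "inv h0 \<otimes> h \<in> M" using subgroup.m_closed[OF M h0(2) subgroup.m_inv_closed[OF M hm(2)]] by simp
        then show "(case a of (h,m) \<Rightarrow> inv h0 \<otimes> h) \<in> H \<inter> M"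
          using subgroup.m_closed[OF H subgroup.m_inv_closed[OF H h0(1)] hm(1)] a by simp
      qed
      fix u assume "u \<in> H \<inter> M"
      then show "(\<lambda>(h,m). inv h0 \<otimes> h) (h0 \<otimes> u, inv u \<otimes> m0) = u" using Hc c0 by (simp add: inv_cancel_left)
    next
      fix a assume "a \<in> {(h,m) \<in> H \<times> M. h \<otimes> m = y}"
      then obtain h m where a: "a = (h,m)" "h \<in> H" "m \<in> M" "h \<otimes> m = y" by auto
      have c: "h \<in> carrier G" "m \<in> carrier G" using a Hc Mc by auto
      have "inv (inv h0 \<otimes> h) \<otimes> m0 = inv h \<otimes> y" using c c0 h0 by (simp add: inv_mult_group m_assoc)
      also have "\<dots> = m" using a c by (metis inv_cancel_left(1))
      finally show "(\<lambda>u. (h0 \<otimes> u, inv u \<otimes> m0)) ((\<lambda>(h,m). inv h0 \<otimes> h) a) = a"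
        using a c c0 by (simp add: inv_cancel_left)
    qed
    from bij_betw_same_card[OF this] show ?thesis by (rule sym)
  qed
  have "of_nat (card H) * sum ?f M = (\<Sum>h\<in>H. \<Sum>m\<in>M. ?f (h \<otimes> m))"
    using f_eq Mc by (simp del: sum.If_cases)
  also have "\<dots> = (\<Sum>a\<in>H \<times> M. ?f (fst a \<otimes> snd a))" by (simp add: sum.cartesian_product case_prod_unfold)
  also have "\<dots> = (\<Sum>y\<in>carrier G. \<Sum>a\<in>{a \<in> H \<times> M. fst a \<otimes> snd a = y}. ?f (fst a \<otimes> snd a))"
    by (rule sum.group[symmetric]) (use fin fH fM Hc Mc in auto)
  also have "\<dots> = (\<Sum>y\<in>carrier G. of_nat (card (H \<inter> M)) * ?f y)"
  proof (rule sum.cong[OF refl])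
    fix y assume y: "y \<in> carrier G"
    have "(\<Sum>a\<in>{a \<in> H \<times> M. fst a \<otimes> snd a = y}. ?f (fst a \<otimes> snd a)) = (\<Sum>a\<in>{a \<in> H \<times> M. fst a \<otimes> snd a = y}. ?f y)"
      by (rule sum.cong) auto
    also have "\<dots> = of_nat (card {a \<in> H \<times> M. fst a \<otimes> snd a = y}) * ?f y" by (rule sum_constant)
    also have "card {a \<in> H \<times> M. fst a \<otimes> snd a = y} = card (H \<inter> M)"
    proof -
      have "{a \<in> H \<times> M. fst a \<otimes> snd a = y} = {(h,m) \<in> H \<times> M. h \<otimes> m = y}" by auto
      then show ?thesis using fib[OF y] by (simp only:)
    qed
    finally show "(\<Sum>a\<in>{a \<in> H \<times> M. fst a \<otimes> snd a = y}. ?f (fst a \<otimes> snd a)) = of_nat (card (H \<inter> M)) * ?f y" .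
  qed
  also have "\<dots> = of_nat (card (H \<inter> M)) * sum ?f (carrier G)" by (rule sum_distrib_left[symmetric])
  finally have key: "of_nat (card H) * sum ?f M = of_nat (card (H \<inter> M)) * sum ?f (carrier G)" .
  let ?GM = "G\<lparr>carrier := M\<rparr>"
  let ?g = "\<lambda>u. if u \<in> H \<inter> M then \<psi> u else 0"
  have xM: "x \<in> p_regular p ?GM" using True x sub_p_regular[OF M fin] by blast
  have "(\<Sum>y\<in>{y \<in> carrier ?GM. y \<otimes>\<^bsub>?GM\<^esub> x \<otimes>\<^bsub>?GM\<^esub> inv\<^bsub>?GM\<^esub> y \<in> H \<inter> M}. ?g (y \<otimes>\<^bsub>?GM\<^esub> x \<otimes>\<^bsub>?GM\<^esub> inv\<^bsub>?GM\<^esub> y))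
    = (\<Sum>y\<in>{y \<in> M. ?c y \<in> H}. \<psi> (?c y))"
  proof (rule sum.cong)
    have cM: "?c y \<in> M" if "y \<in> M" for y using that x subgroup.m_closed[OF M] subgroup.m_inv_closed[OF M] by blast
    show "{y \<in> carrier ?GM. y \<otimes>\<^bsub>?GM\<^esub> x \<otimes>\<^bsub>?GM\<^esub> inv\<^bsub>?GM\<^esub> y \<in> H \<inter> M} = {y \<in> M. ?c y \<in> H}"
      using sub_inv[OF M] cM by auto
    fix y assume "y \<in> {y \<in> M. ?c y \<in> H}"
    then show "?g (y \<otimes>\<^bsub>?GM\<^esub> x \<otimes>\<^bsub>?GM\<^esub> inv\<^bsub>?GM\<^esub> y) = \<psi> (?c y)" using sub_inv[OF M] cM by auto
  qed
  also have "\<dots> = sum ?f M" by (rule sum.inter_filter[OF fM])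
  finally have "induced_Brauer p ?GM (H \<inter> M) ?g x = sum ?f M / of_nat (card (H \<inter> M))"
    using xM by (simp add: induced_Brauer_def)
  moreover have "induced_Brauer p G H \<psi> x = sum ?f (carrier G) / of_nat (card H)"
    using True by (simp add: induced_Brauer_def sum.inter_filter[OF fin])
  moreover have "sum ?f M / of_nat (card (H \<inter> M)) = sum ?f (carrier G) / of_nat (card H)"
    using key cH cHM by (simp add: frac_eq_eq mult.commute)
  ultimately show ?thesis by (simp only:)
next
  case False
  then show ?thesis using sub_p_regular[OF M fin] by (auto simp: induced_Brauer_def)
qed

section \<open>Passing to a maximal normal subgroup\<close>

context brauer
begin

text \<open>The conclusion of the assumption on the level of characters, for an arbitrary element
  type; it is obtained through an isomorphic copy on natural numbers.\<close>

definition super_monomial_group :: "('a, 'b) monoid_scheme \<Rightarrow> bool" where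
  "super_monomial_group G \<longleftrightarrow> (\<forall>\<phi>\<in>IBr p red G. super_monomial_Brauer p red G \<phi>)"

text \<open>Among the subgroups from which the character is induced, one of least cardinality is
  taken. Its inducing character is irreducible because the induced one is, and transitivity of
  induction turns any further descent into a contradiction to minimality.\<close>

lemma exists_inducing_primitive:
  fixes M (structure)
  assumes M: "group M" and fin: "finite (carrier M)" and Y: "irreducible_representation M n Y"
  obtains U \<psi> where "subgroup U M" "primitive_Brauer p red (M\<lparr>carrier := U\<rparr>) \<psi>"
    "induced_Brauer p M U \<psi> = afforded_brauer p red M Y"
proof -
  interpret group M by fact
  have rY: "representation M n Y" using Y by (simp add: irreducible_representation_iff)
  let ?\<theta> = "afforded_brauer p red M Y"
  define R where "R U \<longleftrightarrow> subgroup U M \<and> (\<exists>\<psi>\<in>Brauer_characters p red (M\<lparr>carrier := U\<rparr>). induced_Brauer p M U \<psi> = ?\<theta>)" for U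
  have R0: "R (carrier M)"
  proof -
    have rep: "representation (M\<lparr>carrier := carrier M\<rparr>) n Y" using representation_restrict[OF subgroup_self rY] .
    have "induced_Brauer p M (carrier M) ?\<theta> = ?\<theta>"
    proof
      fix x
      show "induced_Brauer p M (carrier M) ?\<theta> x = ?\<theta> x"
      proof (cases "x \<in> p_regular p M")
        case True
        then have x: "x \<in> carrier M" by (simp add: p_regular_def)
        have "{y \<in> carrier M. y \<otimes> x \<otimes> inv y \<in> carrier M} = carrier M" using x by auto
        then have "induced_Brauer p M (carrier M) ?\<theta> x = (\<Sum>y\<in>carrier M. ?\<theta> x) / of_nat (card (carrier M))"
          using True afforded_conj[OF M fin rY _ x] by (simp add: induced_Brauer_def)
        then show ?thesis using fin one_closed by (auto simp: card_eq_0_iff)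
      next
        case False
        then show ?thesis by (simp add: induced_Brauer_def afforded_brauer_def)
      qed
    qed
    moreover have "?\<theta> \<in> Brauer_characters p red (M\<lparr>carrier := carrier M\<rparr>)"
      using rY by (auto simp: Brauer_characters_def)
    ultimately show ?thesis using subgroup_self by (auto simp: R_def)
  qed
  obtain U where U: "R U" and min: "\<And>V. R V \<Longrightarrow> card U \<le> card V"
    using ex_has_least_nat[of R "carrier M" card] R0 by blast
  have sU: "subgroup U M" using U by (simp add: R_def)
  have fU: "finite U" using subgroup.subset[OF sU] fin finite_subset by blast
  from U obtain \<psi> where \<psi>: "\<psi> \<in> Brauer_characters p red (M\<lparr>carrier := U\<rparr>)" "induced_Brauer p M U \<psi> = ?\<theta>"
    by (auto simp: R_def)
  then obtain m Z where Z: "\<psi> = afforded_brauer p red (M\<lparr>carrier := U\<rparr>) Z" "representation (M\<lparr>carrier := U\<rparr>) m Z"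
    by (auto simp: Brauer_characters_def)
  interpret I: induced_rep p red M U m Z by (rule induced_repI[OF M fin sU Z(2)])
  have "?\<theta> = afforded_brauer p red M I.Ind" using I.Ind_brauer \<psi>(2) Z(1) by simp
  from same_brauer_irreducible[OF M fin Y I.Ind_rep this]
  have "irreducible_representation (M\<lparr>carrier := U\<rparr>) m Z" by (rule I.irreducible_if_Ind_irreducible)
  then have "\<psi> \<in> IBr p red (M\<lparr>carrier := U\<rparr>)" using Z(1) by (auto simp: IBr_def)
  moreover have False if V: "subgroup V (M\<lparr>carrier := U\<rparr>)" "V \<noteq> U" "\<psi>' \<in> Brauer_characters p red (M\<lparr>carrier := V\<rparr>)"
    "induced_Brauer p (M\<lparr>carrier := U\<rparr>) V \<psi>' = \<psi>" for V \<psi>'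
  proof -
    have sV: "subgroup V M" "V \<subseteq> U" using V(1) sub_subgroup_iff[OF sU] by auto
    have "induced_Brauer p M V \<psi>' = ?\<theta>" using induced_Brauer_trans[OF fin sU sV, of p \<psi>'] V(4) \<psi>(2) by simp
    then have "R V" using sV V(3) by (auto simp: R_def)
    then have "card U \<le> card V" by (rule min)
    then show False using card_seteq[OF fU sV(2)] V(2) by simp
  qed
  ultimately have "primitive_Brauer p red (M\<lparr>carrier := U\<rparr>) \<psi>" by (auto simp: primitive_Brauer_def)
  then show ?thesis using that sU \<psi>(2) by blast
qed

text \<open>The cases are distinguished by irreducibility of the induced representation instead of
  stabilisers: its failure directly produces an intertwiner for some \<open>h\<close> outside
  \<open>M\<close>, and by maximality \<open>h\<close> and \<open>M\<close> generate
  \<open>G\<close>, as the extension requires.\<close>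

theorem maximal_normal_Mp:
  fixes G (structure)
  assumes Mp: "Mp_group p red G" and super: "super_monomial_group G" and M: "M \<lhd> G" "M \<noteq> carrier G"
    and max: "\<And>K. subgroup K G \<Longrightarrow> M \<subseteq> K \<Longrightarrow> K = M \<or> K = carrier G"
  shows "Mp_group p red (G\<lparr>carrier := M\<rparr>)"
proof -
  have G: "group G" and fin: "finite (carrier G)" using Mp by (auto simp: Mp_group_def)
  interpret group G by fact
  let ?M = "G\<lparr>carrier := M\<rparr>"
  have sM: "subgroup M G" using M(1) normal_imp_subgroup by blast
  have gM: "group ?M" and fM: "finite (carrier ?M)" using sub_group[OF sM] sub_finite[OF sM fin] by auto
  have "monomial_Brauer p red ?M \<theta>" if \<theta>: "\<theta> \<in> IBr p red ?M" for \<theta>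
  proof -
    obtain n Y where Y: "\<theta> = afforded_brauer p red ?M Y" "irreducible_representation ?M n Y"
      using \<theta> by (auto simp: IBr_def)
    have rY: "representation ?M n Y" using Y(2) by (simp add: irreducible_representation_iff)
    have \<theta>B: "\<theta> \<in> Brauer_characters p red ?M" using Y(1) rY by (auto simp: Brauer_characters_def)
    interpret I: induced_rep p red G M n Y by (rule induced_repI[OF G fin sM rY])
    show ?thesis
    proof (cases "irreducible_representation G (card (I.T \<times> {..<n})) I.Ind")
      case True
      let ?\<phi> = "afforded_brauer p red G I.Ind"
      have "?\<phi> \<in> IBr p red G" using True by (auto simp: IBr_def)
      then have sm: "super_monomial_Brauer p red G ?\<phi>" using super by (simp add: super_monomial_group_def)
      obtain U \<psi> where U: "subgroup U ?M" "primitive_Brauer p red (?M\<lparr>carrier := U\<rparr>) \<psi>"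
        "induced_Brauer p ?M U \<psi> = \<theta>"
        using exists_inducing_primitive[OF gM fM Y(2)] Y(1) by blast
      have sU: "subgroup U G" "U \<subseteq> M" using U(1) sub_subgroup_iff[OF sM] by auto
      have "induced_Brauer p G U \<psi> = ?\<phi>"
        using induced_Brauer_trans[OF fin sM sU, of p \<psi>] U(3) I.Ind_brauer Y(1) by simp
      then have "linear_Brauer p red (G\<lparr>carrier := U\<rparr>) \<psi>"
        using sm U(2) sU(1) by (auto simp: super_monomial_Brauer_def)
      then show ?thesis using \<theta>B U(1,3) by (auto simp: monomial_Brauer_def)
    next
      case False
      then obtain h L L' where h: "h \<in> carrier G" "h \<notin> M" and L: "mat_inv n L L'"
        "\<And>m. m \<in> M \<Longrightarrow> L * Y m = Y (h \<otimes> m \<otimes> inv h) * L"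
        using I.normal_dichotomy[OF M(1) Y(2)] by blast
      have gen: "K = carrier G" if "subgroup K G" "M \<subseteq> K" "h \<in> K" for K
        using max[OF that(1,2)] that(3) h(2) by blast
      obtain X where X: "representation G n X" "\<And>m. m \<in> M \<Longrightarrow> X m = Y m"
        using I.extension[OF M(1) Y(2) h L gen] by blast
      have XM: "irreducible_representation ?M n X"
        using Y(2) X(2) representation_restrict[OF sM X(1)] by (auto simp: irreducible_representation_iff)
      have irrX: "irreducible_representation G n X" unfolding irreducible_representation_iff
      proof (intro conjI X(1) allI impI)
        fix W assume W: "vsub n W \<and> (\<forall>g\<in>carrier G. \<forall>w\<in>W. X g *\<^sub>v w \<in> W)"
        then have "\<forall>g\<in>carrier ?M. \<forall>w\<in>W. X g *\<^sub>v w \<in> W" using subgroup.subset[OF sM] by auto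
        then show "W = {0\<^sub>v n} \<or> W = carrier_vec n"
          using XM W unfolding irreducible_representation_iff by blast
      qed
      let ?\<phi> = "afforded_brauer p red G X"
      have \<theta>\<phi>: "\<theta> g = (if g \<in> M then ?\<phi> g else 0)" for g
      proof -
        have "afforded_brauer p red ?M Y g = afforded_brauer p red ?M X g"
          using X(2) subgroup.subset[OF sM] by (auto simp: afforded_brauer_def p_regular_def)
        then show ?thesis using afforded_restrict[OF sM fin, of p red X g] Y(1) by simp
      qed
      have "?\<phi> \<in> IBr p red G" using irrX by (auto simp: IBr_def)
      then have "monomial_Brauer p red G ?\<phi>" using Mp by (auto simp: Mp_group_def)
      then obtain H l where H: "subgroup H G" and lin: "linear_Brauer p red (G\<lparr>carrier := H\<rparr>) l"
        and ind: "induced_Brauer p G H l = ?\<phi>" by (auto simp: monomial_Brauer_def)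
      obtain \<Lambda> where \<Lambda>: "representation (G\<lparr>carrier := H\<rparr>) 1 \<Lambda>" "l = afforded_brauer p red (G\<lparr>carrier := H\<rparr>) \<Lambda>"
        using linear_Brauer_representation[OF sub_group[OF H] lin] by blast
      interpret J: induced_rep p red G H 1 \<Lambda> by (rule induced_repI[OF G fin H \<Lambda>(1)])
      have eq: "?\<phi> = afforded_brauer p red G J.Ind" using J.Ind_brauer ind \<Lambda>(2) by simp
      \<comment> \<open>On \<open>M\<close> the representation induced from \<Lambda> has the
        character of the irreducible \<open>X\<close>, so its restriction to \<open>M\<close> is
        irreducible as well; this forces \<open>H\<close> and \<open>M\<close> to cover
        \<open>G\<close> by products.\<close>
      have "afforded_brauer p red ?M X = afforded_brauer p red ?M J.Ind"
        by (rule ext) (simp add: afforded_restrict[OF sM fin] eq)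
      from same_brauer_irreducible[OF gM fM XM representation_restrict[OF sM J.Ind_rep] this]
      have HM: "\<exists>h\<in>H. \<exists>m\<in>M. g = h \<otimes> m" if "g \<in> carrier G" for g
        using J.Ind_irreducible_restrict[OF sM _ that] by blast
      have sHM: "subgroup (H \<inter> M) G" by (rule subgroups_Inter_pair[OF H sM])
      let ?l = "\<lambda>u. if u \<in> H \<inter> M then l u else 0"
      have cl: "l (h \<otimes> u \<otimes> inv h) = l u" if "h \<in> H" "u \<in> H" for h u
        using J.theta_conj[OF that] \<Lambda>(2) by simp
      have "induced_Brauer p ?M (H \<inter> M) ?l = \<theta>"
      proof
        fix x
        show "induced_Brauer p ?M (H \<inter> M) ?l x = \<theta> x"
        proof (cases "x \<in> M")
          case True
          then show ?thesis using induced_Brauer_restrict[OF fin sM H HM cl True, of p] ind \<theta>\<phi> by simp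
        next
          case False
          then show ?thesis using \<theta>\<phi> sub_p_regular[OF sM fin] by (auto simp: induced_Brauer_def)
        qed
      qed
      moreover have "linear_Brauer p red (?M\<lparr>carrier := H \<inter> M\<rparr>) ?l"
      proof -
        let ?HM = "G\<lparr>carrier := H \<inter> M\<rparr>"
        have rep: "representation ?HM 1 \<Lambda>"
          using \<Lambda>(1) by (auto simp: representation_def)
        have "?l = afforded_brauer p red ?HM \<Lambda>"
          using sub_p_regular[OF sHM fin] sub_p_regular[OF H fin] \<Lambda>(2) by (auto simp: afforded_brauer_def)
        then have "?l \<in> Brauer_characters p red ?HM" using rep unfolding Brauer_characters_def by blast
        moreover have "?l \<one> = 1"
          using lin subgroup.one_closed[OF H] subgroup.one_closed[OF sM] by (simp add: linear_Brauer_def)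
        moreover have "\<one>\<^bsub>?M\<lparr>carrier := H \<inter> M\<rparr>\<^esub> = \<one>" "?M\<lparr>carrier := H \<inter> M\<rparr> = ?HM" by simp_all
        ultimately show ?thesis unfolding linear_Brauer_def by (simp only: simp_thms)
      qed
      moreover have "subgroup (H \<inter> M) ?M" using sub_subgroup_iff[OF sM] sHM by simp
      ultimately show ?thesis using \<theta>B by (auto simp: monomial_Brauer_def)
    qed
  qed
  then show ?thesis using gM fM by (auto simp: Mp_group_def)
qed

end

section \<open>Transport along isomorphisms\<close>

text \<open>Isomorphisms of finite groups, possibly between different element types.\<close>

definition giso :: "('c, 'd) monoid_scheme \<Rightarrow> ('a, 'b) monoid_scheme \<Rightarrow> ('c \<Rightarrow> 'a) \<Rightarrow> bool" where
  "giso K G g \<longleftrightarrow> group K \<and> group G \<and> finite (carrier G) \<and> bij_betw g (carrier K) (carrier G) \<and>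
     (\<forall>x\<in>carrier K. \<forall>y\<in>carrier K. g (x \<otimes>\<^bsub>K\<^esub> y) = g x \<otimes>\<^bsub>G\<^esub> g y)"

text \<open>The value 0 off the carrier matches the convention for Brauer characters, so that
  pulling back yields an equality of functions.\<close>

definition pull :: "('c \<Rightarrow> 'a) \<Rightarrow> ('c, 'd) monoid_scheme \<Rightarrow> ('a \<Rightarrow> complex) \<Rightarrow> 'c \<Rightarrow> complex" where
  "pull g K \<phi> k = (if k \<in> carrier K then \<phi> (g k) else 0)"

lemma gisoD:
  assumes "giso K G g"
  shows "group K" "group G" "finite (carrier G)" "finite (carrier K)" "bij_betw g (carrier K) (carrier G)"
    "\<And>x. x \<in> carrier K \<Longrightarrow> g x \<in> carrier G"
    "\<And>x y. x \<in> carrier K \<Longrightarrow> y \<in> carrier K \<Longrightarrow> g (x \<otimes>\<^bsub>K\<^esub> y) = g x \<otimes>\<^bsub>G\<^esub> g y"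
    "g \<one>\<^bsub>K\<^esub> = \<one>\<^bsub>G\<^esub>" "\<And>x. x \<in> carrier K \<Longrightarrow> g (inv\<^bsub>K\<^esub> x) = inv\<^bsub>G\<^esub> g x"
    "\<And>x (k::nat). x \<in> carrier K \<Longrightarrow> g (x [^]\<^bsub>K\<^esub> k) = g x [^]\<^bsub>G\<^esub> k"
    "\<And>x y. x \<in> carrier K \<Longrightarrow> y \<in> carrier K \<Longrightarrow> g x = g y \<longleftrightarrow> x = y"
    "\<And>y. y \<in> carrier G \<Longrightarrow> \<exists>x\<in>carrier K. g x = y"
proof -
  show K: "group K" and G: "group G" and fin: "finite (carrier G)" and b: "bij_betw g (carrier K) (carrier G)"
    and m: "\<And>x y. x \<in> carrier K \<Longrightarrow> y \<in> carrier K \<Longrightarrow> g (x \<otimes>\<^bsub>K\<^esub> y) = g x \<otimes>\<^bsub>G\<^esub> g y"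
    using assms by (auto simp: giso_def)
  show "finite (carrier K)" using bij_betw_finite[OF b] fin by simp
  show c: "g x \<in> carrier G" if "x \<in> carrier K" for x using b that by (auto simp: bij_betw_def)
  have "g \<in> hom K G" using c m by (auto simp: hom_def)
  then have gh: "group_hom K G g" using K G by (simp add: group_hom_def group_hom_axioms_def)
  show "g \<one>\<^bsub>K\<^esub> = \<one>\<^bsub>G\<^esub>" using group_hom.hom_one[OF gh] .
  show "g (inv\<^bsub>K\<^esub> x) = inv\<^bsub>G\<^esub> g x" if "x \<in> carrier K" for x using group_hom.hom_inv[OF gh that] .
  show "g (x [^]\<^bsub>K\<^esub> k) = g x [^]\<^bsub>G\<^esub> k" if "x \<in> carrier K" for x and k :: nat
    using group_hom.hom_nat_pow[OF gh that] .
  show "g x = g y \<longleftrightarrow> x = y" if "x \<in> carrier K" "y \<in> carrier K" for x y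
    using b that by (auto simp: bij_betw_def inj_on_def)
  show "\<exists>x\<in>carrier K. g x = y" if "y \<in> carrier G" for y
  proof -
    have "y \<in> g ` carrier K" using bij_betw_imp_surj_on[OF b] that by simp
    then show ?thesis by blast
  qed
qed

lemma giso_inverse:
  assumes "giso K G g" shows "giso G K (inv_into (carrier K) g)"
proof -
  note D = gisoD[OF assms]
  let ?h = "inv_into (carrier K) g"
  have b: "bij_betw ?h (carrier G) (carrier K)" using bij_betw_inv_into[OF D(5)] .
  have hc: "?h x \<in> carrier K" if "x \<in> carrier G" for x using b that by (auto simp: bij_betw_def)
  have gh: "g (?h x) = x" if "x \<in> carrier G" for x using bij_betw_inv_into_right[OF D(5) that] .
  have "?h (x \<otimes>\<^bsub>G\<^esub> y) = ?h x \<otimes>\<^bsub>K\<^esub> ?h y" if "x \<in> carrier G" "y \<in> carrier G" for x y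
  proof -
    have "g (?h x \<otimes>\<^bsub>K\<^esub> ?h y) = x \<otimes>\<^bsub>G\<^esub> y" using D(7) hc gh that by simp
    moreover have "?h x \<otimes>\<^bsub>K\<^esub> ?h y \<in> carrier K" using hc that D(1) by (simp add: group.is_monoid monoid.m_closed)
    ultimately show ?thesis using bij_betw_inv_into_left[OF D(5)] by metis
  qed
  then show ?thesis using D b by (simp add: giso_def)
qed

lemma giso_sub:
  assumes i: "giso K G g" and U: "subgroup U G"
  shows "subgroup {k \<in> carrier K. g k \<in> U} K" "giso (K\<lparr>carrier := {k \<in> carrier K. g k \<in> U}\<rparr>) (G\<lparr>carrier := U\<rparr>) g"
proof -
  note D = gisoD[OF i]
  interpret K: group K by (rule D(1))
  interpret G: group G by (rule D(2))
  let ?V = "{k \<in> carrier K. g k \<in> U}"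
  show V: "subgroup ?V K"
  proof (rule K.subgroupI)
    show "?V \<noteq> {}" using D(8) subgroup.one_closed[OF U] by force
  qed (use D subgroup.m_closed[OF U] subgroup.m_inv_closed[OF U] in auto)
  have "bij_betw g ?V U" unfolding bij_betw_def inj_on_def
  proof (intro conjI ballI impI)
    show "g ` ?V = U" using D(12) subgroup.subset[OF U] by blast
  qed (use D(11) in auto)
  then show "giso (K\<lparr>carrier := ?V\<rparr>) (G\<lparr>carrier := U\<rparr>) g"
    using K.sub_group[OF V] G.sub_group[OF U] G.sub_finite[OF U D(3)] D(7) by (simp add: giso_def)
qed

lemma giso_p_regular:
  assumes i: "giso K G g" and k: "k \<in> carrier K"
  shows "g k \<in> p_regular p G \<longleftrightarrow> k \<in> p_regular p K"
proof -
  note D = gisoD[OF i]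
  interpret K: group K by (rule D(1))
  have "g k [^]\<^bsub>G\<^esub> m = \<one>\<^bsub>G\<^esub> \<longleftrightarrow> k [^]\<^bsub>K\<^esub> m = \<one>\<^bsub>K\<^esub>" for m :: nat
    using D(8,10,11) k by (metis K.nat_pow_closed K.one_closed)
  then show ?thesis using p_regular_iff[OF D(1,4)] p_regular_iff[OF D(2,3)] D(6) k by auto
qed

lemma giso_representation:
  assumes i: "giso K G g" and X: "representation G n X" shows "representation K n (X \<circ> g)"
  using gisoD[OF i] representationD[OF X] by (simp add: representation_def)

lemma giso_irreducible:
  assumes i: "giso K G g" and X: "irreducible_representation G n X" shows "irreducible_representation K n (X \<circ> g)"
proof -
  note D = gisoD[OF i]
  have inv: "X a *\<^sub>v w \<in> W" if st: "\<forall>a\<in>carrier K. \<forall>w\<in>W. (X \<circ> g) a *\<^sub>v w \<in> W" and a: "a \<in> carrier G" and w: "w \<in> W" for W a w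
  proof -
    obtain k where "k \<in> carrier K" "g k = a" using D(12)[OF a] by blast
    then show ?thesis using st w by auto
  qed
  have irr: "vsub n W \<Longrightarrow> \<forall>a\<in>carrier G. \<forall>w\<in>W. X a *\<^sub>v w \<in> W \<Longrightarrow> W = {0\<^sub>v n} \<or> W = carrier_vec n" for W
    using X unfolding irreducible_representation_iff by blast
  have rX: "representation G n X" using X by (simp add: irreducible_representation_iff)
  show ?thesis unfolding irreducible_representation_iff
    using giso_representation[OF i rX] irr inv by blast
qed

lemma pull_afforded:
  assumes i: "giso K G g" shows "pull g K (afforded_brauer p red G X) = afforded_brauer p red K (X \<circ> g)"
proof
  fix k
  show "pull g K (afforded_brauer p red G X) k = afforded_brauer p red K (X \<circ> g) k"
    using giso_p_regular[OF i, of k p] by (auto simp: pull_def afforded_brauer_def p_regular_def)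
qed

lemma pull_Brauer_characters:
  "giso K G g \<Longrightarrow> \<phi> \<in> Brauer_characters p red G \<Longrightarrow> pull g K \<phi> \<in> Brauer_characters p red K"
  unfolding Brauer_characters_def using giso_representation pull_afforded by fast

lemma pull_IBr: "giso K G g \<Longrightarrow> \<phi> \<in> IBr p red G \<Longrightarrow> pull g K \<phi> \<in> IBr p red K"
  unfolding IBr_def using giso_irreducible pull_afforded by fast

lemma IBr_Brauer_characters: "\<phi> \<in> IBr p red G \<Longrightarrow> \<phi> \<in> Brauer_characters p red G"
  by (auto simp: IBr_def Brauer_characters_def irreducible_representation_def)

lemma Brauer_characters_outside: "\<phi> \<in> Brauer_characters p red G \<Longrightarrow> x \<notin> carrier G \<Longrightarrow> \<phi> x = 0"
  by (auto simp: Brauer_characters_def afforded_brauer_def p_regular_def)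

lemma pull_inverse:
  assumes i: "giso K G g" and out: "\<And>x. x \<notin> carrier G \<Longrightarrow> \<phi> x = 0"
  shows "pull (inv_into (carrier K) g) G (pull g K \<phi>) = \<phi>"
proof
  fix x
  note D = gisoD[OF i] and D' = gisoD[OF giso_inverse[OF i]]
  show "pull (inv_into (carrier K) g) G (pull g K \<phi>) x = \<phi> x"
    using D'(6)[of x] bij_betw_inv_into_right[OF D(5), of x] out[of x] by (auto simp: pull_def)
qed

lemma pull_inverse':
  assumes i: "giso K G g" and out: "\<And>x. x \<notin> carrier K \<Longrightarrow> \<phi> x = 0"
  shows "pull g K (pull (inv_into (carrier K) g) G \<phi>) = \<phi>"
proof
  fix x
  note D = gisoD[OF i]
  show "pull g K (pull (inv_into (carrier K) g) G \<phi>) x = \<phi> x"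
    using D(6)[of x] bij_betw_inv_into_left[OF D(5), of x] out[of x] by (auto simp: pull_def)
qed

lemma pull_induced:
  assumes i: "giso K G g" and U: "subgroup U G"
  defines "V \<equiv> {k \<in> carrier K. g k \<in> U}"
  shows "pull g K (induced_Brauer p G U \<psi>) = induced_Brauer p K V (pull g (K\<lparr>carrier := V\<rparr>) \<psi>)"
proof
  fix x
  note D = gisoD[OF i]
  interpret K: group K by (rule D(1))
  show "pull g K (induced_Brauer p G U \<psi>) x = induced_Brauer p K V (pull g (K\<lparr>carrier := V\<rparr>) \<psi>) x"
  proof (cases "x \<in> p_regular p K")
    case True
    then have x: "x \<in> carrier K" by (simp add: p_regular_def)
    have gx: "g x \<in> p_regular p G" using giso_p_regular[OF i x] True by simp
    have c: "g (y \<otimes>\<^bsub>K\<^esub> x \<otimes>\<^bsub>K\<^esub> inv\<^bsub>K\<^esub> y) = g y \<otimes>\<^bsub>G\<^esub> g x \<otimes>\<^bsub>G\<^esub> inv\<^bsub>G\<^esub> g y" if "y \<in> carrier K" for y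
      using D(7,9) x that by simp
    have "(\<Sum>y\<in>{y \<in> carrier G. y \<otimes>\<^bsub>G\<^esub> g x \<otimes>\<^bsub>G\<^esub> inv\<^bsub>G\<^esub> y \<in> U}. \<psi> (y \<otimes>\<^bsub>G\<^esub> g x \<otimes>\<^bsub>G\<^esub> inv\<^bsub>G\<^esub> y))
      = (\<Sum>y\<in>{y \<in> carrier K. y \<otimes>\<^bsub>K\<^esub> x \<otimes>\<^bsub>K\<^esub> inv\<^bsub>K\<^esub> y \<in> V}. pull g (K\<lparr>carrier := V\<rparr>) \<psi> (y \<otimes>\<^bsub>K\<^esub> x \<otimes>\<^bsub>K\<^esub> inv\<^bsub>K\<^esub> y))"
    proof (rule sum.reindex_bij_witness[of _ g "inv_into (carrier K) g"])
      fix y assume y: "y \<in> {y \<in> carrier G. y \<otimes>\<^bsub>G\<^esub> g x \<otimes>\<^bsub>G\<^esub> inv\<^bsub>G\<^esub> y \<in> U}"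
      then show e: "g (inv_into (carrier K) g y) = y" using bij_betw_inv_into_right[OF D(5)] by simp
      have hc: "inv_into (carrier K) g y \<in> carrier K" using gisoD(6)[OF giso_inverse[OF i]] y by simp
      show "inv_into (carrier K) g y \<in> {y \<in> carrier K. y \<otimes>\<^bsub>K\<^esub> x \<otimes>\<^bsub>K\<^esub> inv\<^bsub>K\<^esub> y \<in> V}"
        using hc c[OF hc] e y x by (simp add: V_def)
      show "pull g (K\<lparr>carrier := V\<rparr>) \<psi> (inv_into (carrier K) g y \<otimes>\<^bsub>K\<^esub> x \<otimes>\<^bsub>K\<^esub> inv\<^bsub>K\<^esub> inv_into (carrier K) g y)
        = \<psi> (y \<otimes>\<^bsub>G\<^esub> g x \<otimes>\<^bsub>G\<^esub> inv\<^bsub>G\<^esub> y)"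
        using hc c[OF hc] e y x by (simp add: pull_def V_def)
    next
      fix y assume y: "y \<in> {y \<in> carrier K. y \<otimes>\<^bsub>K\<^esub> x \<otimes>\<^bsub>K\<^esub> inv\<^bsub>K\<^esub> y \<in> V}"
      then show "inv_into (carrier K) g (g y) = y" using bij_betw_inv_into_left[OF D(5)] by simp
      show "g y \<in> {y \<in> carrier G. y \<otimes>\<^bsub>G\<^esub> g x \<otimes>\<^bsub>G\<^esub> inv\<^bsub>G\<^esub> y \<in> U}"
        using y c[of y] D(6) by (simp add: V_def)
    qed
    moreover have "card V = card U"
      using bij_betw_same_card[OF gisoD(5)[OF giso_sub(2)[OF i U]]] by (simp add: V_def)
    ultimately show ?thesis using True gx x by (simp add: pull_def induced_Brauer_def)
  next
    case False
    then show ?thesis using giso_p_regular[OF i, of x p] by (auto simp: pull_def induced_Brauer_def)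
  qed
qed

lemma giso_Mp:
  assumes i: "giso K G g" and Mp: "Mp_group p red G" shows "Mp_group p red K"
proof -
  note D = gisoD[OF i]
  let ?h = "inv_into (carrier K) g"
  have "monomial_Brauer p red K \<phi>" if \<phi>: "\<phi> \<in> IBr p red K" for \<phi>
  proof -
    have \<phi>B: "\<phi> \<in> Brauer_characters p red K" by (rule IBr_Brauer_characters[OF \<phi>])
    have "pull ?h G \<phi> \<in> IBr p red G" by (rule pull_IBr[OF giso_inverse[OF i] \<phi>])
    then have "monomial_Brauer p red G (pull ?h G \<phi>)" using Mp by (simp add: Mp_group_def)
    then obtain H l where H: "subgroup H G" and l: "linear_Brauer p red (G\<lparr>carrier := H\<rparr>) l"
      and ind: "induced_Brauer p G H l = pull ?h G \<phi>" by (auto simp: monomial_Brauer_def)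
    let ?V = "{k \<in> carrier K. g k \<in> H}"
    let ?l = "pull g (K\<lparr>carrier := ?V\<rparr>) l"
    have "induced_Brauer p K ?V ?l = \<phi>"
      using pull_induced[OF i H, of p l] ind pull_inverse'[OF i Brauer_characters_outside[OF \<phi>B]] by simp
    moreover have "linear_Brauer p red (K\<lparr>carrier := ?V\<rparr>) ?l"
      using l pull_Brauer_characters[OF giso_sub(2)[OF i H]] subgroup.one_closed[OF giso_sub(1)[OF i H]] D(8)
      by (auto simp: linear_Brauer_def pull_def)
    ultimately show ?thesis using giso_sub(1)[OF i H] \<phi>B by (auto simp: monomial_Brauer_def)
  qed
  then show ?thesis using D by (simp add: Mp_group_def)
qed

text \<open>Primitivity has to survive the transport to \<open>K\<close>: a character of a proper
  subgroup inducing the pulled-back character would return along the inverse isomorphism and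
  contradict primitivity of the original.\<close>

lemma giso_super_monomial:
  assumes i: "giso K G g" and super: "super_Mp_group p red K" and \<phi>: "\<phi> \<in> IBr p red G"
  shows "super_monomial_Brauer p red G \<phi>"
  unfolding super_monomial_Brauer_def
proof (intro conjI \<phi> allI impI, elim conjE)
  fix U \<psi> assume U: "subgroup U G" and prim: "primitive_Brauer p red (G\<lparr>carrier := U\<rparr>) \<psi>"
    and ind: "induced_Brauer p G U \<psi> = \<phi>"
  note D = gisoD[OF i]
  let ?V = "{k \<in> carrier K. g k \<in> U}"
  let ?KV = "K\<lparr>carrier := ?V\<rparr>"
  let ?GU = "G\<lparr>carrier := U\<rparr>"
  let ?\<psi> = "pull g ?KV \<psi>"
  let ?h = "inv_into (carrier ?KV) g"
  have iV: "giso ?KV ?GU g" and V: "subgroup ?V K" using giso_sub[OF i U] by auto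
  have iV': "giso ?GU ?KV ?h" by (rule giso_inverse[OF iV])
  have \<psi>I: "\<psi> \<in> IBr p red ?GU" using prim by (simp add: primitive_Brauer_def)
  have \<psi>B: "\<psi> \<in> Brauer_characters p red ?GU" by (rule IBr_Brauer_characters[OF \<psi>I])
  have "primitive_Brauer p red ?KV ?\<psi>" unfolding primitive_Brauer_def
  proof (intro conjI pull_IBr[OF iV \<psi>I] notI, elim exE conjE)
    fix W \<psi>' assume W: "subgroup W ?KV" "W \<noteq> carrier ?KV" "\<psi>' \<in> Brauer_characters p red (?KV\<lparr>carrier := W\<rparr>)"
      and ind': "induced_Brauer p ?KV W \<psi>' = ?\<psi>"
    let ?W = "{k \<in> carrier ?GU. ?h k \<in> W}"
    have "induced_Brauer p ?GU ?W (pull ?h (?GU\<lparr>carrier := ?W\<rparr>) \<psi>') = \<psi>"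
      using pull_induced[OF iV' W(1), of p \<psi>'] ind' pull_inverse[OF iV Brauer_characters_outside[OF \<psi>B]] by simp
    moreover have "subgroup ?W ?GU" by (rule giso_sub(1)[OF iV' W(1)])
    moreover have "pull ?h (?GU\<lparr>carrier := ?W\<rparr>) \<psi>' \<in> Brauer_characters p red (?GU\<lparr>carrier := ?W\<rparr>)"
      by (rule pull_Brauer_characters[OF giso_sub(2)[OF iV' W(1)] W(3)])
    moreover have "?W \<noteq> carrier ?GU"
    proof
      assume e: "?W = carrier ?GU"
      have "carrier ?KV \<subseteq> W"
      proof
        fix k assume k: "k \<in> carrier ?KV"
        then obtain u where "u \<in> carrier ?GU" "?h u = k" using gisoD(12)[OF iV' k] by blast
        then show "k \<in> W" using e by blast
      qed
      then show False using W(2) subgroup.subset[OF W(1)] by blast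
    qed
    ultimately show False using prim unfolding primitive_Brauer_def by blast
  qed
  moreover have "induced_Brauer p K ?V ?\<psi> = pull g K \<phi>" using pull_induced[OF i U, of p \<psi>] ind by simp
  moreover have "super_monomial_Brauer p red K (pull g K \<phi>)"
    using super pull_IBr[OF i \<phi>] by (simp add: super_Mp_group_def)
  ultimately have "linear_Brauer p red ?KV ?\<psi>" using V by (simp add: super_monomial_Brauer_def)
  then have "?\<psi> \<one>\<^bsub>K\<^esub> = 1" by (simp add: linear_Brauer_def)
  then have "\<psi> \<one>\<^bsub>G\<^esub> = 1" using D(8) subgroup.one_closed[OF V] by (simp add: pull_def)
  then show "linear_Brauer p red ?GU \<psi>" using \<psi>B by (simp add: linear_Brauer_def)
qed

lemma giso_nat_exists:
  assumes G: "group G" and fin: "finite (carrier G)"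
  obtains K :: "nat monoid" and g where "giso K G g" "card (carrier K) = card (carrier G)"
proof -
  interpret group G by fact
  obtain f where f: "bij_betw f (carrier G) {0..<card (carrier G)}"
    using ex_bij_betw_finite_nat[OF fin] by blast
  define g where "g = inv_into (carrier G) f"
  let ?C = "{0..<card (carrier G)}"
  have g: "bij_betw g ?C (carrier G)" unfolding g_def by (rule bij_betw_inv_into[OF f])
  define K where "K = \<lparr>carrier = ?C, monoid.mult = (\<lambda>x y. f (g x \<otimes>\<^bsub>G\<^esub> g y)), one = f \<one>\<^bsub>G\<^esub>\<rparr>"
  have gc: "g x \<in> carrier G" if "x \<in> ?C" for x using g that by (auto simp: bij_betw_def)
  have fc: "f x \<in> ?C" if "x \<in> carrier G" for x using f that by (auto simp: bij_betw_def)
  have gf: "g (f x) = x" if "x \<in> carrier G" for x unfolding g_def by (rule bij_betw_inv_into_left[OF f that])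
  have fg: "f (g x) = x" if "x \<in> ?C" for x unfolding g_def by (rule bij_betw_inv_into_right[OF f that])
  have "group K"
  proof (rule groupI)
    fix x y assume "x \<in> carrier K" "y \<in> carrier K"
    then show "x \<otimes>\<^bsub>K\<^esub> y \<in> carrier K" using fc gc by (simp add: K_def del: atLeastLessThan_iff)
  next
    show "\<one>\<^bsub>K\<^esub> \<in> carrier K" using fc by (simp add: K_def del: atLeastLessThan_iff)
  next
    fix x y z assume "x \<in> carrier K" "y \<in> carrier K" "z \<in> carrier K"
    then show "x \<otimes>\<^bsub>K\<^esub> y \<otimes>\<^bsub>K\<^esub> z = x \<otimes>\<^bsub>K\<^esub> (y \<otimes>\<^bsub>K\<^esub> z)"
      using gc gf by (simp add: K_def m_assoc del: atLeastLessThan_iff)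
  next
    fix x assume "x \<in> carrier K"
    then have x: "x \<in> ?C" by (simp add: K_def)
    show "\<one>\<^bsub>K\<^esub> \<otimes>\<^bsub>K\<^esub> x = x" using gc[OF x] gf fg[OF x] by (simp add: K_def)
    have "f (inv\<^bsub>G\<^esub> g x) \<otimes>\<^bsub>K\<^esub> x = \<one>\<^bsub>K\<^esub>" using gc[OF x] gf by (simp add: K_def)
    moreover have "f (inv\<^bsub>G\<^esub> g x) \<in> carrier K" using fc gc[OF x] by (simp add: K_def del: atLeastLessThan_iff)
    ultimately show "\<exists>y\<in>carrier K. y \<otimes>\<^bsub>K\<^esub> x = \<one>\<^bsub>K\<^esub>" by blast
  qed
  then have "giso K G g" using G fin g gf gc by (simp add: giso_def K_def del: atLeastLessThan_iff)
  then show ?thesis using that by (simp add: K_def)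
qed

section \<open>Induction on the order of the group\<close>

text \<open>A maximal normal \<open>M\<close> above a proper \<open>N\<close> is an M_p-group of
  smaller order, odd by Lagrange, and \<open>N\<close> is normal in it. The assumption on
  natural-number groups reaches \<open>G\<close> through a copy of \<open>G\<close>.\<close>

theorem (in brauer) normal_subgroup_Mp:
  fixes G :: "'a monoid"
  assumes hyp: "\<forall>K :: nat monoid. Mp_group p red K \<and> odd (card (carrier K)) \<longrightarrow> super_Mp_group p red K"
  shows "Mp_group p red G \<Longrightarrow> odd (card (carrier G)) \<Longrightarrow> N \<lhd> G \<Longrightarrow> Mp_group p red (G\<lparr>carrier := N\<rparr>)"
proof (induction "card (carrier G)" arbitrary: G rule: less_induct)
  case less
  note Mp = less.prems(1) and odd = less.prems(2) and N = less.prems(3)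
  have G: "group G" and fin: "finite (carrier G)" using Mp by (auto simp: Mp_group_def)
  interpret group G by fact
  show ?case
  proof (cases "N = carrier G")
    case True
    then show ?thesis using Mp by simp
  next
    case False
    obtain M where M: "M \<lhd> G" "N \<subseteq> M" "M \<noteq> carrier G"
      and max: "\<And>K. subgroup K G \<Longrightarrow> M \<subseteq> K \<Longrightarrow> K = M \<or> K = carrier G"
      using Mp_maximal_normal[OF Mp N False] by blast
    have sM: "subgroup M G" using M(1) normal_imp_subgroup by blast
    obtain K :: "nat monoid" and g where i: "giso K G g" and c: "card (carrier K) = card (carrier G)"
      using giso_nat_exists[OF G fin] by blast
    have "super_Mp_group p red K" using hyp giso_Mp[OF i Mp] c odd by simp
    then have "super_monomial_group G"
      unfolding super_monomial_group_def using giso_super_monomial[OF i] by blast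
    then have MpM: "Mp_group p red (G\<lparr>carrier := M\<rparr>)" by (rule maximal_normal_Mp[OF Mp _ M(1,3) max])
    have "card M dvd card (carrier G)"
    proof -
      have "card (carrier G) = card (rcosets\<^bsub>G\<^esub> M) * card M" using lagrange[OF sM] by (simp add: Coset.order_def)
      then show ?thesis by simp
    qed
    then have "odd (card M)" using odd dvd_trans by blast
    moreover have "card M < card (carrier G)"
      using subgroup.subset[OF sM] M(3) by (intro psubset_card_mono fin) auto
    moreover have "N \<lhd> G\<lparr>carrier := M\<rparr>"
      unfolding group.normal_inv_iff[OF sub_group[OF sM]]
      using sub_subgroup_iff[OF sM, of N] normal_imp_subgroup[OF N] M(2) normal.inv_op_closed2[OF N]
        sub_inv[OF sM] subgroup.subset[OF sM] by auto
    ultimately have "Mp_group p red (G\<lparr>carrier := M\<rparr>\<lparr>carrier := N\<rparr>)"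
      using less.hyps[of "G\<lparr>carrier := M\<rparr>"] MpM by simp
    then show ?thesis by simp
  qed
qed

theorem theorem1p3:
  fixes p :: nat and red :: "complex \<Rightarrow> 'k::field"
    and G :: "'a monoid" and N :: "'a set"
  assumes "prime p"
    and "brauer_reduction p red"
    and "\<forall>K :: nat monoid. Mp_group p red K \<and> odd (card (carrier K)) \<longrightarrow> super_Mp_group p red K"
    and "Mp_group p red G" and "odd (card (carrier G))" and "N \<lhd> G"
  shows "Mp_group p red (G\<lparr>carrier := N\<rparr>)"
proof -
  interpret brauer p red by unfold_locales fact+
  show ?thesis by (rule normal_subgroup_Mp[OF assms(3-6)])
qed

end
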